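(* Let $F$ be the cyclic quartic field defined by $a,b,c,d$ and let $p$ be a prime. There is a unique prime ideal of $\mathcal{O}_F$ above $p$ if and only if one of the following conditions is satisfied: (i) $p\mid d$; (ii) $p\mid a$ and $d$ is a quadratic non-residue modulo $p$; (iii) $p\nmid abcd$ and $d$ is a quadratic non-residue modulo $p$. Moreover, let $P$ denote the unique prime ideal of $\mathcal{O}_F$ above $p$, where well-roundedness is considered only when $P$ is primitive (so in cases (i) and (ii)). Then $P$ is well-rounded if and only if the following conditions are satisfied. In case (i): $d\equiv 1\pmod 4$, $b\equiv 0\pmod 2$, $a+b\equiv 1\pmod 4$ and one of the following holds: $|a|=1$ and $\frac15 d\le p^2\le 5d$; or $|a|=3$ and $d\le p^2\le 9d$; or $|a|=5$ and $\frac73 d\le p^2\le 5d$. In case (ii): $d=5$, $b=2$, $c=1$ and $|a|\le p^2\le 5|a|$.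
   Context: Cyclic quartic fields: $a,b,c,d$ are integers with $a$ squarefree and odd, $d=b^2+c^2$ squarefree, $b>0$, $c>0$, $\gcd(a,d)=1$; $\beta=\sqrt{a(d-b\sqrt d)}$ and $F=\mathbb{Q}(\beta)$, with defining polynomial $x^4-2adx^2+a^2c^2d$. $F$ is a cyclic quartic field, totally real if $a>0$ and totally imaginary if $a<0$. All ideals are nonzero integral ideals of the ring of integers $\mathcal{O}_F$; an ideal is primitive if it is not contained in $n\mathcal{O}_F$ for any integer $n\ge2$. Well-roundedness is only considered for primitive ideals; in case (iii) the prime ideal is $p\mathcal{O}_F$, which is not primitive. An ideal is viewed as a full rank lattice in $F\otimes\mathbb{R}\cong\mathbb{R}^4$ with Euclidean norm $\|\delta\|^2=\sum_{\tau}|\tau(\delta)|^2$, the sum over all four embeddings $\tau:F\to\mathbb{C}$. A full rank lattice in $\mathbb{R}^n$ is well-rounded (WR) if its nonzero vectors of minimal norm contain $n$ linearly independent vectors.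
   Formalization: The formal theorem excludes p=2 with d≡5 (mod 8) from the uniqueness equivalence (there 2 has a unique prime but (i)–(iii) all fail) and adds a+b≡1 (mod 4) to the conditions in case (ii) (a=-3, b=2, c=1, d=5, p=3 is otherwise a counterexample). *)

theory Defs
  imports
    "HOL-Algebra.Generated_Fields"
    "HOL-Algebra.Algebraic_Closure_Type"
    "HOL-Analysis.Analysis"
    "HOL-Number_Theory.Number_Theory"
begin

abbreviation complex_ring :: "complex ring"
  where "complex_ring \<equiv> ring_of_type_algebra"

definition quartic_beta :: "int \<Rightarrow> int \<Rightarrow> int \<Rightarrow> complex"
  where "quartic_beta a b d =
    csqrt (complex_of_real (of_int a * (of_int d - of_int b * sqrt (of_int d))))"

text \<open>Generating a subfield of the complex numbers automatically adjoins the rationals,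
  so this is the field obtained from the rationals by adjoining beta.\<close>
definition quartic_field :: "int \<Rightarrow> int \<Rightarrow> int \<Rightarrow> complex set"
  where "quartic_field a b d = generate_field complex_ring {quartic_beta a b d}"

definition ring_of_integers :: "complex set \<Rightarrow> complex ring"
  where "ring_of_integers F = complex_ring\<lparr>carrier := {x \<in> F. algebraic_int x}\<rparr>"

definition prime_above :: "complex set \<Rightarrow> nat \<Rightarrow> complex set \<Rightarrow> bool"
  where "prime_above F p P \<longleftrightarrow> primeideal P (ring_of_integers F) \<and> of_nat p \<in> P"

definition primitive_ideal :: "complex set \<Rightarrow> complex set \<Rightarrow> bool"
  where "primitive_ideal F I \<longleftrightarrow>
    \<not> (\<exists>n::nat. n \<ge> 2 \<and> I \<subseteq> (\<lambda>x. of_nat n * x) ` carrier (ring_of_integers F))"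

text \<open>Maps are required to be extensional, so that two embeddings are equal as soon as
  they agree on \<open>F\<close>.\<close>
definition embeddings :: "complex set \<Rightarrow> (complex \<Rightarrow> complex) set"
  where "embeddings F = ring_hom (complex_ring\<lparr>carrier := F\<rparr>) complex_ring \<inter> extensional F"

definition minimal_vectors :: "'a::euclidean_space set \<Rightarrow> 'a set"
  where "minimal_vectors L = {v. is_arg_min norm (\<lambda>u. u \<in> L \<and> u \<noteq> 0) v}"

text \<open>\<open>L\<close> is a lattice of rank \<open>n\<close>, possibly in a space of larger dimension; it has
  full rank in its real span.\<close>
definition well_rounded :: "nat \<Rightarrow> 'a::euclidean_space set \<Rightarrow> bool"
  where "well_rounded n L \<longleftrightarrow>
    (\<exists>B \<subseteq> minimal_vectors L. independent B \<and> card B = n)"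

text \<open>For a quartic field \<open>F\<close>, the tensor product of \<open>F\<close> with the reals is the real span
  (of dimension 4) of the image of \<open>F\<close> under the tuple of its four embeddings; on it
  the norm of \<open>complex ^ 4\<close> is the square root of the sum of the squared absolute values of
  the conjugates. The choice of the enumeration \<open>e\<close> only permutes coordinates.\<close>
definition well_rounded_ideal :: "complex set \<Rightarrow> complex set \<Rightarrow> bool"
  where "well_rounded_ideal F I \<longleftrightarrow>
    (\<exists>e :: 4 \<Rightarrow> complex \<Rightarrow> complex. bij_betw e UNIV (embeddings F) \<and>
       well_rounded 4 ((\<lambda>x. (\<chi> i. e i x) :: complex ^ 4) ` I))"

end

theory Submission
  imports Defs "Jordan_Normal_Form.Char_Poly"
begin

text \<open>
  Let \<open>s\<close> be the square root of \<open>d\<close> and let \<open>\<gamma>\<close> be the conjugate of \<open>\<beta>\<close> with \<open>\<beta> \<gamma> = a c s\<close>.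
  Since \<open>d = b\<^sup>2 + c\<^sup>2\<close>, the four numbers \<open>1, s, \<beta>, \<gamma>\<close> have integer structure constants:
  \<open>s \<beta> = - b \<beta> + c \<gamma>\<close>, \<open>s \<gamma> = c \<beta> + b \<gamma>\<close>, \<open>\<beta>\<^sup>2 = a (d - b s)\<close>, \<open>\<gamma>\<^sup>2 = a (d + b s)\<close>.
  So \<open>F\<close> consists of the \<open>E x y z w = x + y s + z \<beta> + w \<gamma>\<close> with rational coordinates, and
  \<open>s \<mapsto> -s, \<beta> \<mapsto> \<gamma>, \<gamma> \<mapsto> -\<beta>\<close> generates its Galois group. This basis is orthogonal for the
  sum over the embeddings: the squared length of \<open>E x y z w\<close> is
  \<open>4 (x\<^sup>2 + d y\<^sup>2 + \<bar>a\<bar> d (z\<^sup>2 + w\<^sup>2))\<close> (\<open>sum_cmod_embeddings\<close>). The whole theorem is thereby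
  reduced to statements about four rational coordinates.

  The integers of \<open>F\<close>. Traces and norms to \<open>K = \<rat>(s)\<close> show that integers have coordinates in
  \<open>\<int>/4\<close>, and parity arguments give the exact conditions. If \<open>d\<close> is odd, \<open>b\<close> even and
  \<open>a + b \<equiv> 1 (mod 4)\<close>, and the sign of \<open>c\<close> is chosen so that \<open>a c \<equiv> 1 (mod 4)\<close>, they are: the four
  coordinates, multiplied by 4, have equal parity and a sum divisible by 4 (\<open>integers_b_even\<close>,
  \<open>integers_quarter\<close>). In all other cases the ring of integers is the
  orthogonal sum of a part in \<open>K\<close> and a part in the span of \<open>\<beta>, \<gamma>\<close>.

  The primes. As \<open>F\<close> is cyclic over \<open>\<rat>\<close> with \<open>K\<close> as only intermediate field, there is a single
  prime above \<open>p\<close> unless \<open>p\<close> splits in \<open>K\<close>. Concretely, modulo \<open>p\<close> the norm form of \<open>F\<close> vanishes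
  exactly where the first coordinate vanishes (if \<open>p\<close> divides \<open>d\<close>), where the first two vanish
  (if \<open>p\<close> divides \<open>a\<close> and \<open>d\<close> is a nonresidue) or only at 0 (if \<open>p\<close> does not divide \<open>a\<close> and \<open>d\<close> is a
  nonresidue). In each case the integers with norm divisible by \<open>p\<close> are closed under addition,
  hence form an ideal, and it is prime because the norm is multiplicative
  (\<open>prime_above_norm_ideal\<close>); every prime above \<open>p\<close> equals it (\<open>prime_above_eq_norm_ideal\<close>).
  If \<open>p\<close> splits in \<open>K\<close>, a unique prime would be stable under conjugation, which is impossible
  (\<open>not_unique_if_residue\<close>, \<open>not_unique_two_if_split\<close>).

  Well-roundedness. The ideal is given by divisibility of the first one or two coordinates. Four
  independent minimal vectors cannot lie in a coordinate hyperplane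
  (\<open>well_rounded_coordinates\<close>); where the ring of integers is an orthogonal sum, comparing a few
  short vectors shows that they do. In the remaining case the ideal is, in units of quarters and
  up to scaling of the axes, twice the lattice \<open>D\<^sub>4\<close> together with the glue vectors all of whose
  coordinates are odd. It is well-rounded exactly if its shortest odd vectors, all coordinates \<open>\<plusminus>1\<close>,
  are minimal (\<open>glue_necessary\<close>, \<open>glue_sufficient\<close>), and comparing them with the short even
  vectors gives the inequalities between \<open>p\<^sup>2\<close>, \<open>d\<close> and \<open>\<bar>a\<bar>\<close>.
\<close>

section \<open>Algebraic integers form a ring\<close>

definition int_span :: "complex set \<Rightarrow> complex set"
  where "int_span S = {\<Sum>s\<in>S. of_int (c s) * s |c. True}"

lemma int_span_add: "x \<in> int_span S \<Longrightarrow> y \<in> int_span S \<Longrightarrow> x + y \<in> int_span S"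
  unfolding int_span_def
proof clarsimp
  fix c c' :: "complex \<Rightarrow> int"
  show "\<exists>e. (\<Sum>s\<in>S. of_int (c s) * s) + (\<Sum>s\<in>S. of_int (c' s) * s) = (\<Sum>s\<in>S. of_int (e s) * s)"
    by (rule exI[of _ "\<lambda>s. c s + c' s"]) (simp add: sum.distrib algebra_simps)
qed

lemma int_span_scale: "x \<in> int_span S \<Longrightarrow> of_int k * x \<in> int_span S"
  unfolding int_span_def
proof clarsimp
  fix c :: "complex \<Rightarrow> int"
  show "\<exists>e. of_int k * (\<Sum>s\<in>S. of_int (c s) * s) = (\<Sum>s\<in>S. of_int (e s) * s)"
    by (rule exI[of _ "\<lambda>s. k * c s"]) (simp add: sum_distrib_left algebra_simps)
qed

lemma int_span_base:
  assumes "finite S" "x \<in> S"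
  shows "x \<in> int_span S"
proof -
  have "(\<Sum>s\<in>S. of_int (if s = x then 1 else 0) * s) = (\<Sum>s\<in>S. if s = x then s else 0)"
    by (rule sum.cong) auto
  also have "\<dots> = x" using assms by simp
  finally show ?thesis
    unfolding int_span_def by (intro CollectI exI[of _ "\<lambda>s. if s = x then 1 else 0"]) simp
qed

lemma int_span_0: "0 \<in> int_span S"
  unfolding int_span_def by (rule CollectI, rule exI[of _ "\<lambda>s. 0"]) simp

lemma int_span_sum: "(\<And>i. i \<in> I \<Longrightarrow> f i \<in> int_span S) \<Longrightarrow> (\<Sum>i\<in>I. f i) \<in> int_span S"
  by (induction I rule: infinite_finite_induct) (auto intro: int_span_0 int_span_add)

lemma int_span_mult_closed:
  assumes "\<And>s. s \<in> S \<Longrightarrow> x * s \<in> int_span S" and "m \<in> int_span S"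
  shows "x * m \<in> int_span S"
proof -
  from assms(2) obtain c where m: "m = (\<Sum>s\<in>S. of_int (c s) * s)"
    unfolding int_span_def by auto
  have "x * m = (\<Sum>s\<in>S. of_int (c s) * (x * s))"
    by (simp add: m sum_distrib_left algebra_simps)
  also have "\<dots> \<in> int_span S"
    by (intro int_span_sum int_span_scale assms(1))
  finally show ?thesis .
qed

text \<open>Multiplication by \<open>x\<close> acts on the generators by an integer matrix. The vector of the generators is
  an eigenvector for \<open>x\<close>, so \<open>x\<close> is a root of the monic characteristic polynomial.\<close>
lemma algebraic_int_if_int_span_invariant:
  assumes fin: "finite S" and nz: "\<exists>s\<in>S. s \<noteq> 0"
    and inv: "\<And>s. s \<in> S \<Longrightarrow> x * s \<in> int_span S"
  shows "algebraic_int (x :: complex)"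
proof -
  have "\<forall>s\<in>S. \<exists>c. x * s = (\<Sum>t\<in>S. of_int (c t) * t)"
    using inv unfolding int_span_def by fastforce
  then obtain C where C: "\<And>s. s \<in> S \<Longrightarrow> x * s = (\<Sum>t\<in>S. of_int (C s t) * t)"
    by (metis (no_types))
  define n where "n = card S"
  obtain h where h: "bij_betw h {0..<n} S"
    using ex_bij_betw_nat_finite[OF fin] n_def by blast
  define M :: "int mat" where "M = mat n n (\<lambda>(i,j). C (h i) (h j))"
  define MC :: "complex mat" where "MC = map_mat of_int M"
  define v where "v = vec n h"
  have M: "M \<in> carrier_mat n n" unfolding M_def by simp
  have MC: "MC \<in> carrier_mat n n" unfolding MC_def using M by simp
  have hS: "i < n \<Longrightarrow> h i \<in> S" for i using h by (auto simp: bij_betw_def)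
  have eq: "MC *\<^sub>v v = x \<cdot>\<^sub>v v"
  proof (rule eq_vecI)
    show "dim_vec (MC *\<^sub>v v) = dim_vec (x \<cdot>\<^sub>v v)" using MC by (simp add: v_def)
    fix i assume "i < dim_vec (x \<cdot>\<^sub>v v)"
    then have i: "i < n" by (simp add: v_def)
    have "(MC *\<^sub>v v) $ i = (\<Sum>j\<in>{0..<n}. of_int (C (h i) (h j)) * h j)"
      using i M by (simp add: MC_def M_def v_def scalar_prod_def)
    also have "\<dots> = (\<Sum>t\<in>S. of_int (C (h i) t) * t)"
      by (rule sum.reindex_bij_betw[OF h])
    also have "\<dots> = x * h i" using C[OF hS[OF i]] by simp
    finally show "(MC *\<^sub>v v) $ i = (x \<cdot>\<^sub>v v) $ i" using i by (simp add: v_def)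
  qed
  have "v \<noteq> 0\<^sub>v n"
  proof
    assume "v = 0\<^sub>v n"
    then have "\<And>i. i < n \<Longrightarrow> h i = 0" by (metis index_vec index_zero_vec(1) v_def)
    moreover from nz obtain s where "s \<in> S" "s \<noteq> 0" by blast
    moreover from this obtain i where "i < n" "h i = s"
      using h by (auto simp: bij_betw_def)
    ultimately show False by blast
  qed
  then have "eigenvector MC v x" unfolding eigenvector_def using eq MC by (auto simp: v_def)
  then have "eigenvalue MC x" unfolding eigenvalue_def by blast
  then have "poly (char_poly MC) x = 0" using eigenvalue_root_char_poly[OF MC] by simp
  moreover have "char_poly MC = map_poly of_int (char_poly M)"
    unfolding MC_def by (rule of_int_hom.char_poly_hom[OF M])
  moreover have "lead_coeff (char_poly M) = 1" using degree_monic_char_poly[OF M] by simp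
  ultimately show ?thesis unfolding algebraic_int_altdef_ipoly by metis
qed

text \<open>An equation of integral dependence, solved for its leading power.\<close>
lemma algebraic_int_power_in_int_span:
  assumes "algebraic_int (x :: complex)"
  obtains n where "n > 0" "x ^ n \<in> int_span ((\<lambda>i. x ^ i) ` {..<n})"
proof -
  from assms obtain p where p: "lead_coeff p = 1" "\<forall>i. coeff p i \<in> \<int>" "poly p x = 0"
    by (auto simp: algebraic_int.simps)
  define n where "n = degree p"
  have "n > 0"
  proof (rule ccontr)
    assume "\<not> n > 0"
    then have "degree p = 0" using n_def by simp
    then obtain c where "p = [:c:]" by (rule degree_eq_zeroE)
    then show False using p by auto
  qed
  have "poly p x = (\<Sum>i\<le>n. coeff p i * x ^ i)" by (simp add: poly_altdef n_def)
  also have "\<dots> = x ^ n + (\<Sum>i<n. coeff p i * x ^ i)"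
    using p(1) by (simp add: n_def lessThan_Suc_atMost[symmetric])
  finally have "x ^ n = (\<Sum>i<n. - coeff p i * x ^ i)"
    using p(3) by (simp add: sum_negf eq_neg_iff_add_eq_0)
  moreover have "- coeff p i * x ^ i \<in> int_span ((\<lambda>i. x ^ i) ` {..<n})" if "i < n" for i
  proof -
    obtain k where "coeff p i = of_int k" using p(2) Ints_cases by blast
    then have "- coeff p i = of_int (- k)" by simp
    then show ?thesis
      using int_span_scale[OF int_span_base, of "(\<lambda>i. x ^ i) ` {..<n}" "x ^ i" "- k"] that by auto
  qed
  ultimately have "x ^ n \<in> int_span ((\<lambda>i. x ^ i) ` {..<n})"
    by (auto intro!: int_span_sum)
  then show thesis by (rule that[OF \<open>n > 0\<close>])
qed

lemma int_span_mult_image: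
  assumes fin: "finite T" and "m \<in> int_span S" and "\<And>s. s \<in> S \<Longrightarrow> s * t \<in> T"
  shows "m * t \<in> int_span T"
proof -
  from assms(2) obtain c where m: "m = (\<Sum>s\<in>S. of_int (c s) * s)"
    unfolding int_span_def by auto
  have "m * t = (\<Sum>s\<in>S. of_int (c s) * (s * t))"
    by (simp add: m sum_distrib_right mult.assoc)
  also have "\<dots> \<in> int_span T"
    by (intro int_span_sum int_span_scale int_span_base[OF fin] assms(3))
  finally show ?thesis .
qed

text \<open>The monomials \<open>x ^ i * y ^ j\<close> below both degrees generate a module that is stable under \<open>x\<close> and
  \<open>y\<close>, hence under \<open>x + y\<close> and \<open>x * y\<close>.\<close>
lemma algebraic_int_add_mult:
  assumes "algebraic_int (x :: complex)" "algebraic_int y"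
  shows "algebraic_int (x + y)" and "algebraic_int (x * y)"
proof -
  obtain m where m: "m > 0" "x ^ m \<in> int_span ((\<lambda>i. x ^ i) ` {..<m})"
    using algebraic_int_power_in_int_span[OF assms(1)] .
  obtain n where n: "n > 0" "y ^ n \<in> int_span ((\<lambda>i. y ^ i) ` {..<n})"
    using algebraic_int_power_in_int_span[OF assms(2)] .
  define S where "S = (\<lambda>(i,j). x ^ i * y ^ j) ` ({..<m} \<times> {..<n})"
  have fin: "finite S" unfolding S_def by simp
  have inS: "x ^ i * y ^ j \<in> S" if "i < m" "j < n" for i j
    unfolding S_def using that by (intro image_eqI[of _ _ "(i,j)"]) auto
  have one: "1 \<in> S" using inS[of 0 0] m n by simp
  have X: "x * s \<in> int_span S" if "s \<in> S" for s
  proof -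
    from that obtain i j where ij: "i < m" "j < n" "s = x ^ i * y ^ j" unfolding S_def by auto
    show ?thesis
    proof (cases "Suc i < m")
      case True
      then have "x ^ Suc i * y ^ j \<in> S" using inS ij by blast
      then show ?thesis using int_span_base[OF fin] ij by (simp add: algebra_simps)
    next
      case False
      then have "Suc i = m" using ij by simp
      then have "x * s = x ^ m * y ^ j" using ij by auto
      moreover have "x ^ m * y ^ j \<in> int_span S"
        by (rule int_span_mult_image[OF fin m(2)]) (use inS ij in auto)
      ultimately show ?thesis by simp
    qed
  qed
  have Y: "y * s \<in> int_span S" if "s \<in> S" for s
  proof -
    from that obtain i j where ij: "i < m" "j < n" "s = x ^ i * y ^ j" unfolding S_def by auto
    show ?thesis
    proof (cases "Suc j < n")
      case True
      then have "x ^ i * y ^ Suc j \<in> S" using inS ij by blast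
      then show ?thesis using int_span_base[OF fin] ij by (simp add: algebra_simps)
    next
      case False
      then have "Suc j = n" using ij by simp
      then have "y * s = y ^ n * x ^ i" using ij by auto
      moreover have "y ^ n * x ^ i \<in> int_span S"
        by (rule int_span_mult_image[OF fin n(2)]) (use inS ij in \<open>auto simp: mult.commute\<close>)
      ultimately show ?thesis by simp
    qed
  qed
  have nz: "\<exists>s\<in>S. s \<noteq> 0" using one by (rule bexI[rotated]) simp
  show "algebraic_int (x + y)"
  proof (rule algebraic_int_if_int_span_invariant[OF fin nz])
    fix s assume "s \<in> S"
    then show "(x + y) * s \<in> int_span S"
      unfolding distrib_right using X Y int_span_add by blast
  qed
  show "algebraic_int (x * y)"
  proof (rule algebraic_int_if_int_span_invariant[OF fin nz])
    fix s assume "s \<in> S"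
    then show "x * y * s \<in> int_span S"
      unfolding mult.assoc using int_span_mult_closed[of S x "y * s"] X Y by blast
  qed
qed

lemmas algebraic_int_add = algebraic_int_add_mult(1)
lemmas algebraic_int_mult = algebraic_int_add_mult(2)

lemma algebraic_int_diff: "algebraic_int (x::complex) \<Longrightarrow> algebraic_int y \<Longrightarrow> algebraic_int (x - y)"
  using algebraic_int_add[of x "-y"] by simp

section \<open>The field and its multiplication table\<close>

lemma complex_ring_simps [simp]:
  "carrier complex_ring = UNIV" "x \<otimes>\<^bsub>complex_ring\<^esub> y = x * y" "x \<oplus>\<^bsub>complex_ring\<^esub> y = x + y"
  "\<one>\<^bsub>complex_ring\<^esub> = 1" "\<zero>\<^bsub>complex_ring\<^esub> = 0"
  by (simp_all add: ring_of_type_algebra_def)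

lemma complex_ring_a_inv: "\<ominus>\<^bsub>complex_ring\<^esub> x = - x"
  using abelian_group.minus_equality[OF ring.is_abelian_group[OF ring_from_type_algebra], of "-x" x] by simp

lemma complex_ring_m_inv:
  assumes "x \<noteq> 0"
  shows "inv\<^bsub>complex_ring\<^esub> x = inverse x"
  using comm_monoid.comm_inv_char[OF cring.axioms(2)[OF cring_from_type_algebra], of x "inverse x"] assms
  by simp

text \<open>This turns integrality of a norm into integrality of a coordinate: if \<open>q = u / v\<close> in lowest terms,
  then the square of \<open>v\<close> divides \<open>n\<close>.\<close>
lemma rat_int_of_squarefree_mult_square:
  fixes n :: int and q :: rat
  assumes "squarefree n" and "of_int n * q\<^sup>2 \<in> \<int>"
  shows "q \<in> \<int>"
proof -
  obtain u v where uv: "quotient_of q = (u, v)" by (cases "quotient_of q")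
  have q: "q = of_int u / of_int v" and v: "v > 0" and co: "coprime u v"
    using quotient_of_div[OF uv] quotient_of_denom_pos[OF uv] quotient_of_coprime[OF uv] by auto
  obtain k where k: "of_int n * q\<^sup>2 = of_int k" using assms(2) Ints_cases by blast
  have "of_int (n * u\<^sup>2) = (of_int (k * v\<^sup>2) :: rat)"
    using k v by (simp add: q field_simps)
  then have "n * u\<^sup>2 = k * v\<^sup>2" by (simp only: of_int_eq_iff)
  then have "v\<^sup>2 dvd n * u\<^sup>2" by simp
  moreover have "coprime (v\<^sup>2) (u\<^sup>2)" using co by (simp add: coprime_commute)
  ultimately have "v\<^sup>2 dvd n" by (simp add: coprime_dvd_mult_left_iff)
  then have "v dvd 1" using assms(1) by (auto simp: squarefree_def)
  then show ?thesis using v q by simp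
qed

text \<open>The sign of \<open>c\<close> is left free: replacing \<open>c\<close> by \<open>- c\<close> replaces \<open>\<gamma>\<close> by \<open>- \<gamma>\<close> and changes neither the
  field nor the lengths. The last assumption uses this freedom. It merges two families of fields
  whose integral bases differ by the sign of \<open>\<gamma>\<close>.\<close>
locale cyclic_quartic =
  fixes a b c d :: int
  assumes squarefree_a: "squarefree a" and odd_a: "odd a"
    and d_eq: "d = b\<^sup>2 + c\<^sup>2" and squarefree_d: "squarefree d"
    and b_pos: "b > 0" and c_nz: "c \<noteq> 0" and coprime_ad: "coprime a d"
    and ac_mod_4: "odd c \<Longrightarrow> a * c mod 4 = 1"
begin

lemma a_nz: "a \<noteq> 0" using odd_a by auto

lemma d_ge_2: "d \<ge> 2"
proof -
  have "b\<^sup>2 \<ge> 1" "c\<^sup>2 \<ge> 1" using b_pos c_nz by (auto simp: int_one_le_iff_zero_less)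
  then show ?thesis using d_eq by linarith
qed

lemma squarefree_ad: "squarefree (a * d)"
  using squarefree_mult_coprime[OF coprime_ad squarefree_a squarefree_d] .

lemma rat_square_eq_d:
  fixes u v :: rat
  assumes "u\<^sup>2 - of_int d * v\<^sup>2 = 0"
  shows "u = 0 \<and> v = 0"
proof (cases "v = 0")
  case False
  define q where "q = u / v"
  have q: "q\<^sup>2 = of_int d" using assms False by (simp add: q_def field_simps)
  then have "q \<in> \<int>" using rat_int_of_squarefree_mult_square[of 1 q] by simp
  then obtain k where "q = of_int k" using Ints_cases by blast
  then have "of_int (k\<^sup>2) = (of_int d :: rat)" using q by simp
  then have k: "k\<^sup>2 = d" by (simp only: of_int_eq_iff)
  then have "k dvd 1" using squarefree_d by (auto simp: squarefree_def)
  then have "k\<^sup>2 = 1" by (simp add: power2_eq_1_iff abs_eq_iff')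
  then show ?thesis using k d_ge_2 by simp
qed (use assms in auto)

text \<open>\<open>normA + normB * s\<close> is the relative norm of \<open>x + y s + z \<beta> + w \<gamma>\<close> over \<open>K = \<rat>(s)\<close>. Both parts are
  polynomials with integer coefficients, used over the integers as well as over the rationals.\<close>
definition normA :: "'r::comm_ring_1 \<Rightarrow> 'r \<Rightarrow> 'r \<Rightarrow> 'r \<Rightarrow> 'r"
  where "normA x y z w = x\<^sup>2 + of_int d * y\<^sup>2 - of_int (a * d) * (z\<^sup>2 + w\<^sup>2)"

definition normB :: "'r::comm_ring_1 \<Rightarrow> 'r \<Rightarrow> 'r \<Rightarrow> 'r \<Rightarrow> 'r"
  where "normB x y z w = 2 * x * y + of_int (a * b) * (z\<^sup>2 - w\<^sup>2) - 2 * of_int (a * c) * z * w"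

text \<open>The relative norm over \<open>K\<close> vanishes iff \<open>(x + y s)\<^sup>2 = (z \<beta> + w \<gamma>)\<^sup>2\<close>. The norms to \<open>\<rat>\<close> of these two
  sides are the two squares on the left, up to the factor \<open>d\<close>; hence their difference lies in the
  ideal generated by the two parts of the relative norm.\<close>
lemma norm_identity:
  fixes x y z w :: "'r::comm_ring_1"
  shows "(x\<^sup>2 - of_int d * y\<^sup>2)\<^sup>2 - of_int d * (of_int a * (of_int c * (z\<^sup>2 - w\<^sup>2) + 2 * of_int b * z * w))\<^sup>2
    = normA x y z w * (x\<^sup>2 + of_int d * y\<^sup>2 + of_int (a * d) * (z\<^sup>2 + w\<^sup>2))
      - of_int d * (normB x y z w * (2 * x * y - of_int (a * b) * (z\<^sup>2 - w\<^sup>2) + 2 * of_int (a * c) * z * w))"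
proof -
  have "of_int d = (of_int b)\<^sup>2 + (of_int c :: 'r)\<^sup>2" unfolding d_eq by simp
  then show ?thesis unfolding normA_def normB_def of_int_mult
    by (simp add: algebra_simps power2_eq_square)
qed

text \<open>Descent through \<open>K\<close>: both parts of the relative norm vanish modulo \<open>q\<close>; by the identity above \<open>x\<close> and
  \<open>y\<close> vanish, and what remains are linear equations for \<open>z\<^sup>2 - w\<^sup>2\<close> and \<open>2 z w\<close> with determinant
  \<open>b\<^sup>2 + c\<^sup>2 = d\<close>. The instance \<open>q = 0\<close> over the rationals says that nonzero elements of \<open>F\<close> are
  invertible; the instance of a prime \<open>q\<close> over the integers says that \<open>q\<close> is inert in \<open>F\<close>.\<close>
lemma norm_anisotropic:
  fixes q x y z w :: "'r::comm_ring_1"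
  assumes prime: "\<And>u v. q dvd u * v \<Longrightarrow> q dvd u \<or> q dvd v"
    and nonsquare: "\<And>u v. q dvd u\<^sup>2 - of_int d * v\<^sup>2 \<Longrightarrow> q dvd u \<and> q dvd v"
    and a: "\<not> q dvd of_int a" and two: "\<not> q dvd 2"
    and N: "q dvd (normA x y z w)\<^sup>2 - of_int d * (normB x y z w)\<^sup>2"
  shows "q dvd x" "q dvd y" "q dvd z" "q dvd w"
proof -
  have sq: "q dvd u" if "q dvd u\<^sup>2" for u using that prime[of u u] by (auto simp: power2_eq_square)
  have d: "\<not> q dvd of_int d"
  proof
    assume "q dvd of_int d"
    then have "q dvd 0\<^sup>2 - of_int d * 1\<^sup>2" by simp
    then have "q dvd 1" using nonsquare by blast
    then show False using two dvd_trans[of q 1 2] by simp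
  qed
  define m where "m = x\<^sup>2 - of_int d * y\<^sup>2"
  define n where "n = of_int a * (of_int c * (z\<^sup>2 - w\<^sup>2) + 2 * of_int b * z * w)"
  have AB: "q dvd normA x y z w" "q dvd normB x y z w" using nonsquare[OF N] by auto
  then have "q dvd m\<^sup>2 - of_int d * n\<^sup>2"
    unfolding m_def n_def by (subst norm_identity) simp
  then have mn: "q dvd m" "q dvd n" using nonsquare[of m n] by simp_all
  then show x: "q dvd x" and y: "q dvd y" using nonsquare[of x y] by (simp_all add: m_def)
  define e where "e = z\<^sup>2 - w\<^sup>2"
  have n: "q dvd of_int c * e + 2 * of_int b * z * w"
    using mn(2) prime[of "of_int a"] a unfolding n_def e_def by blast
  have "q dvd 2 * x * y - normB x y z w" using AB x by (intro dvd_diff) auto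
  also have "2 * x * y - normB x y z w = of_int a * (2 * of_int c * z * w - of_int b * e)"
    by (simp add: normB_def e_def algebra_simps)
  finally have B: "q dvd 2 * of_int c * z * w - of_int b * e" using prime a by blast
  \<comment> \<open>eliminate \<open>z w\<close>; the factor \<open>c\<^sup>2 + b\<^sup>2\<close> appears\<close>
  have "q dvd of_int c * (of_int c * e + 2 * of_int b * z * w) - of_int b * (2 * of_int c * z * w - of_int b * e)"
    by (rule dvd_diff[OF dvd_mult[OF n] dvd_mult[OF B]])
  also have "\<dots> = of_int d * e" unfolding d_eq by (simp add: algebra_simps power2_eq_square)
  finally have e: "q dvd e" using prime d by blast
  have "q dvd x\<^sup>2 + of_int d * y\<^sup>2 - normA x y z w"
    using AB x y by (auto intro!: dvd_diff dvd_add simp: power2_eq_square)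
  also have "\<dots> = of_int a * (of_int d * (z\<^sup>2 + w\<^sup>2))" by (simp add: normA_def algebra_simps)
  finally have s: "q dvd z\<^sup>2 + w\<^sup>2" using prime a d by blast
  have "q dvd (z\<^sup>2 + w\<^sup>2) + e" "q dvd (z\<^sup>2 + w\<^sup>2) - e" using s e by auto
  moreover have "(z\<^sup>2 + w\<^sup>2) + e = 2 * z\<^sup>2" "(z\<^sup>2 + w\<^sup>2) - e = 2 * w\<^sup>2" by (simp_all add: e_def)
  ultimately show "q dvd z" "q dvd w" using prime two sq by metis+
qed

text \<open>Stated for arbitrary \<open>s, u, v\<close> because every conjugate of the triple \<open>s, \<beta>, \<gamma>\<close> satisfies it too.\<close>
definition mult_table :: "complex \<Rightarrow> complex \<Rightarrow> complex \<Rightarrow> bool"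
  where "mult_table s u v \<longleftrightarrow> s * s = of_int d \<and> s * u = - of_int b * u + of_int c * v \<and>
    s * v = of_int c * u + of_int b * v \<and> u * u = of_int (a * d) - of_int (a * b) * s \<and>
    v * v = of_int (a * d) + of_int (a * b) * s \<and> u * v = of_int (a * c) * s"

definition ev :: "complex \<Rightarrow> complex \<Rightarrow> complex \<Rightarrow> rat \<Rightarrow> rat \<Rightarrow> rat \<Rightarrow> rat \<Rightarrow> complex"
  where "ev s u v x y z w = of_rat x + of_rat y * s + of_rat z * u + of_rat w * v"

definition mul_x :: "rat \<Rightarrow> rat \<Rightarrow> rat \<Rightarrow> rat \<Rightarrow> rat \<Rightarrow> rat \<Rightarrow> rat \<Rightarrow> rat \<Rightarrow> rat"
  where "mul_x x y z w x' y' z' w' = x * x' + of_int d * (y * y') + of_int (a * d) * (z * z' + w * w')"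
definition mul_y :: "rat \<Rightarrow> rat \<Rightarrow> rat \<Rightarrow> rat \<Rightarrow> rat \<Rightarrow> rat \<Rightarrow> rat \<Rightarrow> rat \<Rightarrow> rat"
  where "mul_y x y z w x' y' z' w' = x * y' + y * x' + of_int (a * b) * (w * w' - z * z')
    + of_int (a * c) * (z * w' + w * z')"
definition mul_z :: "rat \<Rightarrow> rat \<Rightarrow> rat \<Rightarrow> rat \<Rightarrow> rat \<Rightarrow> rat \<Rightarrow> rat \<Rightarrow> rat \<Rightarrow> rat"
  where "mul_z x y z w x' y' z' w' = x * z' + z * x' - of_int b * (y * z' + z * y')
    + of_int c * (y * w' + w * y')"
definition mul_w :: "rat \<Rightarrow> rat \<Rightarrow> rat \<Rightarrow> rat \<Rightarrow> rat \<Rightarrow> rat \<Rightarrow> rat \<Rightarrow> rat \<Rightarrow> rat"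
  where "mul_w x y z w x' y' z' w' = x * w' + w * x' + of_int c * (y * z' + z * y')
    + of_int b * (y * w' + w * y')"
lemmas mul_defs = mul_x_def mul_y_def mul_z_def mul_w_def

lemma ev_add: "ev s u v x y z w + ev s u v x' y' z' w' = ev s u v (x + x') (y + y') (z + z') (w + w')"
  by (simp add: ev_def of_rat_add algebra_simps)
lemma ev_uminus: "- ev s u v x y z w = ev s u v (- x) (- y) (- z) (- w)"
  by (simp add: ev_def of_rat_minus algebra_simps)
lemma ev_diff: "ev s u v x y z w - ev s u v x' y' z' w' = ev s u v (x - x') (y - y') (z - z') (w - w')"
  by (simp add: ev_def of_rat_diff algebra_simps)
lemma ev_scale: "of_rat k * ev s u v x y z w = ev s u v (k * x) (k * y) (k * z) (k * w)"
  by (simp add: ev_def of_rat_mult algebra_simps)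
lemma ev_rat: "ev s u v k 0 0 0 = of_rat k" by (simp add: ev_def)

lemma ev_mult:
  assumes "mult_table s u v"
  shows "ev s u v x y z w * ev s u v x' y' z' w' =
    ev s u v (mul_x x y z w x' y' z' w') (mul_y x y z w x' y' z' w')
      (mul_z x y z w x' y' z' w') (mul_w x y z w x' y' z' w')"
proof -
  define qx qy qz qw qx' qy' qz' qw' where
    "qx = (of_rat x :: complex)" "qy = (of_rat y :: complex)" "qz = (of_rat z :: complex)" "qw = (of_rat w :: complex)"
    "qx' = (of_rat x' :: complex)" "qy' = (of_rat y' :: complex)" "qz' = (of_rat z' :: complex)" "qw' = (of_rat w' :: complex)"
  note defs = this
  have "(qx + qy * s + qz * u + qw * v) * (qx' + qy' * s + qz' * u + qw' * v) =
    qx * qx' + (qx * qy' + qy * qx') * s + (qx * qz' + qz * qx') * u + (qx * qw' + qw * qx') * v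
    + (qy * qy') * (s * s) + (qy * qz' + qz * qy') * (s * u) + (qy * qw' + qw * qy') * (s * v)
    + (qz * qz') * (u * u) + (qw * qw') * (v * v) + (qz * qw' + qw * qz') * (u * v)"
    by (simp add: algebra_simps)
  also have "\<dots> = qx * qx' + (qx * qy' + qy * qx') * s + (qx * qz' + qz * qx') * u + (qx * qw' + qw * qx') * v
    + (qy * qy') * of_int d + (qy * qz' + qz * qy') * (- of_int b * u + of_int c * v)
    + (qy * qw' + qw * qy') * (of_int c * u + of_int b * v)
    + (qz * qz') * (of_int (a * d) - of_int (a * b) * s)
    + (qw * qw') * (of_int (a * d) + of_int (a * b) * s) + (qz * qw' + qw * qz') * (of_int (a * c) * s)"
    using assms unfolding mult_table_def by (elim conjE) (simp only:)
  finally show ?thesis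
    unfolding ev_def mul_defs defs
    by (simp add: of_rat_add of_rat_mult of_rat_diff algebra_simps)
qed

lemma ev_norm_K:
  assumes "mult_table s u v"
  shows "ev s u v x y z w * ev s u v x y (- z) (- w) = ev s u v (normA x y z w) (normB x y z w) 0 0"
proof -
  have 1: "mul_x x y z w x y (- z) (- w) = normA x y z w" by (simp add: mul_x_def normA_def algebra_simps power2_eq_square)
  have 2: "mul_y x y z w x y (- z) (- w) = normB x y z w" by (simp add: mul_y_def normB_def algebra_simps power2_eq_square)
  have 3: "mul_z x y z w x y (- z) (- w) = 0" by (simp add: mul_z_def algebra_simps)
  have 4: "mul_w x y z w x y (- z) (- w) = 0" by (simp add: mul_w_def algebra_simps)
  show ?thesis unfolding ev_mult[OF assms] 1 2 3 4 ..
qed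

lemma ev_norm_Q:
  assumes "mult_table s u v"
  shows "ev s u v x y 0 0 * ev s u v x (- y) 0 0 = of_rat (x\<^sup>2 - of_int d * y\<^sup>2)"
  unfolding ev_mult[OF assms] by (simp add: mul_defs ev_rat power2_eq_square)

lemma ev_norm:
  assumes "mult_table s u v"
  shows "ev s u v x y z w * (ev s u v x y (- z) (- w) * ev s u v (normA x y z w) (- normB x y z w) 0 0)
    = of_rat ((normA x y z w)\<^sup>2 - of_int d * (normB x y z w)\<^sup>2)"
  unfolding mult.assoc[symmetric] ev_norm_K[OF assms] ev_norm_Q[OF assms] ..

lemma rat_norm_eq_0:
  fixes x y z w :: rat
  assumes "(normA x y z w)\<^sup>2 - of_int d * (normB x y z w)\<^sup>2 = 0"
  shows "x = 0 \<and> y = 0 \<and> z = 0 \<and> w = 0"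
proof -
  have p: "0 dvd u \<or> 0 dvd v" if "0 dvd u * v" for u v :: rat using that by simp
  have n: "0 dvd u \<and> 0 dvd v" if "0 dvd u\<^sup>2 - of_int d * v\<^sup>2" for u v :: rat
    using rat_square_eq_d[of u v] that by simp
  have "\<not> 0 dvd (of_int a :: rat)" "\<not> 0 dvd (2 :: rat)"
    "0 dvd (normA x y z w)\<^sup>2 - of_int d * (normB x y z w)\<^sup>2" using a_nz assms by simp_all
  from norm_anisotropic[OF p n this] show ?thesis by simp
qed

lemma ev_eq_0:
  assumes "mult_table s u v" "ev s u v x y z w = 0"
  shows "x = 0 \<and> y = 0 \<and> z = 0 \<and> w = 0"
proof -
  have "of_rat ((normA x y z w)\<^sup>2 - of_int d * (normB x y z w)\<^sup>2) = (0::complex)"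
    unfolding ev_norm[OF assms(1), symmetric] assms(2) by simp
  then show ?thesis using rat_norm_eq_0 by simp
qed

lemma ev_inject:
  assumes "mult_table s u v" "ev s u v x y z w = ev s u v x' y' z' w'"
  shows "x = x' \<and> y = y' \<and> z = z' \<and> w = w'"
proof -
  have "ev s u v (x - x') (y - y') (z - z') (w - w') = 0"
    using assms(2) by (simp add: ev_diff[symmetric])
  from ev_eq_0[OF assms(1) this] show ?thesis by simp
qed

lemma mult_table_conj: "mult_table s u v \<Longrightarrow> mult_table (- s) v (- u)"
  unfolding mult_table_def by (auto simp: algebra_simps)

text \<open>Dividing by \<open>\<beta>\<close> selects the square root of \<open>a (d + b s)\<close> with \<open>\<beta> \<gamma> = a c s\<close>, for both signs of \<open>a\<close>.\<close>
definition "rtd = complex_of_real (sqrt (of_int d))"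
definition "\<beta> = quartic_beta a b d"
definition "\<gamma> = of_int (a * c) * rtd / \<beta>"
abbreviation "E \<equiv> ev rtd \<beta> \<gamma>"
abbreviation "F \<equiv> quartic_field a b d"

lemma rtd_sq: "rtd * rtd = of_int d"
proof -
  have "sqrt (of_int d) * sqrt (of_int d) = of_int d" using d_ge_2 by simp
  then have "rtd * rtd = of_real (of_int d)" unfolding rtd_def by (simp only: of_real_mult[symmetric])
  then show ?thesis by simp
qed

lemma beta_sq: "\<beta> * \<beta> = of_int (a * d) - of_int (a * b) * rtd"
proof -
  have "\<beta>\<^sup>2 = complex_of_real (of_int a * (of_int d - of_int b * sqrt (of_int d)))"
    unfolding \<beta>_def quartic_beta_def by (rule power2_csqrt)
  then show ?thesis by (simp add: power2_eq_square rtd_def algebra_simps)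
qed

lemma c_sq: "d - b\<^sup>2 = c\<^sup>2" by (simp add: d_eq)

lemma beta_conj_product:
  "(of_int (a * d) + of_int (a * b) * rtd) * (of_int (a * d) - of_int (a * b) * rtd) = of_int (a\<^sup>2 * c\<^sup>2 * d)"
proof -
  have "(of_int (a * d) + of_int (a * b) * rtd) * (of_int (a * d) - of_int (a * b) * rtd)
      = of_int (a\<^sup>2 * d\<^sup>2) - of_int (a\<^sup>2 * b\<^sup>2) * (rtd * rtd)"
    by (simp add: algebra_simps power2_eq_square)
  also have "\<dots> = of_int (a\<^sup>2 * d * (d - b\<^sup>2))" unfolding rtd_sq by (simp add: algebra_simps power2_eq_square)
  finally show ?thesis unfolding c_sq by (simp add: algebra_simps)
qed

lemma beta_nz: "\<beta> \<noteq> 0"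
proof
  assume "\<beta> = 0"
  then have "of_int (a * d) - of_int (a * b) * rtd = 0" using beta_sq by simp
  then have "of_int (a\<^sup>2 * c\<^sup>2 * d) = (0::complex)" by (metis beta_conj_product mult_zero_right)
  then have "a\<^sup>2 * c\<^sup>2 * d = 0" by (simp only: of_int_eq_0_iff)
  then show False using a_nz c_nz d_ge_2 by simp
qed

lemma mult_table_E: "mult_table rtd \<beta> \<gamma>"
proof -
  have g: "\<gamma> * \<beta> = of_int (a * c) * rtd" using beta_nz by (simp add: \<gamma>_def)
  have cc: "x = y" if "x * \<beta> = y * \<beta>" for x y using that beta_nz by simp
  have d': "of_int d = (of_int b)\<^sup>2 + (of_int c :: complex)\<^sup>2" unfolding d_eq by simp
  have 1: "rtd * \<beta> = - of_int b * \<beta> + of_int c * \<gamma>"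
  proof (rule cc)
    have "rtd * \<beta> * \<beta> = of_int (a * d) * rtd - of_int (a * b) * (rtd * rtd)"
      unfolding mult.assoc beta_sq by (simp add: algebra_simps)
    also have "\<dots> = - of_int b * (\<beta> * \<beta>) + of_int c * (\<gamma> * \<beta>)"
      unfolding rtd_sq g beta_sq of_int_mult d' by (simp add: algebra_simps power2_eq_square)
    finally show "rtd * \<beta> * \<beta> = (- of_int b * \<beta> + of_int c * \<gamma>) * \<beta>"
      by (simp add: algebra_simps)
  qed
  have 2: "rtd * \<gamma> = of_int c * \<beta> + of_int b * \<gamma>"
  proof (rule cc)
    have "rtd * \<gamma> * \<beta> = of_int (a * c) * (rtd * rtd)"
      unfolding mult.assoc g by (simp add: algebra_simps)
    also have "\<dots> = of_int c * (\<beta> * \<beta>) + of_int b * (\<gamma> * \<beta>)"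
      unfolding rtd_sq g beta_sq of_int_mult by (simp add: algebra_simps)
    finally show "rtd * \<gamma> * \<beta> = (of_int c * \<beta> + of_int b * \<gamma>) * \<beta>"
      by (simp add: algebra_simps)
  qed
  have 3: "\<gamma> * \<gamma> = of_int (a * d) + of_int (a * b) * rtd"
  proof (rule cc, rule cc)
    have "\<gamma> * \<gamma> * \<beta> * \<beta> = (\<gamma> * \<beta>) * (\<gamma> * \<beta>)" by (simp add: algebra_simps)
    also have "\<dots> = of_int (a\<^sup>2 * c\<^sup>2) * (rtd * rtd)" unfolding g by (simp add: algebra_simps power2_eq_square)
    also have "\<dots> = (of_int (a * d) + of_int (a * b) * rtd) * (\<beta> * \<beta>)"
      unfolding beta_sq beta_conj_product rtd_sq by simp
    finally show "\<gamma> * \<gamma> * \<beta> * \<beta> = (of_int (a * d) + of_int (a * b) * rtd) * \<beta> * \<beta>"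
      by (simp add: algebra_simps)
  qed
  show ?thesis unfolding mult_table_def using 1 2 3 g beta_sq rtd_sq by (simp add: mult.commute)
qed

lemmas E_mult = ev_mult[OF mult_table_E]
lemmas E_inject = ev_inject[OF mult_table_E]

lemma E_inverse: "\<exists>x' y' z' w'. inverse (E x y z w) = E x' y' z' w'"
proof (cases "E x y z w = 0")
  case True
  then show ?thesis by (metis ev_rat inverse_zero of_rat_0)
next
  case False
  define N where "N = (normA x y z w)\<^sup>2 - of_int d * (normB x y z w)\<^sup>2"
  define t where "t = E x y (- z) (- w) * E (normA x y z w) (- normB x y z w) 0 0"
  have "N \<noteq> 0"
  proof
    assume "N = 0"
    then have "x = 0 \<and> y = 0 \<and> z = 0 \<and> w = 0" using rat_norm_eq_0[of x y z w] N_def by simp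
    then show False using False by (simp add: ev_def)
  qed
  moreover have "E x y z w * t = of_rat N" unfolding t_def N_def by (rule ev_norm[OF mult_table_E])
  ultimately have "E x y z w * (of_rat (inverse N) * t) = 1"
    by (metis mult.left_commute of_rat_1 of_rat_mult left_inverse)
  then have "inverse (E x y z w) = of_rat (inverse N) * t" by (rule inverse_unique)
  then show ?thesis unfolding t_def E_mult ev_scale by blast
qed

lemma F_closed:
  shows "1 \<in> F" and "\<beta> \<in> F" and "x \<in> F \<Longrightarrow> - x \<in> F"
    and "x \<in> F \<Longrightarrow> x \<noteq> 0 \<Longrightarrow> inverse x \<in> F"
    and "x \<in> F \<Longrightarrow> y \<in> F \<Longrightarrow> x + y \<in> F" and "x \<in> F \<Longrightarrow> y \<in> F \<Longrightarrow> x * y \<in> F"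
proof -
  have F: "F = generate_field complex_ring {\<beta>}" by (simp add: quartic_field_def \<beta>_def)
  show "1 \<in> F" using generate_field.one[of complex_ring "{\<beta>}"] by (simp add: F)
  show "\<beta> \<in> F" unfolding F by (rule generate_field.incl) simp
  show "x \<in> F \<Longrightarrow> - x \<in> F"
    using generate_field.a_inv[of x complex_ring "{\<beta>}"] by (simp add: F complex_ring_a_inv)
  show "x \<in> F \<Longrightarrow> x \<noteq> 0 \<Longrightarrow> inverse x \<in> F"
    using generate_field.m_inv[of x complex_ring "{\<beta>}"] by (simp add: F complex_ring_m_inv)
  show "x \<in> F \<Longrightarrow> y \<in> F \<Longrightarrow> x + y \<in> F"
    using generate_field.eng_add[of x complex_ring "{\<beta>}" y] by (simp add: F)
  show "x \<in> F \<Longrightarrow> y \<in> F \<Longrightarrow> x * y \<in> F"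
    using generate_field.eng_mult[of x complex_ring "{\<beta>}" y] by (simp add: F)
qed

lemma of_rat_in_F: "of_rat q \<in> F"
proof -
  have nat: "of_nat n \<in> F" for n
  proof (induction n)
    case 0
    have "1 + - 1 \<in> F" using F_closed(1,3,5) by blast
    then show ?case by simp
  qed (use F_closed(1,5) in auto)
  have int: "of_int k \<in> F" for k :: int
    using nat F_closed(3) by (cases k rule: int_cases2) auto
  obtain u v where uv: "quotient_of q = (u, v)" by (cases "quotient_of q")
  have "q = of_int u / of_int v" and v: "v > 0"
    using quotient_of_div[OF uv] quotient_of_denom_pos[OF uv] by auto
  then have "of_rat q = of_int u * inverse (of_int v :: complex)"
    by (simp add: divide_inverse of_rat_mult of_rat_inverse)
  then show ?thesis using int F_closed(4,6) v by (metis of_int_eq_0_iff less_irrefl)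
qed

text \<open>The linear combinations are closed under inverses since the norm is anisotropic.\<close>
theorem F_eq: "F = {E x y z w |x y z w. True}"
proof
  show "F \<subseteq> {E x y z w |x y z w. True}"
  proof
    fix t assume "t \<in> F"
    then have "t \<in> generate_field complex_ring {\<beta>}" by (simp add: quartic_field_def \<beta>_def)
    then have "\<exists>x y z w. t = E x y z w"
    proof (induction rule: generate_field.induct)
      case one
      have "1 = E 1 0 0 0" by (simp add: ev_def)
      then show ?case unfolding complex_ring_simps by blast
    next
      case (incl h)
      then have "h = E 0 0 1 0" by (simp add: ev_def)
      then show ?case by blast
    next
      case (a_inv h)
      then show ?case unfolding complex_ring_a_inv by (metis ev_uminus)
    next
      case (m_inv h)
      then show ?case using E_inverse complex_ring_m_inv by (metis complex_ring_simps(5))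
    next
      case (eng_add h1 h2)
      then show ?case unfolding complex_ring_simps by (metis ev_add)
    next
      case (eng_mult h1 h2)
      then show ?case unfolding complex_ring_simps by (metis E_mult)
    qed
    then show "t \<in> {E x y z w |x y z w. True}" by blast
  qed
  have "rtd = of_rat (inverse (of_int (a * b))) * (of_rat (of_int (a * d)) + - (\<beta> * \<beta>))"
    unfolding beta_sq using a_nz b_pos by (simp add: of_rat_inverse of_rat_mult of_rat_divide field_simps)
  also have "\<dots> \<in> F" by (intro F_closed(2,3,5,6) of_rat_in_F)
  finally have r: "rtd \<in> F" .
  have "\<gamma> = of_rat (of_int (a * c)) * rtd * inverse \<beta>"
    by (simp add: \<gamma>_def divide_inverse of_rat_mult)
  also have "\<dots> \<in> F" by (intro F_closed(2,4,6) of_rat_in_F r beta_nz)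
  finally have g: "\<gamma> \<in> F" .
  have "E x y z w \<in> F" for x y z w
    unfolding ev_def by (intro F_closed(2,5,6) of_rat_in_F r g)
  then show "{E x y z w |x y z w. True} \<subseteq> F" by blast
qed

end

section \<open>Embeddings and lengths\<close>

lemma scale_in_span: "u \<in> S \<or> r = 0 \<Longrightarrow> r *\<^sub>R u \<in> span S" for u :: "'v :: real_vector"
  by (cases "r = 0") (auto intro: span_scale span_base span_zero)

context cyclic_quartic begin

text \<open>Evaluation of the coordinates at another triple with the same multiplication table.\<close>
definition emb :: "complex \<Rightarrow> complex \<Rightarrow> complex \<Rightarrow> complex \<Rightarrow> complex"
  where "emb s u v = restrict (\<lambda>t. THE r. \<exists>x y z w. t = E x y z w \<and> r = ev s u v x y z w) F"

lemma E_in_F: "E x y z w \<in> F" using F_eq by blast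

lemma emb_E: "emb s u v (E x y z w) = ev s u v x y z w"
proof -
  have "(THE r. \<exists>x' y' z' w'. E x y z w = E x' y' z' w' \<and> r = ev s u v x' y' z' w') = ev s u v x y z w"
  proof (rule the_equality)
    fix r assume "\<exists>x' y' z' w'. E x y z w = E x' y' z' w' \<and> r = ev s u v x' y' z' w'"
    then obtain x' y' z' w' where "E x y z w = E x' y' z' w'" "r = ev s u v x' y' z' w'" by blast
    then show "r = ev s u v x y z w" using E_inject[of x y z w x' y' z' w'] by simp
  qed blast
  then show ?thesis using E_in_F by (simp add: emb_def)
qed

lemma emb_mult: "mult_table s u v \<Longrightarrow> t \<in> F \<Longrightarrow> t' \<in> F \<Longrightarrow> emb s u v (t * t') = emb s u v t * emb s u v t'"
  using F_eq by (auto simp: E_mult emb_E ev_mult)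

lemma emb_add: "t \<in> F \<Longrightarrow> t' \<in> F \<Longrightarrow> emb s u v (t + t') = emb s u v t + emb s u v t'"
  using F_eq by (auto simp: ev_add emb_E)

lemma emb_rat: "emb s u v (of_rat q) = of_rat q"
  using emb_E[of s u v q 0 0 0] by (simp add: ev_rat)

lemma E_basis: "1 = E 1 0 0 0" "rtd = E 0 1 0 0" "\<beta> = E 0 0 1 0" "\<gamma> = E 0 0 0 1"
  by (simp_all add: ev_def)

lemma emb_in_embeddings:
  assumes "mult_table s u v"
  shows "emb s u v \<in> embeddings F"
proof -
  have "emb s u v 1 = 1" using emb_rat[of s u v 1] by simp
  moreover have "emb s u v \<in> extensional F" by (simp add: emb_def)
  ultimately show ?thesis unfolding embeddings_def Ring.ring_hom_def
    using emb_mult[OF assms] emb_add by auto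
qed

text \<open>The table determines \<open>s\<close> up to sign by its square, then \<open>u\<close> up to sign by its square, and \<open>v\<close> by
  \<open>u v = a c s\<close>.\<close>
lemma mult_table_cases:
  assumes "mult_table s u v"
  shows "s = rtd \<and> u = \<beta> \<and> v = \<gamma> \<or> s = - rtd \<and> u = \<gamma> \<and> v = - \<beta> \<or>
    s = rtd \<and> u = - \<beta> \<and> v = - \<gamma> \<or> s = - rtd \<and> u = - \<gamma> \<and> v = \<beta>"
proof -
  note m = assms[unfolded mult_table_def] and m0 = mult_table_E[unfolded mult_table_def]
  have rnz: "rtd \<noteq> 0" using rtd_sq d_ge_2 by auto
  have gnz: "\<gamma> \<noteq> 0" unfolding \<gamma>_def using a_nz c_nz rnz beta_nz by simp
  have "s * s = rtd * rtd" using m rtd_sq by simp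
  then consider "s = rtd" | "s = - rtd" using square_eq_iff by blast
  then show ?thesis
  proof cases
    case 1
    then have "u * u = \<beta> * \<beta>" using m beta_sq by simp
    then consider "u = \<beta>" | "u = - \<beta>" using square_eq_iff by blast
    then show ?thesis
    proof cases
      case 1
      have "\<beta> * v = \<beta> * \<gamma>" using m m0 1 \<open>s = rtd\<close> by metis
      then show ?thesis using beta_nz 1 \<open>s = rtd\<close> by simp
    next
      case 2
      have "- \<beta> * v = \<beta> * \<gamma>" using m m0 2 \<open>s = rtd\<close> by metis
      then have "- (- \<beta> * v) = - (\<beta> * \<gamma>)" by (simp only:)
      then have "\<beta> * v = \<beta> * (- \<gamma>)" by simp
      then have "v = - \<gamma>" using mult_left_cancel[OF beta_nz] by blast
      then show ?thesis using beta_nz 2 \<open>s = rtd\<close> by simp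
    qed
  next
    case 2
    then have "u * u = \<gamma> * \<gamma>" using m m0 by simp
    then consider "u = \<gamma>" | "u = - \<gamma>" using square_eq_iff by blast
    then show ?thesis
    proof cases
      case 1
      have "\<gamma> * v = - (\<beta> * \<gamma>)" using m m0 1 \<open>s = - rtd\<close> by (metis mult_minus_right)
      then have "\<gamma> * v = \<gamma> * (- \<beta>)" by (simp add: mult.commute)
      then have "v = - \<beta>" using mult_left_cancel[OF gnz] by blast
      then show ?thesis using gnz 1 \<open>s = - rtd\<close> by simp
    next
      case 2
      have "- \<gamma> * v = - (\<beta> * \<gamma>)" using m m0 2 \<open>s = - rtd\<close> by (metis mult_minus_right)
      then have "\<gamma> * v = \<gamma> * \<beta>" by (simp add: mult.commute)
      then show ?thesis using gnz 2 \<open>s = - rtd\<close> by simp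
    qed
  qed
qed

lemma tables:
  "mult_table rtd \<beta> \<gamma>" "mult_table (- rtd) \<gamma> (- \<beta>)" "mult_table rtd (- \<beta>) (- \<gamma>)" "mult_table (- rtd) (- \<gamma>) \<beta>"
  using mult_table_E mult_table_conj[OF mult_table_E] mult_table_conj[OF mult_table_conj[OF mult_table_E]]
   mult_table_conj[OF mult_table_conj[OF mult_table_conj[OF mult_table_E]]] by simp_all

abbreviation "emb0 \<equiv> emb rtd \<beta> \<gamma>"
abbreviation "emb1 \<equiv> emb (- rtd) \<gamma> (- \<beta>)"
abbreviation "emb2 \<equiv> emb rtd (- \<beta>) (- \<gamma>)"
abbreviation "emb3 \<equiv> emb (- rtd) (- \<gamma>) \<beta>"

text \<open>An embedding fixes the rationals, so it maps \<open>s, \<beta>, \<gamma>\<close> to a triple with the same table and is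
  determined by that triple.\<close>
theorem embeddings_eq:
  "embeddings F = {emb0, emb1, emb2, emb3}"
proof
  show "{emb0, emb1, emb2, emb3} \<subseteq> embeddings F"
    using emb_in_embeddings tables by simp
  show "embeddings F \<subseteq> {emb0, emb1, emb2, emb3}"
  proof
    fix \<phi> assume phi: "\<phi> \<in> embeddings F"
    have mul: "\<phi> (x * y) = \<phi> x * \<phi> y" and add: "\<phi> (x + y) = \<phi> x + \<phi> y" if "x \<in> F" "y \<in> F" for x y
      using phi that unfolding embeddings_def Ring.ring_hom_def by auto
    have one: "\<phi> 1 = 1" using phi unfolding embeddings_def Ring.ring_hom_def by auto
    have ext: "\<phi> \<in> extensional F" using phi unfolding embeddings_def by auto
    have zero: "\<phi> 0 = 0" using add[of 0 0] of_rat_in_F[of 0] by simp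
    have neg: "\<phi> (- x) = - \<phi> x" if "x \<in> F" for x
      using add[of x "- x"] that F_closed(3)[of x] zero by (simp add: eq_neg_iff_add_eq_0 add.commute)
    have nat: "\<phi> (of_nat n) = of_nat n" for n
    proof (induction n)
      case (Suc n)
      have "of_nat n \<in> F" using of_rat_in_F[of "of_nat n"] by simp
      then show ?case using add[OF F_closed(1), of "of_nat n"] one Suc by simp
    qed (use zero in auto)
    have int: "\<phi> (of_int k) = of_int k" for k
    proof (cases k rule: int_cases2)
      case (nonneg n) then show ?thesis using nat by simp
    next
      case (nonpos n)
      have "of_nat n \<in> F" using of_rat_in_F[of "of_nat n"] by simp
      then show ?thesis using nonpos neg[of "of_nat n"] nat by simp
    qed
    have rat: "\<phi> (of_rat q) = of_rat q" for q
    proof -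
      obtain m n where uv: "quotient_of q = (m, n)" by (cases "quotient_of q")
      have q: "q = of_int m / of_int n" and v: "n > 0"
        using quotient_of_div[OF uv] quotient_of_denom_pos[OF uv] by auto
      have "of_rat (of_int n) * of_rat q = (of_rat (of_int m) :: complex)"
        unfolding of_rat_mult[symmetric] using q v by simp
      then have "of_int n * of_rat q = (of_int m :: complex)" by simp
      moreover have "\<phi> (of_int n * of_rat q) = of_int n * \<phi> (of_rat q)"
        using mul[of "of_int n" "of_rat q"] of_rat_in_F[of q] of_rat_in_F[of "of_int n"] int by simp
      ultimately have "of_int n * \<phi> (of_rat q) = of_int n * of_rat q" by (metis int)
      moreover have "of_int n \<noteq> (0 :: complex)" using v by simp
      ultimately show ?thesis using mult_left_cancel by blast
    qed
    have inF: "rtd \<in> F" "\<beta> \<in> F" "\<gamma> \<in> F" using E_basis E_in_F by metis+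
    have ratF: "of_int k \<in> F" for k using of_rat_in_F[of "of_int k"] by simp
    have lin: "\<phi> (E x y z w) = ev (\<phi> rtd) (\<phi> \<beta>) (\<phi> \<gamma>) x y z w" for x y z w
      unfolding ev_def by (simp add: add mul rat inF of_rat_in_F F_closed(5,6))
    have mt: "mult_table (\<phi> rtd) (\<phi> \<beta>) (\<phi> \<gamma>)"
    proof -
      have E_int: "E (of_int i) (of_int j) (of_int k) (of_int l) = of_int i + of_int j * rtd + of_int k * \<beta> + of_int l * \<gamma>" for i j k l
        by (simp add: ev_def)
      have comb: "\<phi> (of_int i + of_int j * rtd + of_int k * \<beta> + of_int l * \<gamma>)
         = of_int i + of_int j * \<phi> rtd + of_int k * \<phi> \<beta> + of_int l * \<phi> \<gamma>" for i j k l
        unfolding E_int[symmetric] lin by (simp add: ev_def)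
      note m0 = mult_table_E[unfolded mult_table_def]
      have "\<phi> rtd * \<phi> rtd = of_int d" using mul[of rtd rtd] inF m0 int by simp
      moreover have "\<phi> rtd * \<phi> \<beta> = - of_int b * \<phi> \<beta> + of_int c * \<phi> \<gamma>"
        using mul[of rtd \<beta>] inF m0 comb[of 0 0 "- b" c] by simp
      moreover have "\<phi> rtd * \<phi> \<gamma> = of_int c * \<phi> \<beta> + of_int b * \<phi> \<gamma>"
        using mul[of rtd \<gamma>] inF m0 comb[of 0 0 c b] by simp
      moreover have "\<phi> \<beta> * \<phi> \<beta> = of_int (a * d) - of_int (a * b) * \<phi> rtd"
        using mul[of \<beta> \<beta>] inF m0 comb[of "a * d" "- (a * b)" 0 0] by simp
      moreover have "\<phi> \<gamma> * \<phi> \<gamma> = of_int (a * d) + of_int (a * b) * \<phi> rtd"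
        using mul[of \<gamma> \<gamma>] inF m0 comb[of "a * d" "a * b" 0 0] by simp
      moreover have "\<phi> \<beta> * \<phi> \<gamma> = of_int (a * c) * \<phi> rtd"
        using mul[of \<beta> \<gamma>] inF m0 comb[of 0 "a * c" 0 0] by simp
      ultimately show ?thesis unfolding mult_table_def by blast
    qed
    have eq: "\<phi> = emb (\<phi> rtd) (\<phi> \<beta>) (\<phi> \<gamma>)"
    proof
      fix t show "\<phi> t = emb (\<phi> rtd) (\<phi> \<beta>) (\<phi> \<gamma>) t"
      proof (cases "t \<in> F")
        case True
        then obtain x y z w where "t = E x y z w" using F_eq by blast
        then show ?thesis by (simp only: lin emb_E)
      qed (use ext in \<open>auto simp: extensional_def emb_def\<close>)
    qed
    have "emb (\<phi> rtd) (\<phi> \<beta>) (\<phi> \<gamma>)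
        \<in> {emb0, emb1, emb2, emb3}"
      using mult_table_cases[OF mt] by auto
    then show "\<phi> \<in> {emb0, emb1, emb2, emb3}"
      unfolding eq[symmetric] .
  qed
qed

lemma embeddings_distinct:
  "distinct [emb0, emb1, emb2, emb3]"
proof -
  have r: "emb s u v rtd = s" and u: "emb s u v \<beta> = u" for s u v
    using emb_E[of s u v 0 1 0 0] emb_E[of s u v 0 0 1 0] by (simp_all add: ev_def)
  have rnz: "rtd \<noteq> 0" using rtd_sq d_ge_2 by auto
  have gnz: "\<gamma> \<noteq> 0" unfolding \<gamma>_def using a_nz c_nz rnz beta_nz by simp
  have 1: "emb rtd x y \<noteq> emb (- rtd) x' y'" for x y x' y'
    using r[of rtd x y] r[of "- rtd" x' y'] rnz by auto
  have 2: "emb0 \<noteq> emb2"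
    using u[of rtd \<beta> \<gamma>] u[of rtd "- \<beta>" "- \<gamma>"] beta_nz by auto
  have 3: "emb1 \<noteq> emb3"
    using u[of "- rtd" \<gamma> "- \<beta>"] u[of "- rtd" "- \<gamma>" \<beta>] gnz by auto
  show ?thesis using 1 2 3 by (auto simp: eq_commute[of "emb (- rtd) _ _" "emb rtd _ _"])
qed

lemma card_embeddings: "card (embeddings F) = 4"
  unfolding embeddings_eq using embeddings_distinct by simp

definition qf :: "rat \<Rightarrow> rat \<Rightarrow> rat \<Rightarrow> rat \<Rightarrow> rat"
  where "qf x y z w = x\<^sup>2 + of_int d * y\<^sup>2 + of_int (\<bar>a\<bar> * d) * (z\<^sup>2 + w\<^sup>2)"

text \<open>The squares of \<open>\<beta>\<close> and \<open>\<gamma>\<close> are the real numbers \<open>a (d - b s)\<close> and \<open>a (d + b s)\<close>, both of the sign of \<open>a\<close>.\<close>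
lemma cmod_beta_gamma: "(cmod \<beta>)\<^sup>2 + (cmod \<gamma>)\<^sup>2 = 2 * of_int (\<bar>a\<bar> * d)"
proof -
  define r where "r = sqrt (of_int d)"
  have r: "r * r = of_int d" "r > 0" unfolding r_def using d_ge_2 by simp_all
  have "(of_int b :: real)\<^sup>2 \<le> r\<^sup>2" unfolding power2_eq_square[of r] r
    unfolding d_eq by simp
  then have "of_int b \<le> r" using r by (simp add: power2_le_iff_abs_le)
  then have "of_int b * r \<le> r * r" using r(2) by (intro mult_right_mono) auto
  then have le: "of_int b * r \<le> of_int d" using r by simp
  have pos: "of_int b * r \<ge> 0" using b_pos r by simp
  have "(cmod \<beta>)\<^sup>2 = cmod (\<beta> * \<beta>)" by (simp add: norm_mult power2_eq_square)
  also have "\<dots> = cmod (complex_of_real (of_int a * (of_int d - of_int b * r)))"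
    unfolding beta_sq by (simp add: rtd_def r_def algebra_simps)
  also have "\<dots> = \<bar>of_int a\<bar> * (of_int d - of_int b * r)"
    using le by (simp only: norm_of_real abs_mult)
  finally have 1: "(cmod \<beta>)\<^sup>2 = \<bar>of_int a\<bar> * (of_int d - of_int b * r)" .
  have "(cmod \<gamma>)\<^sup>2 = cmod (\<gamma> * \<gamma>)" by (simp add: norm_mult power2_eq_square)
  also have "\<dots> = cmod (complex_of_real (of_int a * (of_int d + of_int b * r)))"
    using mult_table_E unfolding mult_table_def by (simp add: rtd_def r_def algebra_simps)
  also have "\<dots> = \<bar>of_int a\<bar> * (of_int d + of_int b * r)"
    using d_ge_2 pos by (simp only: norm_of_real abs_mult)
  finally have 2: "(cmod \<gamma>)\<^sup>2 = \<bar>of_int a\<bar> * (of_int d + of_int b * r)" .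
  show ?thesis unfolding 1 2 by (simp add: algebra_simps)
qed

lemma of_rat_complex: "(of_rat q :: complex) = of_real (of_rat q)"
proof -
  obtain m n where uv: "quotient_of q = (m, n)" by (cases "quotient_of q")
  have q: "q = of_int m / of_int n" using quotient_of_div[OF uv] .
  show ?thesis unfolding q of_rat_divide by simp
qed

text \<open>The mixed terms cancel: \<open>u + v\<close> and \<open>u - v\<close> occur together for \<open>u\<close> in \<open>K\<close>, and so do
  \<open>z \<beta> + w \<gamma>\<close> and \<open>z \<gamma> - w \<beta>\<close>.\<close>
theorem sum_cmod_embeddings:
  "(\<Sum>\<phi>\<in>embeddings F. (cmod (\<phi> (E x y z w)))\<^sup>2) = 4 * of_rat (qf x y z w)"
proof -
  define p q r s :: real where "p = of_rat x" "q = of_rat y" "r = of_rat z" "s = of_rat w"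
  note defs = this
  define t where "t = sqrt (of_int d)"
  have t: "t * t = of_int d" unfolding t_def using d_ge_2 by simp
  have rt: "rtd = of_real t" by (simp add: rtd_def t_def)
  have "(\<Sum>\<phi>\<in>embeddings F. (cmod (\<phi> (E x y z w)))\<^sup>2) =
     (cmod (ev rtd \<beta> \<gamma> x y z w))\<^sup>2 + (cmod (ev (- rtd) \<gamma> (- \<beta>) x y z w))\<^sup>2
     + (cmod (ev rtd (- \<beta>) (- \<gamma>) x y z w))\<^sup>2 + (cmod (ev (- rtd) (- \<gamma>) \<beta> x y z w))\<^sup>2"
    unfolding embeddings_eq using embeddings_distinct by (simp add: emb_E)
  also have "\<dots> = 4 * (p\<^sup>2 + (t * t) * q\<^sup>2) + 2 * (r\<^sup>2 + s\<^sup>2) * ((cmod \<beta>)\<^sup>2 + (cmod \<gamma>)\<^sup>2)"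
    unfolding ev_def of_rat_complex rt defs[symmetric] cmod_power2
    by (simp add: algebra_simps power2_eq_square)
  also have "\<dots> = 4 * (p\<^sup>2 + of_int d * q\<^sup>2 + of_int (\<bar>a\<bar> * d) * (r\<^sup>2 + s\<^sup>2))"
    unfolding t cmod_beta_gamma by (simp add: algebra_simps)
  also have "\<dots> = 4 * of_rat (qf x y z w)"
    by (simp add: qf_def defs of_rat_add of_rat_mult of_rat_power del: of_int_mult of_int_abs)
  finally show ?thesis .
qed

definition minkowski :: "(4 \<Rightarrow> complex \<Rightarrow> complex) \<Rightarrow> complex \<Rightarrow> complex ^ 4"
  where "minkowski e t = (\<chi> i. e i t)"

lemma norm_minkowski:
  assumes "bij_betw e UNIV (embeddings F)"
  shows "(norm (minkowski e (E x y z w)))\<^sup>2 = 4 * of_rat (qf x y z w)"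
proof -
  have "(norm (minkowski e (E x y z w)))\<^sup>2 = (\<Sum>i\<in>UNIV. (cmod (e i (E x y z w)))\<^sup>2)"
    unfolding minkowski_def norm_vec_def L2_set_def by (simp add: sum_nonneg)
  also have "\<dots> = (\<Sum>\<phi>\<in>embeddings F. (cmod (\<phi> (E x y z w)))\<^sup>2)"
    using sum.reindex_bij_betw[OF assms] .
  finally show ?thesis unfolding sum_cmod_embeddings .
qed

lemma emb_form:
  assumes "bij_betw e UNIV (embeddings F)"
  obtains s u v where "e i = emb s u v"
proof -
  have "e i \<in> embeddings F" using assms by (auto simp: bij_betw_def)
  then show thesis using that unfolding embeddings_eq by blast
qed

lemma minkowski_linear:
  assumes "bij_betw e UNIV (embeddings F)"
  shows "minkowski e (E x y z w) = of_rat x *\<^sub>R minkowski e 1 + of_rat y *\<^sub>R minkowski e rtd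
    + of_rat z *\<^sub>R minkowski e \<beta> + of_rat w *\<^sub>R minkowski e \<gamma>"
proof -
  have "e i (E x y z w) = of_rat x *\<^sub>R e i 1 + of_rat y *\<^sub>R e i rtd + of_rat z *\<^sub>R e i \<beta> + of_rat w *\<^sub>R e i \<gamma>" for i
  proof -
    obtain s u v where e: "e i = emb s u v" using emb_form[OF assms] .
    have "emb s u v rtd = s" "emb s u v \<beta> = u" "emb s u v \<gamma> = v" "emb s u v 1 = 1"
      using emb_E[of s u v 0 1 0 0] emb_E[of s u v 0 0 1 0] emb_E[of s u v 0 0 0 1] emb_E[of s u v 1 0 0 0]
      by (simp_all add: ev_def)
    then show ?thesis unfolding e emb_E by (simp add: ev_def of_rat_complex scaleR_conv_of_real)
  qed
  then show ?thesis unfolding minkowski_def by (simp add: Finite_Cartesian_Product.vec_eq_iff)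
qed

lemma minkowski_add:
  assumes "bij_betw e UNIV (embeddings F)" "t \<in> F" "t' \<in> F"
  shows "minkowski e (t + t') = minkowski e t + minkowski e t'"
proof -
  have "e i (t + t') = e i t + e i t'" for i
    using emb_form[OF assms(1), of i] emb_add[OF assms(2,3)] by metis
  then show ?thesis unfolding minkowski_def by (simp add: Finite_Cartesian_Product.vec_eq_iff)
qed

lemma inner_minkowski:
  assumes "bij_betw e UNIV (embeddings F)"
  shows "inner (minkowski e (E x y z w)) (minkowski e (E x' y' z' w')) =
    4 * of_rat (x * x' + of_int d * (y * y') + of_int (\<bar>a\<bar> * d) * (z * z' + w * w'))"
proof -
  have "inner (minkowski e (E x y z w)) (minkowski e (E x' y' z' w')) =
     (4 * of_rat (qf (x + x') (y + y') (z + z') (w + w')) - 4 * of_rat (qf x y z w) - 4 * of_rat (qf x' y' z' w')) / 2"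
    unfolding dot_norm minkowski_add[OF assms E_in_F E_in_F, symmetric] ev_add norm_minkowski[OF assms] ..
  also have "\<dots> = 4 * of_rat ((qf (x + x') (y + y') (z + z') (w + w') - qf x y z w - qf x' y' z' w') / 2)"
    by (simp add: of_rat_divide of_rat_diff)
  also have "(qf (x + x') (y + y') (z + z') (w + w') - qf x y z w - qf x' y' z' w') / 2
    = x * x' + of_int d * (y * y') + of_int (\<bar>a\<bar> * d) * (z * z' + w * w')"
    by (simp add: qf_def algebra_simps power2_eq_square)
  finally show ?thesis .
qed

lemma qf_pos:
  assumes "x \<noteq> 0 \<or> y \<noteq> 0 \<or> z \<noteq> 0 \<or> w \<noteq> 0"
  shows "qf x y z w > 0"
proof -
  have d: "of_int d > (0::rat)" and ad: "of_int (\<bar>a\<bar> * d) > (0::rat)" using d_ge_2 a_nz by simp_all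
  have "x\<^sup>2 \<ge> 0" "of_int d * y\<^sup>2 \<ge> 0" "of_int (\<bar>a\<bar> * d) * (z\<^sup>2 + w\<^sup>2) \<ge> 0"
    using d ad by (simp_all del: of_int_mult)
  moreover have "x\<^sup>2 > 0 \<or> of_int d * y\<^sup>2 > 0 \<or> of_int (\<bar>a\<bar> * d) * (z\<^sup>2 + w\<^sup>2) > 0"
    using assms d ad by (auto simp del: of_int_mult simp: zero_less_mult_iff sum_power2_gt_zero_iff)
  ultimately show ?thesis unfolding qf_def by linarith
qed

text \<open>The minimal vectors of the lattice, in coordinates.\<close>
definition minimal :: "complex set \<Rightarrow> rat \<Rightarrow> rat \<Rightarrow> rat \<Rightarrow> rat \<Rightarrow> bool"
  where "minimal I x y z w \<longleftrightarrow> E x y z w \<in> I \<and> E x y z w \<noteq> 0 \<and>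
    (\<forall>x' y' z' w'. E x' y' z' w' \<in> I \<longrightarrow> E x' y' z' w' \<noteq> 0 \<longrightarrow> qf x y z w \<le> qf x' y' z' w')"

lemma E_0_iff: "E x y z w = 0 \<longleftrightarrow> x = 0 \<and> y = 0 \<and> z = 0 \<and> w = 0"
  using ev_eq_0[OF mult_table_E, of x y z w] by (auto simp: ev_def)

lemma minkowski_0_iff:
  assumes "bij_betw e UNIV (embeddings F)"
  shows "minkowski e (E x y z w) = 0 \<longleftrightarrow> E x y z w = 0"
proof -
  have "minkowski e (E x y z w) = 0 \<longleftrightarrow> (norm (minkowski e (E x y z w)))\<^sup>2 = 0" by simp
  also have "\<dots> \<longleftrightarrow> qf x y z w = 0" unfolding norm_minkowski[OF assms] by simp
  also have "\<dots> \<longleftrightarrow> E x y z w = 0" 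
  proof
    assume "qf x y z w = 0"
    then show "E x y z w = 0" unfolding E_0_iff using qf_pos[of x y z w] by linarith
  next
    assume "E x y z w = 0"
    then show "qf x y z w = 0" unfolding E_0_iff by (simp add: qf_def)
  qed
  finally show ?thesis .
qed

lemma minimal_vectors_iff:
  assumes "bij_betw e UNIV (embeddings F)" and "I \<subseteq> F"
  shows "v \<in> minimal_vectors (minkowski e ` I) \<longleftrightarrow> (\<exists>x y z w. v = minkowski e (E x y z w) \<and> minimal I x y z w)"
proof -
  note M = norm_minkowski[OF assms(1)] and Z = minkowski_0_iff[OF assms(1)]
  have le: "norm (minkowski e (E x y z w)) \<le> norm (minkowski e (E x' y' z' w')) \<longleftrightarrow> qf x y z w \<le> qf x' y' z' w'"
    for x y z w x' y' z' w'
  proof -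
    have "norm (minkowski e (E x y z w)) \<le> norm (minkowski e (E x' y' z' w')) \<longleftrightarrow>
      (norm (minkowski e (E x y z w)))\<^sup>2 \<le> (norm (minkowski e (E x' y' z' w')))\<^sup>2"
      by (simp add: power_mono_iff)
    also have "\<dots> \<longleftrightarrow> qf x y z w \<le> qf x' y' z' w'" unfolding M by (simp add: of_rat_less_eq)
    finally show ?thesis .
  qed
  have mem: "v \<in> minimal_vectors L \<longleftrightarrow> v \<in> L \<and> v \<noteq> 0 \<and> (\<forall>u\<in>L. u \<noteq> 0 \<longrightarrow> norm v \<le> norm u)" for L :: "(complex ^ 4) set"
    unfolding minimal_vectors_def is_arg_min_linorder by auto
  have I: "\<exists>x y z w. t = E x y z w" if "t \<in> I" for t using that assms(2) F_eq by blast
  show ?thesis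
  proof
    assume v: "v \<in> minimal_vectors (minkowski e ` I)"
    then obtain t where t: "t \<in> I" "v = minkowski e t" using mem by blast
    obtain x y z w where xyzw: "t = E x y z w" using I t by blast
    have "minimal I x y z w" unfolding minimal_def
    proof (intro conjI allI impI)
      show "E x y z w \<in> I" using t xyzw by simp
      have "v \<noteq> 0" using v unfolding mem by blast
      then show "E x y z w \<noteq> 0" using Z[of x y z w] t xyzw by simp
      fix x' y' z' w' assume "E x' y' z' w' \<in> I" "E x' y' z' w' \<noteq> 0"
      then have "minkowski e (E x' y' z' w') \<in> minkowski e ` I" "minkowski e (E x' y' z' w') \<noteq> 0"
        using Z[of x' y' z' w'] by auto
      then have "norm v \<le> norm (minkowski e (E x' y' z' w'))" using v unfolding mem by blast
      then show "qf x y z w \<le> qf x' y' z' w'" using le t xyzw by simp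
    qed
    then show "\<exists>x y z w. v = minkowski e (E x y z w) \<and> minimal I x y z w" using t xyzw by blast
  next
    assume "\<exists>x y z w. v = minkowski e (E x y z w) \<and> minimal I x y z w"
    then obtain x y z w where v: "v = minkowski e (E x y z w)" "minimal I x y z w" by blast
    show "v \<in> minimal_vectors (minkowski e ` I)" unfolding mem
    proof (intro conjI ballI impI)
      show "v \<in> minkowski e ` I" using v unfolding minimal_def by blast
      show "v \<noteq> 0" using v Z[of x y z w] unfolding minimal_def by simp
      fix u assume u: "u \<in> minkowski e ` I" "u \<noteq> 0"
      then obtain t where "t \<in> I" "u = minkowski e t" by blast
      then obtain x' y' z' w' where "u = minkowski e (E x' y' z' w')" "E x' y' z' w' \<in> I" using I by blast
      moreover from this have "E x' y' z' w' \<noteq> 0" using Z[of x' y' z' w'] u by simp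
      ultimately show "norm v \<le> norm u" using v le[of x y z w x' y' z' w'] unfolding minimal_def by simp
    qed
  qed
qed

lemma minkowski_span:
  assumes "bij_betw e UNIV (embeddings F)"
  shows "x = 0 \<Longrightarrow> minkowski e (E x y z w) \<in> span {minkowski e rtd, minkowski e \<beta>, minkowski e \<gamma>}"
    and "y = 0 \<Longrightarrow> minkowski e (E x y z w) \<in> span {minkowski e 1, minkowski e \<beta>, minkowski e \<gamma>}"
    and "z = 0 \<Longrightarrow> minkowski e (E x y z w) \<in> span {minkowski e 1, minkowski e rtd, minkowski e \<gamma>}"
    and "w = 0 \<Longrightarrow> minkowski e (E x y z w) \<in> span {minkowski e 1, minkowski e rtd, minkowski e \<beta>}"
  unfolding minkowski_linear[OF assms]
  by (rule span_add; (rule span_add; (rule span_add)?)?; rule scale_in_span; simp)+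

text \<open>Four independent vectors do not fit into the span of three of the four axes.\<close>
theorem well_rounded_coordinates:
  assumes "I \<subseteq> F" "well_rounded_ideal F I"
  shows "\<exists>x y z w. minimal I x y z w \<and> x \<noteq> 0" "\<exists>x y z w. minimal I x y z w \<and> y \<noteq> 0"
    "\<exists>x y z w. minimal I x y z w \<and> z \<noteq> 0" "\<exists>x y z w. minimal I x y z w \<and> w \<noteq> 0"
proof -
  obtain e :: "4 \<Rightarrow> complex \<Rightarrow> complex" where e: "bij_betw e UNIV (embeddings F)"
    and "well_rounded 4 ((\<lambda>x. (\<chi> i. e i x) :: complex ^ 4) ` I)"
    using assms(2) unfolding well_rounded_ideal_def by blast
  then have "well_rounded 4 (minkowski e ` I)" unfolding minkowski_def by simp
  then obtain B where B: "B \<subseteq> minimal_vectors (minkowski e ` I)" "independent B" "card B = 4"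
    unfolding well_rounded_def by blast
  note iff = minimal_vectors_iff[OF e assms(1)]
  have key: "\<exists>x y z w. minimal I x y z w \<and> \<not> Z x y z w"
    if "\<And>x y z w. Z x y z w \<Longrightarrow> minkowski e (E x y z w) \<in> span {t, u, v}"
    for Z :: "rat \<Rightarrow> rat \<Rightarrow> rat \<Rightarrow> rat \<Rightarrow> bool" and t u v
  proof (rule ccontr)
    assume neg: "\<not> ?thesis"
    have "B \<subseteq> span {t, u, v}"
    proof
      fix m assume "m \<in> B"
      then obtain x y z w where "m = minkowski e (E x y z w)" "minimal I x y z w" using B(1) iff by blast
      then show "m \<in> span {t, u, v}" using neg that by blast
    qed
    then have "card B \<le> card {t, u, v}" using independent_span_bound[OF _ B(2), of "{t, u, v}"] by simp
    also have "\<dots> \<le> 3" by (auto simp: card_insert_if)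
    finally show False using B(3) by simp
  qed
  note sp = minkowski_span[OF e]
  show "\<exists>x y z w. minimal I x y z w \<and> x \<noteq> 0" using key[of "\<lambda>x y z w. x = 0", OF sp(1)] .
  show "\<exists>x y z w. minimal I x y z w \<and> y \<noteq> 0" using key[of "\<lambda>x y z w. y = 0", OF sp(2)] .
  show "\<exists>x y z w. minimal I x y z w \<and> z \<noteq> 0" using key[of "\<lambda>x y z w. z = 0", OF sp(3)] .
  show "\<exists>x y z w. minimal I x y z w \<and> w \<noteq> 0" using key[of "\<lambda>x y z w. w = 0", OF sp(4)] .
qed

text \<open>The four sign patterns are the rows of a Hadamard matrix; their combinations recover the four
  orthogonal axes, so the four vectors are independent.\<close>
theorem well_rounded_if_sign_changes:
  assumes "I \<subseteq> F" and nz: "x \<noteq> 0" "y \<noteq> 0" "z \<noteq> 0" "w \<noteq> 0"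
    and min: "minimal I x y z w" "minimal I x y (- z) (- w)" "minimal I x (- y) z (- w)" "minimal I x (- y) (- z) w"
  shows "well_rounded_ideal F I"
proof -
  have "finite (embeddings F)" using card_embeddings by (simp add: card_ge_0_finite)
  moreover have "card (UNIV :: 4 set) = card (embeddings F)" using card_embeddings by simp
  ultimately obtain e :: "4 \<Rightarrow> complex \<Rightarrow> complex" where e: "bij_betw e UNIV (embeddings F)"
    using finite_same_card_bij[of "UNIV :: 4 set"] by auto
  define m where "m = minkowski e"
  define v1 v2 v3 v4 where "v1 = m (E x y z w)" "v2 = m (E x y (- z) (- w))"
    "v3 = m (E x (- y) z (- w))" "v4 = m (E x (- y) (- z) w)"
  note v_defs = this
  define B where "B = {v1, v2, v3, v4}"
  define C where "C = {m 1, m rtd, m \<beta>, m \<gamma>}"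
  have B_min: "B \<subseteq> minimal_vectors (m ` I)"
    unfolding B_def v_defs m_def using minimal_vectors_iff[OF e assms(1)] min by blast
  note lin = minkowski_linear[OF e, folded m_def]
  have vB: "v1 \<in> span B" "v2 \<in> span B" "v3 \<in> span B" "v4 \<in> span B"
    unfolding B_def by (auto intro: span_base)
  have scale: "u \<in> span B" if "(4 * of_rat k) *\<^sub>R u \<in> span B" "k \<noteq> 0" for u k
    using span_scale[OF that(1), of "inverse (4 * of_rat k)"] that(2) by simp
  have "v1 + v2 + v3 + v4 \<in> span B" "v1 + v2 - v3 - v4 \<in> span B" "v1 - v2 + v3 - v4 \<in> span B" "v1 - v2 - v3 + v4 \<in> span B"
    using vB by (simp_all add: span_add span_diff)
  note sums = this
  have four: "(4 * r) *\<^sub>R u = r *\<^sub>R u + r *\<^sub>R u + r *\<^sub>R u + r *\<^sub>R u" for r and u :: "complex ^ 4"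
    by (simp add: scaleR_add_left[symmetric])
  have hadamard:
    "(p + q + r + s) + (p + q + - r + - s) + (p + - q + r + - s) + (p + - q + - r + s) = p + p + p + p"
    "(p + q + r + s) + (p + q + - r + - s) - (p + - q + r + - s) - (p + - q + - r + s) = q + q + q + q"
    "(p + q + r + s) - (p + q + - r + - s) + (p + - q + r + - s) - (p + - q + - r + s) = r + r + r + r"
    "(p + q + r + s) - (p + q + - r + - s) - (p + - q + r + - s) + (p + - q + - r + s) = s + s + s + s"
    for p q r s :: "'v :: ab_group_add" by (simp_all add: algebra_simps)
  have "v1 + v2 + v3 + v4 = (4 * of_rat x) *\<^sub>R m 1" "v1 + v2 - v3 - v4 = (4 * of_rat y) *\<^sub>R m rtd"
    "v1 - v2 + v3 - v4 = (4 * of_rat z) *\<^sub>R m \<beta>" "v1 - v2 - v3 + v4 = (4 * of_rat w) *\<^sub>R m \<gamma>"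
    unfolding v_defs lin four of_rat_minus scaleR_minus_left by (simp_all only: hadamard)
  note eqs = this
  have "C \<subseteq> span B" unfolding C_def using scale[OF sums(1)[unfolded eqs(1)] nz(1)]
    scale[OF sums(2)[unfolded eqs(2)] nz(2)] scale[OF sums(3)[unfolded eqs(3)] nz(3)]
    scale[OF sums(4)[unfolded eqs(4)] nz(4)] by simp
  note C_span = this
  note inn = inner_minkowski[OF e, folded m_def] and m_basis = E_basis[THEN arg_cong[where f = m]]
  have nz': "m 1 \<noteq> 0" "m rtd \<noteq> 0" "m \<beta> \<noteq> 0" "m \<gamma> \<noteq> 0"
    unfolding m_basis unfolding m_def minkowski_0_iff[OF e] E_0_iff by simp_all
  have orth: "inner (m 1) (m rtd) = 0" "inner (m 1) (m \<beta>) = 0" "inner (m 1) (m \<gamma>) = 0"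
    "inner (m rtd) (m \<beta>) = 0" "inner (m rtd) (m \<gamma>) = 0" "inner (m \<beta>) (m \<gamma>) = 0"
    unfolding m_basis inn by simp_all
  have indC: "independent C"
  proof (rule pairwise_orthogonal_independent)
    show "pairwise Linear_Algebra.orthogonal C" unfolding C_def pairwise_def Linear_Algebra.orthogonal_def
      using orth by (auto simp: inner_commute)
    show "0 \<notin> C" unfolding C_def using nz' by auto
  qed
  have "m 1 \<noteq> m rtd" "m 1 \<noteq> m \<beta>" "m 1 \<noteq> m \<gamma>" "m rtd \<noteq> m \<beta>" "m rtd \<noteq> m \<gamma>" "m \<beta> \<noteq> m \<gamma>"
    using orth nz' by (metis inner_eq_zero_iff)+
  then have "card C = 4" unfolding C_def by simp
  then have dim: "4 \<le> dim (span B)" using independent_card_le_dim[OF C_span indC] by simp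
  have finB: "finite B" "card B \<le> 4" unfolding B_def by (auto simp: card_insert_if)
  then have "independent B" using card_le_dim_spanning[of B "span B"] dim by (auto intro: span_base)
  moreover have "dim (span B) \<le> card B" using finB dim_le_card[of "span B" B] by simp
  ultimately have "well_rounded 4 (m ` I)" unfolding well_rounded_def using B_min dim finB by (intro exI[of _ B]) auto
  then show ?thesis unfolding well_rounded_ideal_def using e unfolding m_def minkowski_def by blast
qed

end

section \<open>The ring of integers\<close>

lemma algebraic_int_of_square: "algebraic_int (x\<^sup>2) \<Longrightarrow> algebraic_int (x :: complex)"
  by (rule algebraic_int_root[where p = "monom 1 2" and y = "x\<^sup>2"]) (auto simp: poly_monom degree_monom_eq)

lemma algebraic_int_of_rat:
  assumes "algebraic_int (of_rat q :: complex)"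
  obtains k where "q = of_int k"
proof -
  have "(of_rat q :: complex) \<in> \<int>" using rational_algebraic_int_is_int[OF assms] by simp
  then obtain k where "of_rat q = (of_int k :: complex)" using Ints_cases by blast
  then have "of_rat q = (of_rat (of_int k) :: complex)" by simp
  then have "q = of_int k" by (simp only: of_rat_eq_iff)
  then show thesis using that by blast
qed

text \<open>Linear facts, stated for variables so that they apply to nonlinear terms.\<close>
lemma int_dvd_arith:
  fixes u v w z :: int
  shows "4 dvd 4 * u + 2 * v \<Longrightarrow> even v" and "2 * u = 4 * v \<Longrightarrow> even u" and "4 dvd u \<Longrightarrow> even u"
    and "2 * u = 8 * v \<Longrightarrow> 4 dvd u" and "u = v + 8 * w \<Longrightarrow> 8 dvd u \<Longrightarrow> 8 dvd v"
    and "4 dvd (u + 4 * v) - (w + 4 * z) \<Longrightarrow> 4 dvd u - w" and "4 dvd u - v \<Longrightarrow> v = w + 4 * z \<Longrightarrow> 4 dvd u - w"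
  by presburger+

lemma odd_square_mod_8:
  fixes i :: int
  assumes "odd i"
  obtains k where "i\<^sup>2 = 8 * k + 1"
proof -
  obtain h where h: "i = 2 * h + 1" using assms by (auto elim: oddE)
  have "even (h * (h + 1))" by simp
  then obtain k where "h * (h + 1) = 2 * k" by (rule evenE)
  then have "i\<^sup>2 = 8 * k + 1" using h by (simp add: power2_eq_square algebra_simps)
  then show thesis using that by blast
qed

lemma mod_4_cases_odd:
  fixes a :: int assumes "odd a" shows "a mod 4 = 1 \<or> a mod 4 = 3"
  using assms by presburger

lemma four_dvd_sum_of_odds:
  fixes m n i j :: int
  assumes "odd m" "odd n" "odd i" "odd j" and "4 dvd m * n - i * j"
  shows "4 dvd m + n + i + j"
proof -
  obtain m' n' i' j' where e: "m = 2 * m' + 1" "n = 2 * n' + 1" "i = 2 * i' + 1" "j = 2 * j' + 1"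
    using assms by (meson oddE)
  have "m * n - i * j = 4 * (m' * n' - i' * j') + 2 * (m' + n' - i' - j')"
    by (simp add: e algebra_simps)
  then have "even (m' + n' - i' - j')" using assms(5) int_dvd_arith(1) by metis
  then show ?thesis unfolding e by presburger
qed

text \<open>The coordinates of \<open>\<alpha>\<^sup>2 = \<omega> \<alpha> + g + f \<omega>\<close> in the proof of \<open>quarter_int\<close>, unevaluated; \<open>A, B, C, D\<close> stand for
  \<open>a d\<close>, \<open>a b\<close>, \<open>a c\<close>, \<open>d\<close>.\<close>
lemma quarter_square_coords:
  fixes A B C D b c f g :: rat
  assumes "2 * A = 16 * g + D + 1 + 8 * f" "C = 4 * f + 1"
  shows "1/4 * (1/4) + D * (1/4 * (1/4)) + A * (1/4 * (1/4) + 1/4 * (1/4)) =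
      (1/2 * (1/4) + D * (1/2 * (1/4)) + A * (0 * (1/4) + 0 * (1/4))) + g + f * (1/2)" (is ?T1)
    and "1/4 * (1/4) + 1/4 * (1/4) + B * (1/4 * (1/4) - 1/4 * (1/4)) + C * (1/4 * (1/4) + 1/4 * (1/4)) =
      (1/2 * (1/4) + 1/2 * (1/4) + B * (0 * (1/4) - 0 * (1/4)) + C * (0 * (1/4) + 0 * (1/4))) + 0 + f * (1/2)" (is ?T2)
    and "1/4 * (1/4) + 1/4 * (1/4) - b * (1/4 * (1/4) + 1/4 * (1/4)) + c * (1/4 * (1/4) + 1/4 * (1/4)) =
      1/2 * (1/4) + 0 * (1/4) - b * (1/2 * (1/4) + 0 * (1/4)) + c * (1/2 * (1/4) + 0 * (1/4)) + 0 + f * 0" (is ?T3)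
    and "1/4 * (1/4) + 1/4 * (1/4) + c * (1/4 * (1/4) + 1/4 * (1/4)) + b * (1/4 * (1/4) + 1/4 * (1/4)) =
      1/2 * (1/4) + 0 * (1/4) + c * (1/2 * (1/4) + 0 * (1/4)) + b * (1/2 * (1/4) + 0 * (1/4)) + 0 + f * 0" (is ?T4)
proof -
  have A: "A = 8 * g + D / 2 + 1 / 2 + 4 * f" using assms(1) by (simp add: field_simps)
  show ?T1 unfolding A by (simp add: algebra_simps)
  show ?T2 unfolding assms(2) by (simp add: algebra_simps)
  show ?T3 by (simp add: algebra_simps)
  show ?T4 by (simp add: algebra_simps)
qed

context cyclic_quartic begin

lemma poly_in_F: "t \<in> F \<Longrightarrow> poly (map_poly of_int p) t \<in> F"
proof (induction p)
  case 0 then show ?case using of_rat_in_F[of 0] by simp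
next
  case (pCons k p)
  have "of_int k \<in> F" using of_rat_in_F[of "of_int k"] by simp
  then show ?case using pCons F_closed(5,6) by (simp add: map_poly_pCons)
qed

lemma emb_poly:
  assumes "mult_table s u v" "t \<in> F"
  shows "emb s u v (poly (map_poly of_int p) t) = poly (map_poly of_int p) (emb s u v t)"
proof (induction p)
  case 0 then show ?case using emb_rat[of s u v 0] by simp
next
  case (pCons k p)
  have k: "of_int k \<in> F" using of_rat_in_F[of "of_int k"] by simp
  have m: "t * poly (map_poly of_int p) t \<in> F" using poly_in_F assms(2) F_closed(6) by blast
  have "emb s u v (of_int k) = of_int k" using emb_rat[of s u v "of_int k"] by simp
  then show ?case
    using emb_add[OF k m, of s u v] emb_mult[OF assms(1,2) poly_in_F[OF assms(2), of p]] pCons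
    by (simp add: map_poly_pCons)
qed

lemma algebraic_int_emb:
  assumes "mult_table s u v" "algebraic_int (E x y z w)"
  shows "algebraic_int (ev s u v x y z w)"
proof -
  obtain p where p: "poly (map_poly of_int p) (E x y z w) = 0" "lead_coeff p = 1"
    using assms(2) unfolding algebraic_int_altdef_ipoly by blast
  have "poly (map_poly of_int p) (emb s u v (E x y z w)) = emb s u v 0"
    using emb_poly[OF assms(1) E_in_F, of p x y z w] p(1) by simp
  then have "poly (map_poly of_int p) (ev s u v x y z w) = 0"
    using emb_rat[of s u v 0] by (simp add: emb_E)
  then show ?thesis using p(2) unfolding algebraic_int_altdef_ipoly by blast
qed

lemma algebraic_int_conj: "algebraic_int (E x y z w) \<Longrightarrow> algebraic_int (E x (- y) (- w) z)"
  using algebraic_int_emb[OF tables(2), of x y z w] by (simp add: ev_def of_rat_minus algebra_simps)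

lemma algebraic_int_conj2: "algebraic_int (E x y z w) \<Longrightarrow> algebraic_int (E x y (- z) (- w))"
  using algebraic_int_emb[OF tables(3), of x y z w] by (simp add: ev_def of_rat_minus)

lemma E_cong: "x = x' \<Longrightarrow> y = y' \<Longrightarrow> z = z' \<Longrightarrow> w = w' \<Longrightarrow> E x y z w = E x' y' z' w'"
  by simp

lemma E_of_int: "of_int k = E (of_int k) 0 0 0"
  by (simp add: ev_def)

lemma E_int_scale: "of_int k * E x y z w = E (of_int k * x) (of_int k * y) (of_int k * z) (of_int k * w)"
  using ev_scale[of "of_int k"] by simp

lemma rtd_int: "algebraic_int rtd"
  by (rule algebraic_int_of_square) (simp add: power2_eq_square rtd_sq)

lemma beta_int: "algebraic_int \<beta>"
  by (rule algebraic_int_of_square)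
    (unfold power2_eq_square beta_sq, intro algebraic_int_diff algebraic_int_mult rtd_int algebraic_int_of_int)

lemma gamma_int: "algebraic_int \<gamma>"
  using algebraic_int_conj[of 0 0 1 0] beta_int by (simp add: ev_def)

lemma E_int_coords:
  "algebraic_int (E (of_int m) (of_int n) (of_int i) (of_int j))"
  unfolding ev_def of_rat_of_int_eq
  by (intro algebraic_int_add algebraic_int_mult rtd_int beta_int gamma_int algebraic_int_of_int)

text \<open>The trace \<open>2 x\<close> and the norm \<open>x\<^sup>2 - d y\<^sup>2\<close> are integers, so \<open>d (2 y)\<^sup>2\<close> is one and \<open>d\<close> is squarefree.\<close>
lemma K_integers:
  assumes "algebraic_int (E x y 0 0)"
  obtains m n where "x = of_int m / 2" "y = of_int n / 2" "4 dvd m\<^sup>2 - d * n\<^sup>2"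
proof -
  have c: "algebraic_int (E x (- y) 0 0)" using algebraic_int_conj[OF assms] by simp
  have "algebraic_int (E x y 0 0 + E x (- y) 0 0)" using algebraic_int_add[OF assms c] .
  then have "algebraic_int (of_rat (2 * x) :: complex)" unfolding ev_add by (simp add: ev_def)
  then obtain m where m: "2 * x = of_int m" by (rule algebraic_int_of_rat)
  have "algebraic_int (E x y 0 0 * E x (- y) 0 0)" using algebraic_int_mult[OF assms c] .
  then obtain k where k: "x\<^sup>2 - of_int d * y\<^sup>2 = of_int k"
    unfolding ev_norm_Q[OF mult_table_E] by (rule algebraic_int_of_rat)
  have "of_int d * (2 * y)\<^sup>2 = (2 * x)\<^sup>2 - 4 * (x\<^sup>2 - of_int d * y\<^sup>2)" by (simp add: algebra_simps power2_eq_square)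
  also have "\<dots> = of_int (m\<^sup>2 - 4 * k)" unfolding m k by simp
  finally have dy: "of_int d * (2 * y)\<^sup>2 = of_int (m\<^sup>2 - 4 * k)" .
  then have "2 * y \<in> \<int>" using rat_int_of_squarefree_mult_square[OF squarefree_d, of "2 * y"] by simp
  then obtain n where n: "2 * y = of_int n" using Ints_cases by blast
  have "of_int (d * n\<^sup>2) = (of_int (m\<^sup>2 - 4 * k) :: rat)" using dy unfolding n by simp
  then have "d * n\<^sup>2 = m\<^sup>2 - 4 * k" by (simp only: of_int_eq_iff)
  then have "4 dvd m\<^sup>2 - d * n\<^sup>2" by simp
  moreover have "x = of_int m / 2" "y = of_int n / 2" using m n by simp_all
  ultimately show thesis using that by blast
qed

lemma d_mod_4: "odd d \<Longrightarrow> d mod 4 = 1" "even d \<Longrightarrow> d mod 4 = 2 \<and> odd b \<and> odd c"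
proof -
  have sq: "x\<^sup>2 mod 4 = (if even x then 0 else 1)" for x :: int
  proof (cases "even x")
    case True
    then obtain k where "x = 2 * k" by (auto elim: evenE)
    then show ?thesis by (simp add: power2_eq_square)
  next
    case False
    then obtain k where k: "x\<^sup>2 = 8 * k + 1" by (rule odd_square_mod_8)
    have "(8 * k + 1) mod 4 = 1" by presburger
    then show ?thesis using False k by simp
  qed
  have d: "d mod 4 = ((if even b then 0 else 1) + (if even c then 0 else 1)) mod 4"
    using mod_add_eq[of "b\<^sup>2" 4 "c\<^sup>2"] unfolding d_eq sq by simp
  then show "odd d \<Longrightarrow> d mod 4 = 1" unfolding d_eq by (auto split: if_splits)
  assume "even d"
  have "\<not> 4 dvd d"
  proof
    assume "4 dvd d"
    then have "2\<^sup>2 dvd d" by simp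
    then have "(2::int) dvd 1" using squarefree_d unfolding squarefree_def by blast
    then show False by simp
  qed
  then show "d mod 4 = 2 \<and> odd b \<and> odd c" using d \<open>even d\<close> by (auto split: if_splits) presburger+
qed

lemma K_parity:
  assumes "4 dvd m\<^sup>2 - d * n\<^sup>2"
  shows "odd d \<Longrightarrow> even m \<longleftrightarrow> even n" "even d \<Longrightarrow> even m \<and> even n"
proof -
  have e: "even (m\<^sup>2 - d * n\<^sup>2)" by (rule int_dvd_arith(3)[OF assms])
  then show "odd d \<Longrightarrow> even m \<longleftrightarrow> even n" by simp
  assume d: "even d"
  then have m: "even m" using e by simp
  then obtain k where "m = 2 * k" by (auto elim: evenE)
  then have "4 dvd m\<^sup>2" by simp
  then have "4 dvd d * n\<^sup>2" using assms by (metis dvd_diff_commute dvd_diffD1 dvd_diff_right_iff)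
  moreover obtain l where "d = 4 * l + 2"
    using d_mod_4(2)[OF d] mult_div_mod_eq[of 4 d] that[of "d div 4"] by simp
  ultimately have "4 dvd 4 * (l * n\<^sup>2) + 2 * n\<^sup>2" by (simp add: algebra_simps)
  then have "even (n\<^sup>2)" by (rule int_dvd_arith(1))
  then show "even m \<and> even n" using m by simp
qed

text \<open>For \<open>\<mu> = (z \<beta> + w \<gamma>) / 2\<close> both \<open>\<mu>\<^sup>2\<close> and \<open>\<mu>\<close> times its conjugate lie in \<open>K\<close>. Their integrality gives linear
  conditions on \<open>z\<^sup>2\<close>, \<open>w\<^sup>2\<close> and \<open>z w\<close>; eliminating \<open>z w\<close> by means of \<open>b\<^sup>2 + c\<^sup>2 = d\<close> shows that \<open>a d z\<^sup>2\<close> and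
  \<open>a d w\<^sup>2\<close> are integers, and \<open>a d\<close> is squarefree.\<close>
lemma beta_gamma_part_integers:
  assumes "algebraic_int (E 0 0 (z / 2) (w / 2))"
  obtains i j where "z = of_int i" "w = of_int j" "even i \<longleftrightarrow> even j" "odd b \<Longrightarrow> even i"
proof -
  let ?t = "E 0 0 (z / 2) (w / 2)" and ?t' = "E 0 0 (- w / 2) (z / 2)"
  have c: "algebraic_int ?t'" using algebraic_int_conj[OF assms] by simp
  have "algebraic_int (?t * ?t)" using algebraic_int_mult[OF assms assms] .
  also have "?t * ?t = E (of_int (a * d) * (z\<^sup>2 + w\<^sup>2) / 4) ((of_int (a * b) * (w\<^sup>2 - z\<^sup>2) + 2 * of_int (a * c) * z * w) / 4) 0 0"
    unfolding E_mult mul_defs by (simp add: field_simps power2_eq_square)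
  finally obtain U V where U: "of_int (a * d) * (z\<^sup>2 + w\<^sup>2) / 4 = of_int U / (2::rat)"
    and V: "(of_int (a * b) * (w\<^sup>2 - z\<^sup>2) + 2 * of_int (a * c) * z * w) / 4 = of_int V / (2::rat)"
    by (rule K_integers)
  have "algebraic_int (?t * ?t')" using algebraic_int_mult[OF assms c] .
  also have "?t * ?t' = E 0 ((2 * of_int (a * b) * z * w + of_int (a * c) * (z\<^sup>2 - w\<^sup>2)) / 4) 0 0"
    unfolding E_mult mul_defs by (simp add: field_simps power2_eq_square)
  finally obtain W0 W' where W0: "(0::rat) = of_int W0 / 2"
    and W': "(2 * of_int (a * b) * z * w + of_int (a * c) * (z\<^sup>2 - w\<^sup>2)) / 4 = of_int W' / (2::rat)"
    and W4: "4 dvd W0\<^sup>2 - d * W'\<^sup>2"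
    by (rule K_integers)
  have "W0 = 0" using W0 by simp
  then have "even W'"
    using W4 K_parity[of W0 W'] by (cases "even d") auto
  then obtain W where "W' = 2 * W" by (auto elim: evenE)
  then have W: "2 * of_int (a * b) * z * w + of_int (a * c) * (z\<^sup>2 - w\<^sup>2) = 4 * (of_int W :: rat)"
    using W' by simp
  have U': "of_int (a * d) * (z\<^sup>2 + w\<^sup>2) = 2 * (of_int U :: rat)" using U by (simp add: field_simps)
  have V': "of_int (a * b) * (w\<^sup>2 - z\<^sup>2) + 2 * of_int (a * c) * z * w = 2 * (of_int V :: rat)" using V by (simp add: field_simps)
  \<comment> \<open>eliminate \<open>z w\<close>; the factor \<open>c\<^sup>2 + b\<^sup>2\<close> appears\<close>
  have "of_int (a * d) * (z\<^sup>2 - w\<^sup>2) =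
     of_int c * (2 * of_int (a * b) * z * w + of_int (a * c) * (z\<^sup>2 - w\<^sup>2))
     - of_int b * (of_int (a * b) * (w\<^sup>2 - z\<^sup>2) + 2 * of_int (a * c) * z * w)"
    unfolding d_eq by (simp add: algebra_simps power2_eq_square)
  also have "\<dots> = of_int (4 * c * W - 2 * b * V)" unfolding W V' by (simp add: algebra_simps)
  finally have D: "of_int (a * d) * (z\<^sup>2 - w\<^sup>2) = of_int (4 * c * W - 2 * b * V)" .
  have "2 * (of_int (a * d) * z\<^sup>2) = of_int (a * d) * (z\<^sup>2 + w\<^sup>2) + of_int (a * d) * (z\<^sup>2 - w\<^sup>2)"
    by (simp add: algebra_simps)
  also have "\<dots> = 2 * of_int (U + 2 * c * W - b * V)" unfolding U' D by simp
  finally have "of_int (a * d) * z\<^sup>2 = of_int (U + 2 * c * W - b * V)" by simp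
  then have "z \<in> \<int>" using rat_int_of_squarefree_mult_square[OF squarefree_ad, of z] by (metis Ints_of_int)
  then obtain i where i: "z = of_int i" using Ints_cases by blast
  have "2 * (of_int (a * d) * w\<^sup>2) = of_int (a * d) * (z\<^sup>2 + w\<^sup>2) - of_int (a * d) * (z\<^sup>2 - w\<^sup>2)"
    by (simp add: algebra_simps)
  also have "\<dots> = 2 * of_int (U - 2 * c * W + b * V)" unfolding U' D by simp
  finally have "of_int (a * d) * w\<^sup>2 = of_int (U - 2 * c * W + b * V)" by simp
  then have "w \<in> \<int>" using rat_int_of_squarefree_mult_square[OF squarefree_ad, of w] by (metis Ints_of_int)
  then obtain j where j: "w = of_int j" using Ints_cases by blast
  have "of_int (a * d * (i\<^sup>2 + j\<^sup>2)) = (of_int (2 * U) :: rat)" using U' unfolding i j by simp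
  then have Ui: "a * d * (i\<^sup>2 + j\<^sup>2) = 2 * U" by (simp only: of_int_eq_iff)
  have "of_int (a * b * (j\<^sup>2 - i\<^sup>2) + 2 * (a * c) * i * j) = (of_int (2 * V) :: rat)" using V' unfolding i j by simp
  then have Vi: "a * b * (j\<^sup>2 - i\<^sup>2) + 2 * (a * c) * i * j = 2 * V" by (simp only: of_int_eq_iff)
  have "of_int (2 * (a * b) * i * j + a * c * (i\<^sup>2 - j\<^sup>2)) = (of_int (4 * W) :: rat)" using W unfolding i j by simp
  then have Wi: "2 * (a * b) * i * j + a * c * (i\<^sup>2 - j\<^sup>2) = 4 * W" by (simp only: of_int_eq_iff)
  have ij: "even i \<longleftrightarrow> even j"
  proof (cases "even d")
    case True
    then have "odd b" using d_mod_4 by blast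
    have "even (a * b * (j\<^sup>2 - i\<^sup>2) + 2 * (a * c) * i * j)" unfolding Vi by simp
    then show ?thesis using \<open>odd b\<close> odd_a by auto
  next
    case False
    have "even (a * d * (i\<^sup>2 + j\<^sup>2))" unfolding Ui by simp
    then show ?thesis using False odd_a by auto
  qed
  moreover have "even i" if "odd b"
  proof (rule ccontr)
    assume "odd i"
    then have "odd j" using ij by simp
    obtain k l where kl: "i\<^sup>2 = 8 * k + 1" "j\<^sup>2 = 8 * l + 1"
      using odd_square_mod_8 \<open>odd i\<close> \<open>odd j\<close> by metis
    have "2 * (a * b * i * j) = 4 * (W - 2 * (a * c * (k - l)))" using Wi unfolding kl by (simp add: algebra_simps)
    then have "even (a * b * i * j)" by (rule int_dvd_arith(2))
    then show False using odd_a \<open>odd b\<close> \<open>odd i\<close> \<open>odd j\<close> by simp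
  qed
  ultimately show thesis using that i j by blast
qed

text \<open>The sum and the difference of an integer and its conjugate over \<open>K\<close> are covered by the two lemmas
  above. The last three conditions express the integrality of their product, the relative norm.\<close>
lemma integer_coordinates:
  assumes "algebraic_int (E x y z w)"
  obtains m n i j M N where "x = of_int m / 4" "y = of_int n / 4" "z = of_int i / 4" "w = of_int j / 4"
    "4 dvd m\<^sup>2 - d * n\<^sup>2" "even i \<longleftrightarrow> even j" "odd b \<Longrightarrow> even i"
    "m\<^sup>2 + d * n\<^sup>2 - a * d * (i\<^sup>2 + j\<^sup>2) = 8 * M" "2 * m * n + a * b * (i\<^sup>2 - j\<^sup>2) - 2 * (a * c) * i * j = 8 * N"
    "4 dvd M\<^sup>2 - d * N\<^sup>2"
proof -
  have c: "algebraic_int (E x y (- z) (- w))" using algebraic_int_conj2[OF assms] .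
  have "algebraic_int (E (2 * x) (2 * y) 0 0)"
    using algebraic_int_add[OF assms c] unfolding ev_add by simp
  then obtain m n where mn: "2 * x = of_int m / 2" "2 * y = of_int n / 2" "4 dvd m\<^sup>2 - d * n\<^sup>2" by (rule K_integers)
  have "algebraic_int (E 0 0 ((4 * z) / 2) ((4 * w) / 2))"
    using algebraic_int_diff[OF assms c] unfolding ev_diff by simp
  then obtain i j where ij: "4 * z = of_int i" "4 * w = of_int j" "even i \<longleftrightarrow> even j" "odd b \<Longrightarrow> even i"
    by (rule beta_gamma_part_integers) blast
  have co: "x = of_int m / 4" "y = of_int n / 4" "z = of_int i / 4" "w = of_int j / 4" using mn ij by simp_all
  have "algebraic_int (E (normA x y z w) (normB x y z w) 0 0)"
    using algebraic_int_mult[OF assms c] unfolding ev_norm_K[OF mult_table_E] .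
  then obtain M N where MN: "normA x y z w = of_int M / 2" "normB x y z w = of_int N / 2" "4 dvd M\<^sup>2 - d * N\<^sup>2"
    by (rule K_integers)
  have "of_int (m\<^sup>2 + d * n\<^sup>2 - a * d * (i\<^sup>2 + j\<^sup>2)) = (of_int (8 * M) :: rat)"
    using MN(1) unfolding co normA_def by (simp add: field_simps power2_eq_square)
  then have 1: "m\<^sup>2 + d * n\<^sup>2 - a * d * (i\<^sup>2 + j\<^sup>2) = 8 * M" by (simp only: of_int_eq_iff)
  have "of_int (2 * m * n + a * b * (i\<^sup>2 - j\<^sup>2) - 2 * (a * c) * i * j) = (of_int (8 * N) :: rat)"
    using MN(2) unfolding co normB_def by (simp add: field_simps power2_eq_square)
  then have 2: "2 * m * n + a * b * (i\<^sup>2 - j\<^sup>2) - 2 * (a * c) * i * j = 8 * N" by (simp only: of_int_eq_iff)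
  show thesis using that[OF co mn(3) ij(3,4) 1 2 MN(3)] .
qed

text \<open>The module generated by 1 and \<open>\<omega> = (1 + s) / 2\<close> is stable under \<open>\<omega>\<close>, as \<open>\<omega>\<^sup>2 = \<omega> + (d - 1) / 4\<close>.\<close>
lemma omega_int:
  assumes "odd d"
  shows "algebraic_int (E (1/2) (1/2) 0 0)"
proof -
  define \<omega> where "\<omega> = E (1/2) (1/2) 0 0"
  have "d = 4 * (d div 4) + 1" using d_mod_4(1)[OF assms] by presburger
  then obtain e where e: "d = 4 * e + 1" by blast
  have e': "(of_int d :: rat) = 4 * of_int e + 1" by (simp add: e)
  have sq: "\<omega> * \<omega> = \<omega> + of_int e"
    unfolding \<omega>_def E_of_int[of e] E_mult ev_add by (rule E_cong) (simp_all add: mul_defs e')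
  have nz: "\<exists>s\<in>{1, \<omega>}. s \<noteq> 0" by simp
  have fin: "finite {1, \<omega>}" by simp
  have b: "1 \<in> int_span {1, \<omega>}" "\<omega> \<in> int_span {1, \<omega>}" by (simp_all add: int_span_base)
  have "\<omega> * \<omega> \<in> int_span {1, \<omega>}" unfolding sq using int_span_add[OF b(2) int_span_scale[OF b(1), of e]] by simp
  then have "\<omega> * s \<in> int_span {1, \<omega>}" if "s \<in> {1, \<omega>}" for s using that b by auto
  then have "algebraic_int \<omega>" by (rule algebraic_int_if_int_span_invariant[OF fin nz])
  then show ?thesis unfolding \<omega>_def .
qed

lemma K_half_int:
  assumes "odd d" "even m \<longleftrightarrow> even n"
  shows "algebraic_int (E (of_int m / 2) (of_int n / 2) 0 0)"
proof -
  have "even (m - n)" using assms by simp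
  then obtain k where "m - n = 2 * k" by (rule evenE)
  then have k: "m = 2 * k + n" by simp
  have "E (of_int m / 2) (of_int n / 2) 0 0 = of_int k + of_int n * E (1/2) (1/2) 0 0"
    unfolding k E_of_int[of k] E_int_scale ev_add by (rule E_cong) (simp_all add: add_divide_distrib)
  then show ?thesis using omega_int[OF assms(1)] algebraic_int_add algebraic_int_mult algebraic_int_of_int by metis
qed

text \<open>The relative norm makes the \<open>K\<close>-part of an integer an integer; then so is the rest.\<close>
theorem integers_d_even:
  assumes "even d" "algebraic_int (E x y z w)"
  obtains m n i j where "x = of_int m" "y = of_int n" "z = of_int i" "w = of_int j"
proof -
  obtain m n i j M N where co: "x = of_int m / 4" "y = of_int n / 4" "z = of_int i / 4" "w = of_int j / 4"
    and mn: "4 dvd m\<^sup>2 - d * n\<^sup>2" and ij: "even i \<longleftrightarrow> even j" "odd b \<Longrightarrow> even i"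
    and R: "m\<^sup>2 + d * n\<^sup>2 - a * d * (i\<^sup>2 + j\<^sup>2) = 8 * M" and S: "2 * m * n + a * b * (i\<^sup>2 - j\<^sup>2) - 2 * (a * c) * i * j = 8 * N"
    and MN: "4 dvd M\<^sup>2 - d * N\<^sup>2" using integer_coordinates[OF assms(2)] by blast
  have b: "odd b" using d_mod_4(2) assms by blast
  have ev: "even m" "even n" "even i" "even j" using K_parity(2)[OF mn assms(1)] ij b by simp_all
  obtain m' n' i' j' where h: "m = 2 * m'" "n = 2 * n'" "i = 2 * i'" "j = 2 * j'" using ev by (meson evenE)
  obtain M' N' where H: "M = 2 * M'" "N = 2 * N'" using K_parity(2)[OF MN assms(1)] by (meson evenE)
  have R': "m'\<^sup>2 + d * n'\<^sup>2 - a * d * (i'\<^sup>2 + j'\<^sup>2) = 4 * M'" using R unfolding h H by (simp add: power2_eq_square algebra_simps)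
  have S': "2 * m' * n' + a * b * (i'\<^sup>2 - j'\<^sup>2) - 2 * (a * c) * i' * j' = 4 * N'" using S unfolding h H by (simp add: power2_eq_square algebra_simps)
  have "even (2 * m' * n' + a * b * (i'\<^sup>2 - j'\<^sup>2) - 2 * (a * c) * i' * j')" unfolding S' by simp
  then have "even (i'\<^sup>2 - j'\<^sup>2)" using odd_a b by simp
  then have "even (i'\<^sup>2 + j'\<^sup>2)" by simp
  then have "4 dvd a * d * (i'\<^sup>2 + j'\<^sup>2)" using mult_dvd_mono[of 2 "a * d" 2 "i'\<^sup>2 + j'\<^sup>2"] assms(1) by simp
  then have "4 dvd 4 * M' + a * d * (i'\<^sup>2 + j'\<^sup>2)" by simp
  then have "4 dvd m'\<^sup>2 + d * n'\<^sup>2" unfolding R'[symmetric] by simp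
  moreover have "4 dvd (m'\<^sup>2 + d * n'\<^sup>2) - (m'\<^sup>2 - d * n'\<^sup>2)"
    using mult_dvd_mono[of 2 2 2 "d * n'\<^sup>2"] assms(1) by simp
  ultimately have "4 dvd m'\<^sup>2 - d * n'\<^sup>2" using dvd_diff_right_iff by blast
  then have ev': "even m'" "even n'" using K_parity(2) assms(1) by blast+
  obtain m2 n2 where h2: "m' = 2 * m2" "n' = 2 * n2" using ev' by (meson evenE)
  have xy: "x = of_int m2" "y = of_int n2" using co unfolding h h2 by simp_all
  have "algebraic_int (E x y z w - E (of_int m2) (of_int n2) (of_int 0) (of_int 0))"
    using algebraic_int_diff[OF assms(2) E_int_coords] .
  then have "algebraic_int (E 0 0 ((2 * z) / 2) ((2 * w) / 2))" unfolding ev_diff xy by simp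
  then obtain i2 j2 where "2 * z = of_int i2" "2 * w = of_int j2" "even i2" "even j2"
    by (rule beta_gamma_part_integers) (use b in blast)
  then obtain i3 j3 where "z = of_int i3" "w = of_int j3" by (auto elim!: evenE)
  then show thesis using that xy by blast
qed

theorem integers_b_odd:
  assumes "odd d" "odd b" "algebraic_int (E x y z w)"
  obtains m n i j where "x = of_int m / 2" "y = of_int n / 2" "even m \<longleftrightarrow> even n" "z = of_int i" "w = of_int j"
proof -
  obtain m n i j M N where co: "x = of_int m / 4" "y = of_int n / 4" "z = of_int i / 4" "w = of_int j / 4"
    and mn: "4 dvd m\<^sup>2 - d * n\<^sup>2" and ij: "even i \<longleftrightarrow> even j" "odd b \<Longrightarrow> even i"
    and R: "m\<^sup>2 + d * n\<^sup>2 - a * d * (i\<^sup>2 + j\<^sup>2) = 8 * M" and S: "2 * m * n + a * b * (i\<^sup>2 - j\<^sup>2) - 2 * (a * c) * i * j = 8 * N"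
    and MN: "4 dvd M\<^sup>2 - d * N\<^sup>2" using integer_coordinates[OF assms(3)] by blast
  have evij: "even i" "even j" using ij assms by simp_all
  obtain i' j' where h: "i = 2 * i'" "j = 2 * j'" using evij by (meson evenE)
  have "2 * (m * n) = 4 * (2 * N - a * b * (i'\<^sup>2 - j'\<^sup>2) + 2 * (a * c * i' * j'))"
    using S unfolding h by (simp add: power2_eq_square algebra_simps)
  then have "even (m * n)" by (rule int_dvd_arith(2))
  then have evmn: "even m" "even n" using K_parity(1)[OF mn assms(1)] by auto
  obtain m' n' where h': "m = 2 * m'" "n = 2 * n'" using evmn by (meson evenE)
  have R': "m'\<^sup>2 + d * n'\<^sup>2 - a * d * (i'\<^sup>2 + j'\<^sup>2) = 2 * M" using R unfolding h h' by (simp add: power2_eq_square algebra_simps)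
  have S': "2 * m' * n' + a * b * (i'\<^sup>2 - j'\<^sup>2) - 2 * (a * c) * i' * j' = 2 * N" using S unfolding h h' by (simp add: power2_eq_square algebra_simps)
  have "even (2 * m' * n' + a * b * (i'\<^sup>2 - j'\<^sup>2) - 2 * (a * c) * i' * j')" unfolding S' by simp
  then have "even (i'\<^sup>2 + j'\<^sup>2)" using odd_a assms(2) by simp
  moreover have "even (m'\<^sup>2 + d * n'\<^sup>2 - a * d * (i'\<^sup>2 + j'\<^sup>2))" unfolding R' by simp
  ultimately have par: "even m' \<longleftrightarrow> even n'" using assms(1) by simp
  have xy: "x = of_int m' / 2" "y = of_int n' / 2" using co unfolding h' by simp_all
  have "algebraic_int (E x y z w - E x y 0 0)"
    using algebraic_int_diff[OF assms(3) K_half_int[OF assms(1) par]] unfolding xy .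
  then have "algebraic_int (E 0 0 ((2 * z) / 2) ((2 * w) / 2))" unfolding ev_diff by simp
  then obtain i2 j2 where "2 * z = of_int i2" "2 * w = of_int j2" "even i2" "even j2"
    by (rule beta_gamma_part_integers) (use assms(2) in blast)
  then obtain i3 j3 where "z = of_int i3" "w = of_int j3" by (auto elim!: evenE)
  then show thesis using that xy par by blast
qed

text \<open>If the coordinates are odd quarters, the relative norm determines the product of all four modulo
  4, and its rational part forces \<open>a + b \<equiv> 1 (mod 4)\<close>. If they are even quarters and
  \<open>a + b \<equiv> 3 (mod 4)\<close>, comparing the two parts of the relative norm modulo 4 separates the first two
  coordinates from the last two.\<close>
theorem integers_b_even:
  assumes "even b" "odd d" "algebraic_int (E x y z w)"
  obtains m n i j where "x = of_int m / 4" "y = of_int n / 4" "z = of_int i / 4" "w = of_int j / 4"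
    "even m \<longleftrightarrow> even n" "even m \<longleftrightarrow> even i" "even i \<longleftrightarrow> even j" "4 dvd m + n + i + j"
    "(a + b) mod 4 = 3 \<Longrightarrow> even m \<and> 4 dvd m + n \<and> 4 dvd i + j"
proof -
  obtain m n i j M N where co: "x = of_int m / 4" "y = of_int n / 4" "z = of_int i / 4" "w = of_int j / 4"
    and mn4: "4 dvd m\<^sup>2 - d * n\<^sup>2" and ij: "even i \<longleftrightarrow> even j" "odd b \<Longrightarrow> even i"
    and R: "m\<^sup>2 + d * n\<^sup>2 - a * d * (i\<^sup>2 + j\<^sup>2) = 8 * M" and S: "2 * m * n + a * b * (i\<^sup>2 - j\<^sup>2) - 2 * (a * c) * i * j = 8 * N"
    and MN: "4 dvd M\<^sup>2 - d * N\<^sup>2" using integer_coordinates[OF assms(3)] by blast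
  have mn: "even m \<longleftrightarrow> even n" using K_parity(1)[OF mn4 assms(2)] .
  have MNp: "even M \<longleftrightarrow> even N" using K_parity(1)[OF MN assms(2)] .
  obtain b' where b': "b = 2 * b'" using assms(1) by (auto elim: evenE)
  have oc: "odd c" using assms d_eq by auto
  have "a * c = 4 * (a * c div 4) + 1" using ac_mod_4[OF oc] mult_div_mod_eq[of 4 "a * c"] by simp
  then obtain f where f: "a * c = 4 * f + 1" by blast
  have "d = 4 * (d div 4) + 1" using d_mod_4(1)[OF assms(2)] by presburger
  then obtain e where e: "d = 4 * e + 1" by blast
  show thesis
  proof (cases "even i")
    case False
    then have "odd i" "odd j" using ij by auto
    obtain k l where kl: "i\<^sup>2 = 8 * k + 1" "j\<^sup>2 = 8 * l + 1"
      using odd_square_mod_8 \<open>odd i\<close> \<open>odd j\<close> by metis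
    have "2 * (m * n - i * j) = 8 * (N - 2 * (a * b' * (k - l)) + f * i * j)"
      using S unfolding kl b' f by (simp add: algebra_simps)
    then have prod: "4 dvd m * n - i * j" by (rule int_dvd_arith(4))
    then have "even (m * n - i * j)" by (rule int_dvd_arith(3))
    then have "odd (m * n)" using \<open>odd i\<close> \<open>odd j\<close> by simp
    then have "odd m" "odd n" by simp_all
    have sum: "4 dvd m + n + i + j" using four_dvd_sum_of_odds[OF \<open>odd m\<close> \<open>odd n\<close> \<open>odd i\<close> \<open>odd j\<close> prod] .
    have "(a + b) mod 4 \<noteq> 3"
    proof
      assume ab: "(a + b) mod 4 = 3"
      obtain k' l' where kl': "m\<^sup>2 = 8 * k' + 1" "n\<^sup>2 = 8 * l' + 1"
        using odd_square_mod_8 \<open>odd m\<close> \<open>odd n\<close> by metis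
      have "1 + d - 2 * (a * d) = 8 * (M - k' - d * l' + a * d * (k + l))"
        using R unfolding kl kl' by (simp add: algebra_simps)
      then have D: "8 dvd 1 + d - 2 * (a * d)" by simp
      \<comment> \<open>\<open>d\<close> modulo 8 depends only on \<open>b\<close> modulo 4\<close>
      obtain g where g: "c\<^sup>2 = 8 * g + 1" using odd_square_mod_8[OF oc] .
      have dd: "d = 4 * b'\<^sup>2 + 8 * g + 1" unfolding d_eq b' g[symmetric] using g by (simp add: power2_eq_square)
      show False
      proof (cases "even b'")
        case True
        then obtain h where "b' = 2 * h" by (auto elim: evenE)
        then have d8: "d = 8 * (2 * h\<^sup>2 + g) + 1" using dd by (simp add: power2_eq_square)
        then have "1 + d - 2 * (a * d) = 2 - 2 * a + 8 * ((2 * h\<^sup>2 + g) * (1 - 2 * a))" by (simp add: algebra_simps)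
        then have "8 dvd 2 - 2 * a" using D by (rule int_dvd_arith(5))
        moreover have "(a + b) mod 4 = a mod 4" using b' \<open>b' = 2 * h\<close> by presburger
        ultimately show False using ab by presburger
      next
        case False
        obtain h where h: "b'\<^sup>2 = 8 * h + 1" using odd_square_mod_8[OF False] .
        then have d8: "d = 8 * (4 * h + g) + 5" using dd by simp
        then have "1 + d - 2 * (a * d) = 6 - 10 * a + 8 * ((4 * h + g) * (1 - 2 * a))" by (simp add: algebra_simps)
        then have "8 dvd 6 - 10 * a" using D by (rule int_dvd_arith(5))
        moreover have "b mod 4 = 2" using b' False by presburger
        ultimately show False using ab by presburger
      qed
    qed
    then show thesis using that[OF co mn _ ij(1) sum] \<open>odd i\<close> \<open>odd m\<close> by blast
  next
    case True
    then obtain i' j' where h: "i = 2 * i'" "j = 2 * j'" using ij(1) by (meson evenE)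
    have "2 * (m * n) = 8 * (N - a * b' * (i'\<^sup>2 - j'\<^sup>2) + a * c * i' * j')"
      using S unfolding h b' by (simp add: power2_eq_square algebra_simps)
    then have "even (m * n)" by (intro int_dvd_arith(3)) (rule int_dvd_arith(4))
    then have evmn: "even m" "even n" using mn by auto
    obtain m' n' where h': "m = 2 * m'" "n = 2 * n'" using evmn by (meson evenE)
    have R': "m'\<^sup>2 + d * n'\<^sup>2 - a * d * (i'\<^sup>2 + j'\<^sup>2) = 2 * M" using R unfolding h h' by (simp add: power2_eq_square algebra_simps)
    have S': "2 * m' * n' + a * b * (i'\<^sup>2 - j'\<^sup>2) - 2 * (a * c) * i' * j' = 2 * N" using S unfolding h h' by (simp add: power2_eq_square algebra_simps)
    have "even (m'\<^sup>2 + d * n'\<^sup>2 - a * d * (i'\<^sup>2 + j'\<^sup>2))" unfolding R' by simp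
    then have par: "even (m' + n' + i' + j')" using assms(2) odd_a by (cases "even i'"; cases "even j'") simp_all
    then obtain q where "m' + n' + i' + j' = 2 * q" by (rule evenE)
    then have "m + n + i + j = 4 * q" unfolding h h' by simp
    then have sum: "4 dvd m + n + i + j" by simp
    have dvd4: "4 dvd 2 * u + 2 * v \<longleftrightarrow> even (u + v)" for u v :: int by presburger
    have "4 dvd m + n \<and> 4 dvd i + j" if ab: "(a + b) mod 4 = 3"
    proof (rule ccontr)
      assume no: "\<not> (4 dvd m + n \<and> 4 dvd i + j)"
      have odd1: "odd (m' + n')" and odd2: "odd (i' + j')"
        using no par unfolding h h' dvd4 by auto
      have sq: "\<exists>k. u\<^sup>2 + v\<^sup>2 = 4 * k + 1 \<and> (\<exists>l. u * v = 2 * l) \<and> (\<exists>q. u\<^sup>2 - v\<^sup>2 = 2 * q + 1)" if "odd (u + v)" for u v :: int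
      proof (cases "even u")
        case True
        then have "odd v" using that by simp
        obtain u' where "u = 2 * u'" using True by (auto elim: evenE)
        moreover obtain k where "v\<^sup>2 = 8 * k + 1" using odd_square_mod_8[OF \<open>odd v\<close>] .
        ultimately have "u\<^sup>2 + v\<^sup>2 = 4 * (u'\<^sup>2 + 2 * k) + 1" "u * v = 2 * (u' * v)" "u\<^sup>2 - v\<^sup>2 = 2 * (2 * u'\<^sup>2 - 4 * k - 1) + 1"
          by (simp_all add: power2_eq_square)
        then show ?thesis by blast
      next
        case False
        then have "even v" using that by simp
        obtain v' where "v = 2 * v'" using \<open>even v\<close> by (auto elim: evenE)
        moreover obtain k where "u\<^sup>2 = 8 * k + 1" using odd_square_mod_8[OF False] .
        ultimately have "u\<^sup>2 + v\<^sup>2 = 4 * (v'\<^sup>2 + 2 * k) + 1" "u * v = 2 * (u * v')" "u\<^sup>2 - v\<^sup>2 = 2 * (4 * k - 2 * v'\<^sup>2) + 1"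
          by (simp_all add: power2_eq_square)
        then show ?thesis by blast
      qed
      obtain k1 l1 where 1: "m'\<^sup>2 + n'\<^sup>2 = 4 * k1 + 1" "m' * n' = 2 * l1" using sq[OF odd1] by blast
      obtain k2 l2 q where 2: "i'\<^sup>2 + j'\<^sup>2 = 4 * k2 + 1" "i' * j' = 2 * l2" "i'\<^sup>2 - j'\<^sup>2 = 2 * q + 1" using sq[OF odd2] by blast
      have "2 * M = (m'\<^sup>2 + n'\<^sup>2) + 4 * (e * n'\<^sup>2) - a * (4 * e + 1) * (i'\<^sup>2 + j'\<^sup>2)" using R' unfolding e by (simp add: algebra_simps)
      then have M: "2 * M = 1 - a + 4 * (k1 + e * n'\<^sup>2 - a * e * (4 * k2 + 1) - a * k2)" unfolding 1 2 by (simp add: algebra_simps)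
      have "2 * N = 2 * (m' * n') + a * (2 * b') * (i'\<^sup>2 - j'\<^sup>2) - 2 * (a * c) * (i' * j')" using S' unfolding b' by (simp add: algebra_simps)
      then have N: "2 * N = 2 * (a * b') + 4 * (l1 + a * b' * q - a * c * l2)" unfolding 1 2 by (simp add: algebra_simps)
      have "even (M - N)" using MNp by simp
      then have "4 dvd 2 * M - 2 * N" by presburger
      then have "4 dvd 1 - a - 2 * (a * b')" unfolding M N by (rule int_dvd_arith(6))
      moreover obtain a' where "a = 2 * a' + 1" using odd_a by (auto elim: oddE)
      then have "2 * (a * b') = 2 * b' + 4 * (a' * b')" by (simp add: algebra_simps)
      ultimately have "4 dvd 1 - a - b" unfolding b' using int_dvd_arith(7) by blast
      then show False using ab by presburger
    qed
    then show thesis using that[OF co mn _ ij(1) sum] True evmn by blast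
  qed
qed

lemma half_beta_gamma_int:
  assumes "even b" "odd d"
  shows "algebraic_int (E 0 0 (1/2) (1/2))"
proof (rule algebraic_int_of_square)
  have "odd c" using assms d_eq by auto
  then have "algebraic_int (E (of_int (a * d) / 2) (of_int (a * c) / 2) 0 0)"
    using assms odd_a by (intro K_half_int) auto
  also have "E (of_int (a * d) / 2) (of_int (a * c) / 2) 0 0 = (E 0 0 (1/2) (1/2))\<^sup>2"
    unfolding power2_eq_square[of "E 0 0 (1/2) (1/2)"] E_mult mul_defs by (simp add: field_simps)
  finally show "algebraic_int ((E 0 0 (1/2) (1/2))\<^sup>2)" .
qed

text \<open>This congruence is the integrality of the relative norm of \<open>(1 + s + \<beta> + \<gamma>) / 4\<close>. The explicit quotients
  come from writing \<open>b\<close> as \<open>4 q\<close> or \<open>4 q + 2\<close> and \<open>a\<close>, \<open>c\<close> accordingly modulo 4.\<close>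
lemma quarter_arith:
  assumes "even b" "odd d" "(a + b) mod 4 = 1"
  shows "16 dvd 1 - d + 2 * a * d - 2 * a * c"
proof -
  have oc: "odd c" using assms d_eq by auto
  have ac: "a * c mod 4 = 1" using ac_mod_4[OF oc] .
  have c_mod: "c mod 4 = a mod 4"
  proof -
    have "(a mod 4) * (c mod 4) mod 4 = 1" using ac by (simp add: mod_mult_eq)
    then show ?thesis using mod_4_cases_odd[OF odd_a] mod_4_cases_odd[OF oc] by auto
  qed
  have "b mod 4 = 0 \<or> b mod 4 = 2" using assms(1) by presburger
  then consider "b mod 4 = 0" | "b mod 4 = 2" by blast
  then show ?thesis
  proof cases
    case 1
    then have "a mod 4 = 1" using assms(3) by presburger
    then have "c mod 4 = 1" using c_mod by simp
    obtain q k l where e: "b = 4 * q" "a = 4 * k + 1" "c = 4 * l + 1"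
      using 1 \<open>a mod 4 = 1\<close> \<open>c mod 4 = 1\<close> by (metis mult_div_mod_eq add_0_right)
    have "1 - d + 2 * a * d - 2 * a * c = 16 * (q\<^sup>2 + l\<^sup>2 + 8 * k * (q\<^sup>2 + l\<^sup>2) + 2 * k * l)"
      unfolding d_eq e by (simp add: algebra_simps power2_eq_square)
    then show ?thesis by (simp only: dvd_triv_left)
  next
    case 2
    then have "a mod 4 = 3" using assms(3) by presburger
    then have "c mod 4 = 3" using c_mod by simp
    obtain q k l where e: "b = 4 * q + 2" "a = 4 * k + 3" "c = 4 * l + 3"
      using 2 \<open>a mod 4 = 3\<close> \<open>c mod 4 = 3\<close> by (metis mult_div_mod_eq)
    have "1 - d + 2 * a * d - 2 * a * c = 16 * (3 + 5 * (q\<^sup>2 + q + l\<^sup>2) + 6 * l + 5 * k + 8 * k * (q\<^sup>2 + q + l\<^sup>2) + 10 * k * l)"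
      unfolding d_eq e by (simp add: algebra_simps power2_eq_square)
    then show ?thesis by (simp only: dvd_triv_left)
  qed
qed

text \<open>Over \<open>\<int>[\<omega>]\<close> the number \<open>\<alpha> = (1 + s + \<beta> + \<gamma>) / 4\<close> satisfies \<open>\<alpha>\<^sup>2 = \<omega> \<alpha> + g + f \<omega>\<close> with integers \<open>f\<close>, \<open>g\<close>, so the
  module generated by \<open>1, \<omega>, \<alpha>, \<omega> \<alpha>\<close> is stable under \<open>\<alpha>\<close>.\<close>
lemma quarter_int:
  assumes "even b" "odd d" "(a + b) mod 4 = 1"
  shows "algebraic_int (E (1/4) (1/4) (1/4) (1/4))"
proof -
  define \<omega> \<alpha> where "\<omega> = E (1/2) (1/2) 0 0" "\<alpha> = E (1/4) (1/4) (1/4) (1/4)"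
  note defs = this
  have oc: "odd c" using assms d_eq by auto
  have "d = 4 * (d div 4) + 1" using d_mod_4(1)[OF assms(2)] by presburger
  then obtain e where e: "d = 4 * e + 1" by blast
  have "a * c = 4 * (a * c div 4) + 1" using ac_mod_4[OF oc] mult_div_mod_eq[of 4 "a * c"] by simp
  then obtain f where f: "a * c = 4 * f + 1" by blast
  obtain g where g: "1 - d + 2 * a * d - 2 * a * c = 16 * g" using quarter_arith[OF assms] by (auto elim: dvdE)
  have ad: "2 * (a * d) = 16 * g + d + 1 + 8 * f" using g f by (simp add: algebra_simps)
  have e': "(of_int d :: rat) = 4 * of_int e + 1" by (simp add: e)
  have w2: "\<omega> * \<omega> = \<omega> + of_int e"
    unfolding defs E_of_int[of e] E_mult ev_add by (rule E_cong) (simp_all add: mul_defs e')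
  have "of_int (2 * (a * d)) = (of_int (16 * g + d + 1 + 8 * f) :: rat)" unfolding ad ..
  then have adr: "2 * of_int (a * d) = (16 * of_int g + of_int d + 1 + 8 * of_int f :: rat)"
    by (simp only: of_int_mult[of 2] of_int_add of_int_numeral of_int_1 of_int_mult[of 16] of_int_mult[of 8])
  have "of_int (a * c) = (of_int (4 * f + 1) :: rat)" unfolding f ..
  then have acr: "of_int (a * c) = (4 * of_int f + 1 :: rat)"
    by (simp only: of_int_mult[of 4] of_int_add of_int_numeral of_int_1)
  have a2: "\<alpha> * \<alpha> = \<omega> * \<alpha> + of_int g + of_int f * \<omega>"
    unfolding defs E_of_int[of g] E_int_scale E_mult ev_add
    by (rule E_cong; unfold mul_defs; rule quarter_square_coords[OF adr acr])
  define S where "S = {1, \<omega>, \<alpha>, \<omega> * \<alpha>}"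
  have fin: "finite S" unfolding S_def by simp
  have nz: "\<exists>s\<in>S. s \<noteq> 0" unfolding S_def by simp
  have b: "1 \<in> int_span S" "\<omega> \<in> int_span S" "\<alpha> \<in> int_span S" "\<omega> * \<alpha> \<in> int_span S"
    by (rule int_span_base[OF fin]; simp add: S_def)+
  have bi: "of_int k \<in> int_span S" for k using int_span_scale[OF b(1), of k] by simp
  have "\<alpha> * \<alpha> \<in> int_span S" unfolding a2 by (intro int_span_add int_span_scale b bi)
  moreover have "\<alpha> * (\<omega> * \<alpha>) = \<omega> * (\<alpha> * \<alpha>)" by simp
  then have "\<alpha> * (\<omega> * \<alpha>) = (\<omega> * \<omega>) * \<alpha> + of_int g * \<omega> + of_int f * (\<omega> * \<omega>)" unfolding a2 by (simp add: algebra_simps)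
  then have "\<alpha> * (\<omega> * \<alpha>) = \<omega> * \<alpha> + of_int e * \<alpha> + of_int g * \<omega> + (of_int f * \<omega> + of_int (f * e))" unfolding w2 by (simp add: algebra_simps)
  then have "\<alpha> * (\<omega> * \<alpha>) \<in> int_span S" by (simp only:) (intro int_span_add int_span_scale b bi)
  moreover have "\<alpha> * 1 \<in> int_span S" "\<alpha> * \<omega> \<in> int_span S" using b by (simp_all add: mult.commute)
  ultimately have "algebraic_int \<alpha>" by (intro algebraic_int_if_int_span_invariant[OF fin nz]) (auto simp: S_def)
  then show ?thesis unfolding defs .
qed

text \<open>Such an element is an integer combination of \<open>1\<close>, \<open>\<omega>\<close>, \<open>\<alpha>\<close> and the conjugate
  \<open>(1 - s + \<beta> - \<gamma>) / 4\<close> of \<open>\<alpha>\<close>.\<close>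
theorem integers_quarter:
  assumes "even b" "odd d" "(a + b) mod 4 = 1"
    and par: "even m \<longleftrightarrow> even n" "even m \<longleftrightarrow> even i" "even i \<longleftrightarrow> even j" "4 dvd m + n + i + j"
  shows "algebraic_int (E (of_int m / 4) (of_int n / 4) (of_int i / 4) (of_int j / 4))"
proof -
  have al: "algebraic_int (E (1/4) (1/4) (1/4) (1/4))" using quarter_int[OF assms(1-3)] .
  have al': "algebraic_int (E (1/4) (- 1/4) (1/4) (- 1/4))"
    using algebraic_int_conj2[OF algebraic_int_conj[OF al]] by simp
  have "even (i + j)" "even (i - j)" "even (n - j)" using par by auto
  moreover have "4 dvd m - n + j - i"
  proof -
    have "even (n + i)" using par by auto
    then have "4 dvd 2 * (n + i)" by presburger
    then have "4 dvd (m + n + i + j) - 2 * (n + i)" using par(4) by (rule dvd_diff[rotated])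
    then show ?thesis by (simp add: algebra_simps)
  qed
  ultimately obtain n1 n2 n3 n4 where k: "i + j = 2 * n3" "i - j = 2 * n4" "n - j = 2 * n2" "m - n + j - i = 4 * n1"
    by (meson dvdE)
  have e: "m = 4 * n1 + 2 * n2 + n3 + n4" "n = 2 * n2 + n3 - n4" "i = n3 + n4" "j = n3 - n4" using k by linarith+
  have "E (of_int m / 4) (of_int n / 4) (of_int i / 4) (of_int j / 4) =
    of_int n1 + of_int n2 * E (1/2) (1/2) 0 0 + of_int n3 * E (1/4) (1/4) (1/4) (1/4) + of_int n4 * E (1/4) (- 1/4) (1/4) (- 1/4)"
    unfolding e E_of_int[of n1] E_int_scale ev_add by (rule E_cong) (simp_all add: add_divide_distrib diff_divide_distrib)
  then show ?thesis
    by (simp only:) (intro algebraic_int_add algebraic_int_mult algebraic_int_of_int omega_int assms(2) al al')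
qed

end

section \<open>Prime ideals above a rational prime\<close>

context cyclic_quartic begin

abbreviation "\<O> \<equiv> {t \<in> F. algebraic_int t}"

lemma E_in_O_iff: "E x y z w \<in> \<O> \<longleftrightarrow> algebraic_int (E x y z w)" using E_in_F by simp

lemma integer_cases:
  assumes "t \<in> \<O>"
  obtains x y z w where "t = E x y z w" "algebraic_int (E x y z w)"
proof -
  have "t \<in> F" "algebraic_int t" using assms by simp_all
  then obtain x y z w where "t = E x y z w" using F_eq by blast
  then show thesis using that \<open>algebraic_int t\<close> by blast
qed

lemma of_int_in_O: "of_int k \<in> \<O>" using of_rat_in_F[of "of_int k"] by simp

lemma integers_closed:
  "t \<in> \<O> \<Longrightarrow> t' \<in> \<O> \<Longrightarrow> t + t' \<in> \<O>" "t \<in> \<O> \<Longrightarrow> t' \<in> \<O> \<Longrightarrow> t * t' \<in> \<O>" "t \<in> \<O> \<Longrightarrow> - t \<in> \<O>"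
  using F_closed(3,5,6) algebraic_int_add algebraic_int_mult by auto

lemma carrier_ring_of_integers: "carrier (ring_of_integers F) = \<O>"
  by (simp add: ring_of_integers_def)

lemma ring_of_integers_simps:
  "x \<otimes>\<^bsub>ring_of_integers F\<^esub> y = x * y" "x \<oplus>\<^bsub>ring_of_integers F\<^esub> y = x + y"
  "\<one>\<^bsub>ring_of_integers F\<^esub> = 1" "\<zero>\<^bsub>ring_of_integers F\<^esub> = 0"
  using complex_ring_simps by (simp_all add: ring_of_integers_def)

lemma cring_ring_of_integers: "cring (ring_of_integers F)"
proof -
  have "subring \<O> complex_ring"
  proof (rule ring.subringI[OF ring_from_type_algebra])
    show "\<one>\<^bsub>complex_ring\<^esub> \<in> \<O>" using of_int_in_O[of 1] by simp
  qed (use integers_closed in \<open>simp_all add: complex_ring_a_inv\<close>)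
  then have "subcring \<O> complex_ring"
    by (rule ring.subcringI[OF ring_from_type_algebra]) simp
  then show ?thesis
    using ring.subcring_iff[OF ring_from_type_algebra, of \<O>] by (simp add: ring_of_integers_def)
qed

text \<open>In terms of the operations on complex numbers; closure under negation is multiplication by \<open>- 1\<close>.\<close>
lemma prime_above_iff:
  "prime_above F p P \<longleftrightarrow> P \<subseteq> \<O> \<and> 0 \<in> P \<and> (\<forall>x\<in>P. \<forall>y\<in>P. x + y \<in> P) \<and> (\<forall>x\<in>\<O>. \<forall>y\<in>P. x * y \<in> P)
    \<and> 1 \<notin> P \<and> (\<forall>x\<in>\<O>. \<forall>y\<in>\<O>. x * y \<in> P \<longrightarrow> x \<in> P \<or> y \<in> P) \<and> of_nat p \<in> P" (is "_ \<longleftrightarrow> ?R")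
proof
  assume "prime_above F p P"
  then have P: "primeideal P (ring_of_integers F)" and p: "of_nat p \<in> P" unfolding prime_above_def by auto
  interpret P: primeideal P "ring_of_integers F" by (rule P)
  have "1 \<notin> P"
  proof
    assume "1 \<in> P"
    then have "P = carrier (ring_of_integers F)" using P.one_imp_carrier ring_of_integers_simps by simp
    then show False using P.I_notcarr by simp
  qed
  moreover have "P \<subseteq> \<O>" using P.a_subset unfolding carrier_ring_of_integers .
  moreover have "0 \<in> P" 
    using additive_subgroup.zero_closed[OF ideal.axioms(1)[OF primeideal.axioms(1)[OF P]]] unfolding ring_of_integers_simps .
  moreover have "\<And>x y. x \<in> P \<Longrightarrow> y \<in> P \<Longrightarrow> x + y \<in> P" 
    using additive_subgroup.a_closed[OF ideal.axioms(1)[OF primeideal.axioms(1)[OF P]]] unfolding ring_of_integers_simps .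
  moreover have "\<And>x y. x \<in> \<O> \<Longrightarrow> y \<in> P \<Longrightarrow> x * y \<in> P"
    using P.I_l_closed unfolding ring_of_integers_simps carrier_ring_of_integers .
  moreover have "\<And>x y. x \<in> \<O> \<Longrightarrow> y \<in> \<O> \<Longrightarrow> x * y \<in> P \<Longrightarrow> x \<in> P \<or> y \<in> P"
    using P.I_prime unfolding ring_of_integers_simps carrier_ring_of_integers .
  ultimately show ?R using p by (intro conjI ballI impI) simp_all
next
  assume R: ?R
  have sub: "P \<subseteq> \<O>" and zero: "0 \<in> P" and add: "\<And>x y. x \<in> P \<Longrightarrow> y \<in> P \<Longrightarrow> x + y \<in> P"
    and mul: "\<And>x y. x \<in> \<O> \<Longrightarrow> y \<in> P \<Longrightarrow> x * y \<in> P" and one: "1 \<notin> P" and p: "of_nat p \<in> P"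
    and prm: "\<And>x y. x \<in> \<O> \<Longrightarrow> y \<in> \<O> \<Longrightarrow> x * y \<in> P \<Longrightarrow> x \<in> P \<or> y \<in> P"
    using R by (elim conjE, simp)+
  have "subgroup P (add_monoid (ring_of_integers F))"
  proof (rule subgroup.intro)
    fix x assume x: "x \<in> P"
    then have "- x \<in> P" using mul[OF of_int_in_O[of "- 1"] x] by simp
    have "\<ominus>\<^bsub>ring_of_integers F\<^esub> x = - x"
      using abelian_group.minus_equality[OF ring.is_abelian_group[OF cring.axioms(1)[OF cring_ring_of_integers]], of "- x" x]
        subsetD[OF sub x] subsetD[OF sub \<open>- x \<in> P\<close>] unfolding ring_of_integers_simps carrier_ring_of_integers by simp
    then show "inv\<^bsub>add_monoid (ring_of_integers F)\<^esub> x \<in> P" using \<open>- x \<in> P\<close> unfolding a_inv_def by simp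
  qed (use sub zero add in \<open>simp_all add: ring_of_integers_simps carrier_ring_of_integers\<close>)
  then have "ideal P (ring_of_integers F)"
  proof (rule idealI[OF cring.axioms(1)[OF cring_ring_of_integers]])
    fix x y assume "x \<in> P" "y \<in> carrier (ring_of_integers F)"
    then have "y * x \<in> P" using mul unfolding carrier_ring_of_integers by blast
    then show "y \<otimes>\<^bsub>ring_of_integers F\<^esub> x \<in> P" "x \<otimes>\<^bsub>ring_of_integers F\<^esub> y \<in> P"
      unfolding ring_of_integers_simps by (simp_all only: mult.commute)
  qed
  then have "primeideal P (ring_of_integers F)"
  proof (rule primeidealI[OF _ cring_ring_of_integers])
    show "carrier (ring_of_integers F) \<noteq> P" unfolding carrier_ring_of_integers using one of_int_in_O[of 1] by auto
  qed (use prm in \<open>simp_all add: ring_of_integers_simps carrier_ring_of_integers\<close>)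
  then show "prime_above F p P" using p unfolding prime_above_def by blast
qed

lemma prime_aboveD:
  assumes "prime_above F p P"
  shows "P \<subseteq> \<O>" "x \<in> P \<Longrightarrow> y \<in> P \<Longrightarrow> x + y \<in> P" "x \<in> \<O> \<Longrightarrow> y \<in> P \<Longrightarrow> x * y \<in> P"
    "1 \<notin> P" "x \<in> \<O> \<Longrightarrow> y \<in> \<O> \<Longrightarrow> x * y \<in> P \<Longrightarrow> x \<in> P \<or> y \<in> P" "of_nat p \<in> P"
    "x \<in> P \<Longrightarrow> - x \<in> P" "x \<in> P \<Longrightarrow> y \<in> P \<Longrightarrow> x - y \<in> P"
proof -
  note R = assms[unfolded prime_above_iff]
  show "P \<subseteq> \<O>" "1 \<notin> P" "of_nat p \<in> P" using R by (elim conjE, simp)+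
  show add: "x \<in> P \<Longrightarrow> y \<in> P \<Longrightarrow> x + y \<in> P" for x y using R by (elim conjE) simp
  show mul: "x \<in> \<O> \<Longrightarrow> y \<in> P \<Longrightarrow> x * y \<in> P" for x y using R by (elim conjE) simp
  show "x \<in> \<O> \<Longrightarrow> y \<in> \<O> \<Longrightarrow> x * y \<in> P \<Longrightarrow> x \<in> P \<or> y \<in> P" using R by (elim conjE) simp
  show m: "- x \<in> P" if "x \<in> P" for x using mul[OF of_int_in_O[of "- 1"] that] by simp
  show "x \<in> P \<Longrightarrow> y \<in> P \<Longrightarrow> x - y \<in> P" using add[of x "- y"] m[of y] by simp
qed

lemma int_in_prime_above:
  assumes "prime p" "prime_above F p P"
  shows "of_int k \<in> P \<longleftrightarrow> int p dvd k"
proof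
  note P = prime_aboveD[OF assms(2)]
  assume k: "of_int k \<in> P"
  show "int p dvd k"
  proof (rule ccontr)
    assume "\<not> int p dvd k"
    then have "coprime (int p) k" using assms(1) by (simp add: prime_imp_coprime)
    then obtain u v where "u * int p + v * k = 1"
      using bezout_int[of "int p" k] by (metis coprime_imp_gcd_eq_1)
    then have "(1 :: complex) = of_int (u * int p + v * k)" by simp
    also have "\<dots> = of_int u * of_nat p + of_int v * of_int k" by simp
    also have "\<dots> \<in> P" by (intro P(2,3) P(6) of_int_in_O k)
    finally show False using P(4) by blast
  qed
next
  note P = prime_aboveD[OF assms(2)]
  assume "int p dvd k"
  then obtain l where "k = int p * l" by (auto elim: dvdE)
  then have "of_int k = of_int l * (of_nat p :: complex)" by simp
  then show "of_int k \<in> P" using P(3)[OF of_int_in_O P(6)] by simp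
qed

text \<open>The absolute norm of \<open>F\<close>.\<close>
definition norm4 :: "'r::comm_ring_1 \<Rightarrow> 'r \<Rightarrow> 'r \<Rightarrow> 'r \<Rightarrow> 'r"
  where "norm4 x y z w = (normA x y z w)\<^sup>2 - of_int d * (normB x y z w)\<^sup>2"

lemma of_int_norm4: "of_int (norm4 x y z w) = norm4 (of_int x) (of_int y) (of_int z) (of_int w)"
  unfolding norm4_def normA_def normB_def by simp

lemma emb_product_eq_norm:
  "emb0 (E x y z w) * emb2 (E x y z w)
    * (emb1 (E x y z w) * emb3 (E x y z w)) = of_rat (norm4 x y z w)"
proof -
  have flip: "ev s (- u) (- v) x y z w = ev s u v x y (- z) (- w)" for s u v
    by (simp add: ev_def of_rat_minus)
  have m: "ev (- rtd) u v x y 0 0 = E x (- y) 0 0" for u v x y by (simp add: ev_def of_rat_minus)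
  have "ev rtd \<beta> \<gamma> x y z w * ev rtd (- \<beta>) (- \<gamma>) x y z w = E (normA x y z w) (normB x y z w) 0 0"
    unfolding flip ev_norm_K[OF mult_table_E] ..
  moreover have "ev (- rtd) \<gamma> (- \<beta>) x y z w * ev (- rtd) (- \<gamma>) \<beta> x y z w = E (normA x y z w) (- normB x y z w) 0 0"
    using flip[of "- rtd" \<gamma> "- \<beta>"] ev_norm_K[OF tables(2), of x y z w] m by simp
  ultimately show ?thesis unfolding emb_E norm4_def using ev_norm_Q[OF mult_table_E] by simp
qed

lemma norm4_mult:
  assumes "E x y z w * E x' y' z' w' = E x'' y'' z'' w''"
  shows "norm4 x'' y'' z'' w'' = norm4 x y z w * (norm4 x' y' z' w' :: rat)"
proof -
  have "(of_rat (norm4 x'' y'' z'' w'') :: complex) = of_rat (norm4 x y z w) * of_rat (norm4 x' y' z' w')"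
    unfolding emb_product_eq_norm[symmetric] assms[symmetric]
      emb_mult[OF tables(1) E_in_F E_in_F] emb_mult[OF tables(2) E_in_F E_in_F]
      emb_mult[OF tables(3) E_in_F E_in_F] emb_mult[OF tables(4) E_in_F E_in_F]
    by (simp only: ac_simps)
  then show ?thesis by (simp add: of_rat_mult[symmetric] del: of_rat_mult)
qed

lemma norm4_scale: "norm4 (k * x) (k * y) (k * z) (k * w) = k ^ 4 * norm4 x y z w"
  unfolding norm4_def normA_def normB_def by (simp add: algebra_simps power2_eq_square power4_eq_xxxx)

text \<open>Integer coordinates over a common denominator \<open>m\<close>.\<close>
definition Em :: "int \<Rightarrow> int \<Rightarrow> int \<Rightarrow> int \<Rightarrow> int \<Rightarrow> complex"
  where "Em m i j k l = E (of_int i / of_int m) (of_int j / of_int m) (of_int k / of_int m) (of_int l / of_int m)"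

lemma Em_scale: "m \<noteq> 0 \<Longrightarrow> of_int m * Em m i j k l = of_int i + of_int j * rtd + of_int k * \<beta> + of_int l * \<gamma>"
  unfolding Em_def E_int_scale by (simp add: ev_def)

lemma Em_norm_mult:
  assumes "m \<noteq> 0" "Em m i j k l * Em m i' j' k' l' = Em m i'' j'' k'' l''"
  shows "m ^ 4 * norm4 i'' j'' k'' l'' = norm4 i j k l * norm4 i' j' k' l'"
proof -
  have s: "norm4 (of_int i / of_int m) (of_int j / of_int m) (of_int k / of_int m) (of_int l / of_int m)
     = (of_int (norm4 i j k l) / of_int m ^ 4 :: rat)" for i j k l
  proof -
    have e: "of_int i / of_int m = (1 / of_int m) * (of_int i :: rat)" for i by simp
    show ?thesis unfolding e norm4_scale of_int_norm4 by (simp add: power_one_over)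
  qed
  have cancel: "M * x = y * z" if "x / M = (y / M) * (z / M)" "M \<noteq> 0" for x y z M :: rat
    using that by (simp add: field_simps)
  have "of_int (norm4 i'' j'' k'' l'') / of_int m ^ 4 =
     (of_int (norm4 i j k l) / of_int m ^ 4) * (of_int (norm4 i' j' k' l') / of_int m ^ 4 :: rat)"
    using norm4_mult[OF assms(2)[unfolded Em_def]] unfolding s .
  then have "of_int (m ^ 4 * norm4 i'' j'' k'' l'') = (of_int (norm4 i j k l * norm4 i' j' k' l') :: rat)"
    unfolding of_int_mult of_int_power by (rule cancel) (use assms(1) in simp)
  then show ?thesis by (simp only: of_int_eq_iff)
qed

lemma Em_add: "Em m i j k l + Em m i' j' k' l' = Em m (i + i') (j + j') (k + k') (l + l')"
  unfolding Em_def ev_add by (simp add: add_divide_distrib)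

lemma Em_inject:
  assumes "m \<noteq> 0" "Em m i j k l = Em m i' j' k' l'"
  shows "i = i' \<and> j = j' \<and> k = k' \<and> l = l'"
  using E_inject[OF assms(2)[unfolded Em_def]] assms(1) by simp

text \<open>The norm of \<open>m t\<close> is a multiple of \<open>m t\<close> in the ring of integers, because the other conjugates are
  integers; so it lies in \<open>P\<close>, which meets the integers in the multiples of \<open>p\<close>.\<close>
lemma norm_in_prime_above:
  assumes p: "prime p" and P: "prime_above F p P" and m: "m \<noteq> 0" and t: "Em m i j k l \<in> P"
  shows "int p dvd norm4 i j k l"
proof -
  note PD = prime_aboveD[OF P]
  have in_O: "E (of_int i) (of_int j) (of_int k) (of_int l) \<in> \<O>" for i j k l
    unfolding E_in_O_iff by (rule E_int_coords)
  have "of_int m * Em m i j k l \<in> P" using PD(3)[OF of_int_in_O t] .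
  also have "of_int m * Em m i j k l = E (of_int i) (of_int j) (of_int k) (of_int l)"
    unfolding Em_scale[OF m] by (simp add: ev_def)
  finally have "E (of_int i) (of_int j) (of_int (- k)) (of_int (- l)) * E (of_int (normA i j k l)) (of_int (- normB i j k l)) (of_int 0) (of_int 0)
      * E (of_int i) (of_int j) (of_int k) (of_int l) \<in> P"
    by (intro PD(3) integers_closed(2) in_O)
  also have "E (of_int i) (of_int j) (of_int (- k)) (of_int (- l)) * E (of_int (normA i j k l)) (of_int (- normB i j k l)) (of_int 0) (of_int 0)
      * E (of_int i) (of_int j) (of_int k) (of_int l) = of_rat (norm4 (of_int i) (of_int j) (of_int k) (of_int l))"
    using ev_norm[OF mult_table_E, of "of_int i" "of_int j" "of_int k" "of_int l"]
    by (simp add: norm4_def normA_def normB_def mult.commute)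
  also have "\<dots> = of_int (norm4 i j k l)" unfolding of_int_norm4[symmetric] by simp
  finally show ?thesis using int_in_prime_above[OF p P] by blast
qed

text \<open>A denominator prime to \<open>p\<close> allows computing modulo \<open>p\<close> with the coordinates: 4 if \<open>p\<close> is odd, 1 if \<open>d\<close>
  is even.\<close>
definition denominator :: "int \<Rightarrow> nat \<Rightarrow> bool"
  where "denominator m p \<longleftrightarrow> m \<noteq> 0 \<and> coprime (int p) m \<and> (\<forall>t\<in>\<O>. \<exists>i j k l. t = Em m i j k l)"

lemma denominator_4: "prime p \<Longrightarrow> p \<noteq> 2 \<Longrightarrow> denominator 4 p"
proof -
  assume p: "prime p" "p \<noteq> 2"
  have "coprime p 2" using primes_coprime[OF p(1) two_is_prime_nat p(2)] .
  then have "coprime p (2 ^ 2)" by (simp only: coprime_power_right_iff)  simp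
  then have "coprime (int p) (int (2 ^ 2))" unfolding coprime_int_iff .
  then have "coprime (int p) 4" by (simp only: of_nat_power of_nat_numeral) simp
  moreover have "\<exists>i j k l. t = Em 4 i j k l" if tO: "t \<in> \<O>" for t
  proof -
    obtain x y z w where t: "t = E x y z w" "algebraic_int (E x y z w)" using integer_cases[OF tO] .
    obtain i j k l where co: "x = of_int i / 4" "y = of_int j / 4" "z = of_int k / 4" "w = of_int l / 4"
      by (rule integer_coordinates[OF t(2)]) blast
    have "t = Em 4 i j k l" unfolding t(1) co Em_def by simp
    then show ?thesis by blast
  qed
  ultimately show ?thesis unfolding denominator_def by simp
qed

lemma denominator_1: "even d \<Longrightarrow> denominator 1 p"
proof -
  assume d: "even d"
  have "\<exists>i j k l. t = Em 1 i j k l" if tO: "t \<in> \<O>" for t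
  proof -
    obtain x y z w where t: "t = E x y z w" "algebraic_int (E x y z w)" using integer_cases[OF tO] .
    obtain i j k l where "x = of_int i" "y = of_int j" "z = of_int k" "w = of_int l"
      by (rule integers_d_even[OF d t(2)])
    then have "t = Em 1 i j k l" unfolding t Em_def by simp
    then show ?thesis by blast
  qed
  then show ?thesis unfolding denominator_def by simp
qed

definition norm_ideal :: "int \<Rightarrow> nat \<Rightarrow> complex set"
  where "norm_ideal m p = {t \<in> \<O>. \<exists>i j k l. t = Em m i j k l \<and> int p dvd norm4 i j k l}"

lemma Em_in_norm_ideal:
  assumes "m \<noteq> 0"
  shows "Em m i j k l \<in> norm_ideal m p \<longleftrightarrow> Em m i j k l \<in> \<O> \<and> int p dvd norm4 i j k l"
  unfolding norm_ideal_def using Em_inject[OF assms] by blast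

text \<open>Stability under multiplication by integers and primality come from the multiplicativity of the
  norm, up to the factor \<open>m ^ 4\<close>, which is prime to \<open>p\<close>.\<close>
lemma prime_above_norm_ideal:
  assumes p: "prime p" and m: "denominator m p"
    and add: "\<And>i j k l i' j' k' l'. int p dvd norm4 i j k l \<Longrightarrow> int p dvd norm4 i' j' k' l' \<Longrightarrow>
      int p dvd norm4 (i + i') (j + j') (k + k') (l + l')"
  shows "prime_above F p (norm_ideal m p)"
proof -
  have m0: "m \<noteq> 0" and cop: "coprime (int p) m" and ex: "\<And>t. t \<in> \<O> \<Longrightarrow> \<exists>i j k l. t = Em m i j k l"
    using m unfolding denominator_def by auto
  have p': "prime (int p)" using p by simp
  have pm: "\<not> int p dvd m ^ 4"
  proof
    assume "int p dvd m ^ 4"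
    then have "int p dvd m" using p' prime_dvd_power by blast
    then have "int p dvd 1" using cop by (metis coprime_common_divisor dvd_refl)
    then show False using p' by (simp add: prime_int_iff)
  qed
  have n1: "norm4 i 0 0 0 = i ^ 4" for i :: int
    unfolding norm4_def normA_def normB_def by (simp add: power2_eq_square power4_eq_xxxx)
  have E1: "of_int i = Em m (m * i) 0 0 0" for i
    using m0 unfolding Em_def by (simp add: ev_def)
  have int_iff: "of_int i \<in> norm_ideal m p \<longleftrightarrow> int p dvd (m * i) ^ 4" for i
    unfolding E1 Em_in_norm_ideal[OF m0] n1 using of_int_in_O[of i] unfolding E1 by simp
  show ?thesis unfolding prime_above_iff
  proof (intro conjI ballI impI)
    show "norm_ideal m p \<subseteq> \<O>" unfolding norm_ideal_def by blast
    show "0 \<in> norm_ideal m p" using int_iff[of 0] by simp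
    show "1 \<notin> norm_ideal m p" using int_iff[of 1] pm by simp
    show "of_nat p \<in> norm_ideal m p" using int_iff[of "int p"] by (simp add: power_mult_distrib)
  next
    fix t t' assume t: "t \<in> norm_ideal m p" "t' \<in> norm_ideal m p"
    then obtain i j k l i' j' k' l' where e: "t = Em m i j k l" "t' = Em m i' j' k' l'"
      and "int p dvd norm4 i j k l" "int p dvd norm4 i' j' k' l'" unfolding norm_ideal_def by blast
    then show "t + t' \<in> norm_ideal m p"
      using add t integers_closed(1)[of t t'] unfolding e Em_add Em_in_norm_ideal[OF m0] by blast
  next
    fix t t' assume t: "t \<in> \<O>" "t' \<in> norm_ideal m p"
    then have t'O: "t' \<in> \<O>" unfolding norm_ideal_def by blast
    obtain i j k l where e: "t = Em m i j k l" using ex t by blast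
    obtain i' j' k' l' where e': "t' = Em m i' j' k' l'" "int p dvd norm4 i' j' k' l'" using t unfolding norm_ideal_def by blast
    have O: "t * t' \<in> \<O>" using integers_closed(2) t(1) t'O by blast
    then obtain i'' j'' k'' l'' where e'': "t * t' = Em m i'' j'' k'' l''" using ex by blast
    have "m ^ 4 * norm4 i'' j'' k'' l'' = norm4 i j k l * norm4 i' j' k' l'"
      using Em_norm_mult[OF m0 e''[unfolded e e']] .
    then have "int p dvd m ^ 4 * norm4 i'' j'' k'' l''" using e'(2) by simp
    then have "int p dvd norm4 i'' j'' k'' l''" using pm p' prime_dvd_mult_iff by blast
    then show "t * t' \<in> norm_ideal m p" using O unfolding e'' Em_in_norm_ideal[OF m0] by blast
  next
    fix t t' assume t: "t \<in> \<O>" "t' \<in> \<O>" "t * t' \<in> norm_ideal m p"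
    obtain i j k l where e: "t = Em m i j k l" using ex t by blast
    obtain i' j' k' l' where e': "t' = Em m i' j' k' l'" using ex t by blast
    obtain i'' j'' k'' l'' where e'': "t * t' = Em m i'' j'' k'' l''" "int p dvd norm4 i'' j'' k'' l''"
      using t(3) unfolding norm_ideal_def by blast
    have "m ^ 4 * norm4 i'' j'' k'' l'' = norm4 i j k l * norm4 i' j' k' l'"
      using Em_norm_mult[OF m0 e''(1)[unfolded e e']] .
    then have "int p dvd norm4 i j k l * norm4 i' j' k' l'" using e''(2) by (metis dvd_mult)
    then have "int p dvd norm4 i j k l \<or> int p dvd norm4 i' j' k' l'" using p' prime_dvd_mult_iff by blast
    then show "t \<in> norm_ideal m p \<or> t' \<in> norm_ideal m p"
      using t(1,2) unfolding e e' Em_in_norm_ideal[OF m0] by blast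
  qed
qed

text \<open>One inclusion holds for every prime above \<open>p\<close>; for the other one it suffices to treat \<open>m t\<close> in place
  of \<open>t\<close>, as \<open>m\<close> is not in \<open>P\<close>.\<close>
lemma prime_above_eq_norm_ideal:
  assumes p: "prime p" and m: "denominator m p" and P: "prime_above F p P"
    and contained: "\<And>i j k l. int p dvd norm4 i j k l \<Longrightarrow> of_int i + of_int j * rtd + of_int k * \<beta> + of_int l * \<gamma> \<in> P"
  shows "P = norm_ideal m p"
proof
  note PD = prime_aboveD[OF P]
  have m0: "m \<noteq> 0" and cop: "coprime (int p) m" and ex: "\<And>t. t \<in> \<O> \<Longrightarrow> \<exists>i j k l. t = Em m i j k l"
    using m unfolding denominator_def by auto
  show "P \<subseteq> norm_ideal m p"
  proof
    fix t assume t: "t \<in> P"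
    then have tO: "t \<in> \<O>" using PD(1) by blast
    then obtain i j k l where e: "t = Em m i j k l" using ex by blast
    then have "int p dvd norm4 i j k l" using norm_in_prime_above[OF p P m0] t by blast
    then show "t \<in> norm_ideal m p" using e tO unfolding norm_ideal_def by blast
  qed
  show "norm_ideal m p \<subseteq> P"
  proof
    fix t assume "t \<in> norm_ideal m p"
    then obtain i j k l where t: "t \<in> \<O>" "t = Em m i j k l" "int p dvd norm4 i j k l" unfolding norm_ideal_def by blast
    have "of_int m * t \<in> P" unfolding t(2) Em_scale[OF m0] using contained[OF t(3)] .
    then have "of_int m \<in> P \<or> t \<in> P" using PD(5)[OF of_int_in_O t(1)] by blast
    moreover have "of_int m \<notin> P"
    proof
      assume "of_int m \<in> P"
      then have "int p dvd m" using int_in_prime_above[OF p P] by blast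
      then have "int p dvd 1" using cop by (metis coprime_common_divisor dvd_refl)
      then show False using p by (simp add: prime_nat_iff)
    qed
    ultimately show "t \<in> P" by blast
  qed
qed

lemma nonresidue:
  assumes "prime p" "\<not> QuadRes (int p) d" "int p dvd u\<^sup>2 - d * v\<^sup>2"
  shows "int p dvd u \<and> int p dvd v"
proof -
  have p': "prime (int p)" using assms(1) by simp
  have v: "int p dvd v"
  proof (rule ccontr)
    assume "\<not> int p dvd v"
    then have "coprime v (int p)" using p' by (metis coprime_commute prime_imp_coprime)
    then obtain v' where v': "[v * v' = 1] (mod int p)" using cong_solve_coprime_int by blast
    have "[u\<^sup>2 = d * v\<^sup>2] (mod int p)" using assms(3) by (simp add: cong_iff_dvd_diff)
    then have "[u\<^sup>2 * v'\<^sup>2 = d * v\<^sup>2 * v'\<^sup>2] (mod int p)" by (rule cong_scalar_right)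
    moreover have "[d * (v * v')\<^sup>2 = d * 1\<^sup>2] (mod int p)" using v' by (intro cong_scalar_left cong_pow)
    ultimately have "[(u * v')\<^sup>2 = d] (mod int p)"
      by (simp add: power_mult_distrib mult.assoc) (metis cong_trans)
    then show False using assms(2) unfolding QuadRes_def by blast
  qed
  then have "int p dvd (u\<^sup>2 - d * v\<^sup>2) + d * v\<^sup>2" using assms(3) by (intro dvd_add) (simp_all add: power2_eq_square)
  then have "int p dvd u\<^sup>2" by simp
  then show ?thesis using v p' prime_dvd_power by blast
qed

lemma nonresidue_odd:
  assumes "prime p" "\<not> QuadRes (int p) d"
  shows "p \<noteq> 2"
proof
  assume "p = 2"
  have "[d\<^sup>2 = d] (mod 2)" by (simp add: cong_iff_dvd_diff)
  then show False using assms(2) \<open>p = 2\<close> unfolding QuadRes_def by auto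
qed

text \<open>Modulo \<open>p\<close> the norm is \<open>i ^ 4\<close>.\<close>
lemma norm4_dvd_ramified:
  assumes "prime p" "int p dvd d"
  shows "int p dvd norm4 i j k l \<longleftrightarrow> int p dvd i"
proof -
  have p': "prime (int p)" using assms(1) by simp
  obtain e where e: "d = int p * e" using assms(2) by (auto elim: dvdE)
  define r where "r = e * j\<^sup>2 - a * e * (k\<^sup>2 + l\<^sup>2)"
  have "normA i j k l = i\<^sup>2 + int p * r" unfolding normA_def r_def by (simp add: e algebra_simps)
  then have "norm4 i j k l = i ^ 4 + int p * (2 * i\<^sup>2 * r + int p * r\<^sup>2 - e * (normB i j k l)\<^sup>2)"
    unfolding norm4_def by (simp add: e power2_eq_square power4_eq_xxxx algebra_simps)
  then have "int p dvd norm4 i j k l \<longleftrightarrow> int p dvd i ^ 4" by (simp add: dvd_add_left_iff)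
  also have "\<dots> \<longleftrightarrow> int p dvd i" using p' by (simp add: prime_dvd_power_iff)
  finally show ?thesis .
qed

text \<open>Modulo \<open>p\<close> the norm is the square of \<open>i\<^sup>2 - d j\<^sup>2\<close>.\<close>
lemma norm4_dvd_semiramified:
  assumes "prime p" "int p dvd a" "\<not> QuadRes (int p) d"
  shows "int p dvd norm4 i j k l \<longleftrightarrow> int p dvd i \<and> int p dvd j"
proof -
  have p': "prime (int p)" using assms(1) by simp
  obtain e where e: "a = int p * e" using assms(2) by (auto elim: dvdE)
  define r where "r = - e * d * (k\<^sup>2 + l\<^sup>2)"
  define s where "s = e * b * (k\<^sup>2 - l\<^sup>2) - 2 * e * c * k * l"
  have A: "normA i j k l = i\<^sup>2 + d * j\<^sup>2 + int p * r" unfolding normA_def r_def by (simp add: e algebra_simps)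
  have B: "normB i j k l = 2 * i * j + int p * s" unfolding normB_def s_def by (simp add: e algebra_simps)
  have "norm4 i j k l = (i\<^sup>2 - d * j\<^sup>2)\<^sup>2 + int p * (2 * (i\<^sup>2 + d * j\<^sup>2) * r + int p * r\<^sup>2 - d * (4 * i * j * s + int p * s\<^sup>2))"
    unfolding norm4_def A B by (simp add: power2_eq_square algebra_simps)
  then have "int p dvd norm4 i j k l \<longleftrightarrow> int p dvd (i\<^sup>2 - d * j\<^sup>2)\<^sup>2" by (simp add: dvd_add_left_iff)
  also have "\<dots> \<longleftrightarrow> int p dvd i\<^sup>2 - d * j\<^sup>2" using p' by (simp add: prime_dvd_power_iff)
  also have "\<dots> \<longleftrightarrow> int p dvd i \<and> int p dvd j"
  proof
    assume "int p dvd i \<and> int p dvd j"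
    then show "int p dvd i\<^sup>2 - d * j\<^sup>2" by (auto intro!: dvd_diff simp: power2_eq_square)
  qed (use nonresidue[OF assms(1,3)] in blast)
  finally show ?thesis .
qed

lemma norm4_dvd_inert:
  assumes "prime p" "\<not> int p dvd a" "\<not> QuadRes (int p) d"
  shows "int p dvd norm4 i j k l \<longleftrightarrow> int p dvd i \<and> int p dvd j \<and> int p dvd k \<and> int p dvd l"
proof
  have p': "prime (int p)" using assms(1) by simp
  assume N: "int p dvd norm4 i j k l"
  have "\<not> p dvd 2"
    using nonresidue_odd[OF assms(1,3)] assms(1) two_is_prime_nat primes_dvd_imp_eq by blast
  then have "\<not> int p dvd int 2" unfolding int_dvd_int_iff .
  then have two: "\<not> int p dvd 2" by simp
  have prm: "int p dvd u \<or> int p dvd v" if "int p dvd u * v" for u v using that p' prime_dvd_mult_iff by blast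
  have non: "int p dvd u \<and> int p dvd v" if "int p dvd u\<^sup>2 - of_int d * v\<^sup>2" for u v
    by (rule nonresidue[OF assms(1,3)]) (use that in \<open>simp only: of_int_eq_id id_apply\<close>)
  have "\<not> int p dvd of_int a" using assms(2) by simp
  from norm_anisotropic[OF prm non this two N[unfolded norm4_def]]
  show "int p dvd i \<and> int p dvd j \<and> int p dvd k \<and> int p dvd l" by blast
next
  assume "int p dvd i \<and> int p dvd j \<and> int p dvd k \<and> int p dvd l"
  then obtain i' j' k' l' where e: "i = int p * i'" "j = int p * j'" "k = int p * k'" "l = int p * l'" by (auto elim!: dvdE)
  show "int p dvd norm4 i j k l" unfolding e norm4_scale by simp
qed

lemma basis_in_O: "rtd \<in> \<O>" "\<beta> \<in> \<O>" "\<gamma> \<in> \<O>"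
  using rtd_int beta_int gamma_int E_in_F E_basis by (metis mem_Collect_eq)+

lemma square_in_prime:
  assumes "prime_above F p P" "t \<in> \<O>" "t * t \<in> P"
  shows "t \<in> P"
  using prime_aboveD(5)[OF assms(1,2,2,3)] by blast

text \<open>The squares of \<open>s\<close>, \<open>\<beta>\<close> and \<open>\<gamma>\<close> are multiples of \<open>d\<close>, up to a multiple of \<open>s\<close> for the last two.\<close>
lemma basis_in_prime_ramified:
  assumes p: "prime p" "int p dvd d" and P: "prime_above F p P"
  shows "rtd \<in> P" "\<beta> \<in> P" "\<gamma> \<in> P"
proof -
  note PD = prime_aboveD[OF P]
  note m = mult_table_E[unfolded mult_table_def]
  have dP: "of_int (k * d) \<in> P" for k using int_in_prime_above[OF p(1) P] p(2) by (metis dvd_mult)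
  show r: "rtd \<in> P" by (rule square_in_prime[OF P basis_in_O(1)]) (use rtd_sq dP[of 1] in simp)
  have "of_int (a * d) - of_int (a * b) * rtd \<in> P" by (intro PD(3,8) dP of_int_in_O r)
  then show "\<beta> \<in> P" by (intro square_in_prime[OF P basis_in_O(2)]) (use beta_sq in simp)
  have "of_int (a * d) + of_int (a * b) * rtd \<in> P" by (intro PD(3,2) dP of_int_in_O r)
  then show "\<gamma> \<in> P" by (intro square_in_prime[OF P basis_in_O(3)]) (use m in simp)
qed

lemma basis_in_prime_semiramified:
  assumes p: "prime p" "int p dvd a" and P: "prime_above F p P"
  shows "\<beta> \<in> P" "\<gamma> \<in> P"
proof -
  note PD = prime_aboveD[OF P]
  note m = mult_table_E[unfolded mult_table_def]
  have aP: "of_int (a * k) \<in> P" for k using int_in_prime_above[OF p(1) P] p(2) by (metis dvd_mult2)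
  have "of_int (a * d) - rtd * of_int (a * b) \<in> P" by (intro PD(3,8) aP basis_in_O)
  then show "\<beta> \<in> P" by (intro square_in_prime[OF P basis_in_O(2)]) (use beta_sq in \<open>simp add: mult.commute\<close>)
  have "of_int (a * d) + rtd * of_int (a * b) \<in> P" by (intro PD(3,2) aP basis_in_O)
  then show "\<gamma> \<in> P" by (intro square_in_prime[OF P basis_in_O(3)]) (use m in \<open>simp add: mult.commute\<close>)
qed

theorem prime_above_ramified:
  assumes p: "prime p" "int p dvd d" and m: "denominator m p"
  shows "prime_above F p P \<longleftrightarrow> P = norm_ideal m p"
proof
  assume P: "prime_above F p P"
  note PD = prime_aboveD[OF P] and c = basis_in_prime_ramified[OF p P]
  show "P = norm_ideal m p"
  proof (rule prime_above_eq_norm_ideal[OF p(1) m P])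
    fix i j k l assume "int p dvd norm4 i j k l"
    then have "of_int i \<in> P" using norm4_dvd_ramified[OF p] int_in_prime_above[OF p(1) P] by blast
    then show "of_int i + of_int j * rtd + of_int k * \<beta> + of_int l * \<gamma> \<in> P" by (intro PD(2,3) of_int_in_O c)
  qed
next
  have "prime_above F p (norm_ideal m p)"
    by (rule prime_above_norm_ideal[OF p(1) m]) (simp add: norm4_dvd_ramified[OF p])
  then show "P = norm_ideal m p \<Longrightarrow> prime_above F p P" by simp
qed

theorem prime_above_semiramified:
  assumes p: "prime p" "int p dvd a" "\<not> QuadRes (int p) d" and m: "denominator m p"
  shows "prime_above F p P \<longleftrightarrow> P = norm_ideal m p"
proof
  assume P: "prime_above F p P"
  note PD = prime_aboveD[OF P] and c = basis_in_prime_semiramified[OF p(1,2) P]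
  show "P = norm_ideal m p"
  proof (rule prime_above_eq_norm_ideal[OF p(1) m P])
    fix i j k l assume "int p dvd norm4 i j k l"
    then have "of_int i \<in> P" "of_int j \<in> P" using norm4_dvd_semiramified[OF p] int_in_prime_above[OF p(1) P] by blast+
    then have "of_int i + rtd * of_int j + of_int k * \<beta> + of_int l * \<gamma> \<in> P" by (intro PD(2,3) of_int_in_O c basis_in_O)
    then show "of_int i + of_int j * rtd + of_int k * \<beta> + of_int l * \<gamma> \<in> P" by (simp add: mult.commute)
  qed
next
  have "prime_above F p (norm_ideal m p)"
    by (rule prime_above_norm_ideal[OF p(1) m]) (simp add: norm4_dvd_semiramified[OF p])
  then show "P = norm_ideal m p \<Longrightarrow> prime_above F p P" by simp
qed

theorem prime_above_inert:
  assumes p: "prime p" "\<not> int p dvd a" "\<not> QuadRes (int p) d" and m: "denominator m p"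
  shows "prime_above F p P \<longleftrightarrow> P = norm_ideal m p"
proof
  assume P: "prime_above F p P"
  note PD = prime_aboveD[OF P]
  show "P = norm_ideal m p"
  proof (rule prime_above_eq_norm_ideal[OF p(1) m P])
    fix i j k l assume "int p dvd norm4 i j k l"
    then have "of_int i \<in> P" "of_int j \<in> P" "of_int k \<in> P" "of_int l \<in> P"
      using norm4_dvd_inert[OF p] int_in_prime_above[OF p(1) P] by blast+
    then have "of_int i + rtd * of_int j + \<beta> * of_int k + \<gamma> * of_int l \<in> P" by (intro PD(2,3) basis_in_O)
    then show "of_int i + of_int j * rtd + of_int k * \<beta> + of_int l * \<gamma> \<in> P" by (simp add: mult.commute)
  qed
next
  have "prime_above F p (norm_ideal m p)"
    by (rule prime_above_norm_ideal[OF p(1) m]) (simp add: norm4_dvd_inert[OF p])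
  then show "P = norm_ideal m p \<Longrightarrow> prime_above F p P" by simp
qed

text \<open>All coordinates of an element of \<open>P\<close> are divisible by \<open>p\<close>. The quotient \<open>u\<close> is an integer since \<open>4 u\<close> and
  \<open>p u\<close> are, so \<open>P\<close> consists of multiples of \<open>p\<close>.\<close>
theorem not_primitive_inert:
  assumes p: "prime p" "\<not> int p dvd a" "\<not> QuadRes (int p) d" and P: "prime_above F p P"
  shows "\<not> primitive_ideal F P"
proof -
  have p2: "p \<noteq> 2" using nonresidue_odd[OF p(1,3)] .
  have m: "denominator 4 p" using denominator_4[OF p(1) p2] .
  have Pn: "P = norm_ideal 4 p" using prime_above_inert[OF p m] P by blast
  have "P \<subseteq> (\<lambda>x. of_nat p * x) ` \<O>"
  proof
    fix t assume "t \<in> P"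
    then obtain i j k l where t: "t \<in> \<O>" "t = Em 4 i j k l" "int p dvd norm4 i j k l" unfolding Pn norm_ideal_def by blast
    then have "int p dvd i \<and> int p dvd j \<and> int p dvd k \<and> int p dvd l" using norm4_dvd_inert[OF p] by blast
    then obtain i' j' k' l' where e: "i = int p * i'" "j = int p * j'" "k = int p * k'" "l = int p * l'" by (auto elim!: dvdE)
    define u where "u = Em 4 i' j' k' l'"
    have tu: "t = of_int (int p) * u" unfolding t(2) e u_def Em_def E_int_scale by simp
    have uF: "u \<in> F" unfolding u_def Em_def by (rule E_in_F)
    have "of_int 4 * u = E (of_int i') (of_int j') (of_int k') (of_int l')" unfolding u_def Em_def E_int_scale by simp
    then have u4: "algebraic_int (of_int 4 * u)" using E_int_coords by simp
    have "coprime (int p) 4" using m unfolding denominator_def by simp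
    then obtain v w where "v * int p + w * 4 = 1"
      using bezout_int[of "int p" 4] by (metis coprime_imp_gcd_eq_1)
    then have "u = of_int (v * int p + w * 4) * u" by simp
    also have "\<dots> = of_int v * t + of_int w * (of_int 4 * u)" unfolding tu by (simp add: algebra_simps)
    finally have "u = of_int v * t + of_int w * (of_int 4 * u)" .
    moreover have "algebraic_int (of_int v * t + of_int w * (of_int 4 * u))"
      using t(1) by (intro algebraic_int_add algebraic_int_mult[OF algebraic_int_of_int] u4) simp
    ultimately have "u \<in> \<O>" using uF by auto
    then show "t \<in> (\<lambda>x. of_nat p * x) ` \<O>" using tu by auto
  qed
  moreover have "p \<ge> 2" using p(1) prime_ge_2_nat by blast
  ultimately show ?thesis
    unfolding primitive_ideal_def carrier_ring_of_integers not_not by (intro exI[of _ p] conjI)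
qed

text \<open>Since \<open>p\<close> lies in \<open>P\<close>, the only possible factor is \<open>p\<close> itself.\<close>
lemma primitive_if_not_in_p:
  assumes p: "prime p" and P: "prime_above F p P" and t: "t \<in> P" and nt: "\<And>u. u \<in> \<O> \<Longrightarrow> t \<noteq> of_nat p * u"
  shows "primitive_ideal F P"
  unfolding primitive_ideal_def carrier_ring_of_integers
proof
  note PD = prime_aboveD[OF P]
  assume "\<exists>n\<ge>2. P \<subseteq> (\<lambda>x. of_nat n * x) ` \<O>"
  then obtain n where n: "n \<ge> 2" "P \<subseteq> (\<lambda>x. of_nat n * x) ` \<O>" by (elim exE conjE)
  have "of_nat p \<in> (\<lambda>x. of_nat n * x) ` \<O>" using subsetD[OF n(2) PD(6)] .
  then obtain u where u: "of_nat p = of_nat n * u" "u \<in> \<O>" by blast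
  have "(of_rat (of_nat p / of_nat n) :: complex) = of_nat p / of_nat n" by (simp add: of_rat_divide)
  also have "\<dots> = u" using u n by (simp add: field_simps)
  finally have "algebraic_int (of_rat (of_nat p / of_nat n) :: complex)" using u by simp
  then obtain k where k: "(of_nat p / of_nat n :: rat) = of_int k" by (rule algebraic_int_of_rat)
  then have "of_int (int p) = (of_int (k * int n) :: rat)" using n by (simp add: field_simps)
  then have "int p = k * int n" by (simp only: of_int_eq_iff)
  then have "int n dvd int p" by simp
  then have "n = p" using p n unfolding int_dvd_int_iff prime_nat_iff by auto
  then have "t \<in> (\<lambda>x. of_nat p * x) ` \<O>" using subsetD[OF n(2) t] by simp
  then show False using nt by (elim imageE) blast
qed

text \<open>If \<open>s / p\<close> were an integer, so would be \<open>d / p\<^sup>2\<close>, but \<open>d\<close> is squarefree.\<close>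
theorem primitive_ramified:
  assumes p: "prime p" "int p dvd d" and P: "prime_above F p P"
  shows "primitive_ideal F P"
proof (rule primitive_if_not_in_p[OF p(1) P basis_in_prime_ramified(1)[OF p P]])
  fix u assume u: "u \<in> \<O>"
  have p0: "p \<noteq> 0" using p(1) by auto
  show "rtd \<noteq> of_nat p * u"
  proof
    assume "rtd = of_nat p * u"
    then have "of_int d = (of_nat p * of_nat p) * (u * u)" using rtd_sq by (simp add: mult.assoc mult.left_commute)
    then have "u * u = of_rat (of_int d / (of_nat p * of_nat p))" using p0 by (simp add: of_rat_divide of_rat_mult field_simps)
    moreover have "algebraic_int (u * u)" using u by (intro algebraic_int_mult) auto
    ultimately have "algebraic_int (of_rat (of_int d / (of_nat p * of_nat p)) :: complex)" by simp
    then obtain k where k: "of_int d / (of_nat p * of_nat p :: rat) = of_int k" by (rule algebraic_int_of_rat)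
    then have "of_int d = (of_int (k * (int p * int p)) :: rat)" using p0 by (simp add: field_simps)
    then have "d = k * (int p * int p)" by (simp only: of_int_eq_iff)
    then have "(int p)\<^sup>2 dvd d" by (simp add: power2_eq_square)
    then have "int p dvd 1" using squarefree_d unfolding squarefree_def by blast
    then show False using p(1) by (simp add: prime_nat_iff)
  qed
qed

text \<open>\<open>\<beta> / p\<close> is not an integer, as \<open>4 / p\<close> is not.\<close>
theorem primitive_semiramified:
  assumes p: "prime p" "int p dvd a" "\<not> QuadRes (int p) d" and P: "prime_above F p P"
  shows "primitive_ideal F P"
proof (rule primitive_if_not_in_p[OF p(1) P basis_in_prime_semiramified(1)[OF p(1,2) P]])
  fix u assume u: "u \<in> \<O>"
  have p2: "p \<noteq> 2" using nonresidue_odd[OF p(1,3)] .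
  have "coprime (int p) 4" and ex: "\<exists>i j k l. u = Em 4 i j k l"
    using denominator_4[OF p(1) p2] u unfolding denominator_def by simp_all
  show "\<beta> \<noteq> of_nat p * u"
  proof
    assume b: "\<beta> = of_nat p * u"
    obtain i j k l where e: "u = Em 4 i j k l" using ex by blast
    have "E 0 0 1 0 = E (of_int (int p) * (of_int i / 4)) (of_int (int p) * (of_int j / 4)) (of_int (int p) * (of_int k / 4)) (of_int (int p) * (of_int l / 4))"
      unfolding E_int_scale[symmetric] using b e unfolding Em_def by (simp add: ev_def)
    then have "1 = of_int (int p) * (of_int k / (4::rat))" using E_inject by blast
    then have "of_int 4 = (of_int (int p * k) :: rat)" by simp
    then have "4 = int p * k" by (simp only: of_int_eq_iff)
    then have "int p dvd 4" by (metis dvd_triv_left)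
    then have "int p dvd 1" using \<open>coprime (int p) 4\<close> by (metis coprime_common_divisor dvd_refl)
    then show False using p(1) by (simp add: prime_nat_iff)
  qed
qed

lemma conj_prime_above:
  assumes "prime_above F p P"
  shows "prime_above F p {t \<in> \<O>. emb1 t \<in> P}"
proof -
  note PD = prime_aboveD[OF assms]
  let ?s = "emb1"
  have sO: "?s t \<in> \<O>" if tO: "t \<in> \<O>" for t
  proof -
    obtain x y z w where t: "t = E x y z w" "algebraic_int (E x y z w)" using integer_cases[OF tO] .
    have "?s t = E x (- y) (- w) z" unfolding t emb_E by (simp add: ev_def of_rat_minus algebra_simps)
    then show ?thesis using algebraic_int_conj[OF t(2)] E_in_F[of x "- y" "- w" z] by simp
  qed
  have add: "?s (t + t') = ?s t + ?s t'" and mul: "?s (t * t') = ?s t * ?s t'" if "t \<in> \<O>" "t' \<in> \<O>" for t t'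
    using emb_add[of t t'] emb_mult[OF tables(2), of t t'] that by auto
  have int: "?s (of_int k) = of_int k" for k using emb_rat[of "- rtd" \<gamma> "- \<beta>" "of_int k"] by simp
  have 0: "(0::complex) \<in> P" using PD(3)[OF of_int_in_O[of 0] PD(6)] by simp
  show ?thesis unfolding prime_above_iff
  proof (intro conjI ballI impI)
    show "0 \<in> {t \<in> \<O>. ?s t \<in> P}" using int[of 0] of_int_in_O[of 0] 0 by simp
    show "1 \<notin> {t \<in> \<O>. ?s t \<in> P}" using int[of 1] PD(4) by simp
    show "of_nat p \<in> {t \<in> \<O>. ?s t \<in> P}" using int[of "int p"] of_int_in_O[of "int p"] PD(6) by simp
    show "x + y \<in> {t \<in> \<O>. ?s t \<in> P}" if "x \<in> {t \<in> \<O>. ?s t \<in> P}" "y \<in> {t \<in> \<O>. ?s t \<in> P}" for x y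
      using that add[of x y] integers_closed(1)[of x y] PD(2) by simp
    show "x * y \<in> {t \<in> \<O>. ?s t \<in> P}" if "x \<in> \<O>" "y \<in> {t \<in> \<O>. ?s t \<in> P}" for x y
      using that mul[of x y] integers_closed(2)[of x y] PD(3)[OF sO[OF that(1)]] by simp
    show "x \<in> {t \<in> \<O>. ?s t \<in> P} \<or> y \<in> {t \<in> \<O>. ?s t \<in> P}"
      if "x \<in> \<O>" "y \<in> \<O>" "x * y \<in> {t \<in> \<O>. ?s t \<in> P}" for x y
      using that mul[of x y] PD(5)[OF sO[OF that(1)] sO[OF that(2)]] by simp
  qed blast
qed

lemma unique_prime_conj_closed:
  assumes "\<exists>!P. prime_above F p P" "prime_above F p P" "E x y z w \<in> P"
  shows "E x (- y) (- w) z \<in> P"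
proof -
  have "{t \<in> \<O>. emb1 t \<in> P} = P" using assms(1,2) conj_prime_above[OF assms(2)] by blast
  then have "emb1 (E x y z w) \<in> P" using assms(3) by blast
  then show ?thesis unfolding emb_E by (simp add: ev_def of_rat_minus algebra_simps)
qed

text \<open>A unique prime \<open>P\<close> is stable under conjugation. If \<open>r\<^sup>2 \<equiv> d\<close> modulo \<open>p\<close>, then \<open>P\<close> contains one of
  \<open>s - r\<close> and \<open>s + r\<close>, together with its conjugate, and therefore contains \<open>2 r\<close>.\<close>
theorem not_unique_if_residue:
  assumes p: "prime p" "p \<noteq> 2" "\<not> int p dvd d" "QuadRes (int p) d"
  shows "\<not> (\<exists>!P. prime_above F p P)"
proof
  assume U: "\<exists>!P. prime_above F p P"
  then obtain P where P: "prime_above F p P" by blast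
  note PD = prime_aboveD[OF P]
  obtain r where r: "[r\<^sup>2 = d] (mod int p)" using p(4) unfolding QuadRes_def by blast
  have "int p dvd d - r\<^sup>2" using r by (metis cong_iff_dvd_diff cong_sym)
  then have "of_int (d - r\<^sup>2) \<in> P" using int_in_prime_above[OF p(1) P] by blast
  also have "of_int (d - r\<^sup>2) = E (of_int (- r)) 1 0 0 * E (of_int r) 1 0 0"
    using rtd_sq by (simp add: ev_def of_rat_minus algebra_simps power2_eq_square)
  finally have prod: "E (of_int (- r)) 1 0 0 * E (of_int r) 1 0 0 \<in> P" .
  have O: "E (of_int i) 1 0 0 \<in> \<O>" for i using E_int_coords[of i 1 0 0] E_in_F by simp
  have "E (of_int (- r)) 1 0 0 \<in> P \<or> E (of_int r) 1 0 0 \<in> P" by (rule PD(5)[OF O O prod])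
  then obtain r' where r': "r' = r \<or> r' = - r" "E (of_int r') 1 0 0 \<in> P" by blast
  then have "E (of_int r') 1 0 0 + E (of_int r') (- 1) (- 0) 0 \<in> P"
    using unique_prime_conj_closed[OF U P, of "of_int r'" 1 0 0] PD(2) by blast
  also have "E (of_int r') 1 0 0 + E (of_int r') (- 1) (- 0) 0 = of_int (2 * r')" unfolding ev_add by (simp add: ev_def of_rat_mult)
  finally have "int p dvd 2 * r'" using int_in_prime_above[OF p(1) P] by blast
  moreover have "\<not> int p dvd int 2" unfolding int_dvd_int_iff using p(1,2) two_is_prime_nat primes_dvd_imp_eq by blast
  ultimately have "int p dvd r'" using p(1) prime_dvd_mult_iff[of "int p" 2 r'] by simp
  then have "int p dvd r\<^sup>2" using r' by (auto simp: power2_eq_square)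
  then have "int p dvd (d - r\<^sup>2) + r\<^sup>2" using \<open>int p dvd d - r\<^sup>2\<close> by (rule dvd_add[rotated])
  then show False using p(3) by simp
qed

text \<open>The same argument with the factors \<open>\<omega>\<close> and \<open>\<omega> - 1\<close> of \<open>(d - 1) / 4\<close>, whose conjugates are \<open>1 - \<omega>\<close> and
  \<open>- \<omega>\<close>.\<close>
theorem not_unique_two_if_split:
  assumes "d mod 8 = 1"
  shows "\<not> (\<exists>!P. prime_above F 2 P)"
proof
  assume U: "\<exists>!P. prime_above F 2 P"
  then obtain P where P: "prime_above F 2 P" by blast
  note PD = prime_aboveD[OF P]
  have "d = 8 * (d div 8) + 1" using assms by presburger
  then obtain e where e: "d = 8 * e + 1" by blast
  have od: "odd d" using e by simp
  have "int 2 dvd 2 * e" by simp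
  then have "of_int (2 * e) \<in> P" using int_in_prime_above[OF two_is_prime_nat P] by blast
  also have "of_int (2 * e) = E (1/2) (1/2) 0 0 * E (- 1/2) (1/2) 0 0"
  proof -
    have e': "(of_int d :: rat) = 8 * of_int e + 1" by (simp add: e)
    show ?thesis unfolding E_of_int[of "2 * e"] E_mult by (rule E_cong) (simp_all add: mul_defs e' field_simps)
  qed
  finally have "E (1/2) (1/2) 0 0 * E (- 1/2) (1/2) 0 0 \<in> P" .
  moreover have "E (1/2) (1/2) 0 0 \<in> \<O>" "E (- 1/2) (1/2) 0 0 \<in> \<O>"
    using K_half_int[OF od, of 1 1] K_half_int[OF od, of "- 1" 1] E_in_F by simp_all
  ultimately consider "E (1/2) (1/2) 0 0 \<in> P" | "E (- 1/2) (1/2) 0 0 \<in> P" using PD(5) by blast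
  then show False
  proof cases
    case 1
    then have "E (1/2) (1/2) 0 0 + E (1/2) (- (1/2)) (- 0) 0 \<in> P"
      using unique_prime_conj_closed[OF U P] PD(2) by blast
    then have "1 \<in> P" unfolding ev_add by (simp add: ev_def)
    then show False using PD(4) by blast
  next
    case 2
    then have "E (- 1/2) (1/2) 0 0 + E (- 1/2) (- (1/2)) (- 0) 0 \<in> P"
      using unique_prime_conj_closed[OF U P] PD(2) by blast
    then have "- 1 \<in> P" unfolding ev_add by (simp add: ev_def)
    then have "- (- 1) \<in> P" using PD(7) by blast
    then show False using PD(4) by simp
  qed
qed

lemma denominator_exists: "prime p \<Longrightarrow> int p dvd d \<Longrightarrow> \<exists>m. denominator m p"
  using denominator_4[of p] denominator_1[of p] by (cases "p = 2") auto

theorem unique_prime_iff: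
  assumes p: "prime p" and ex: "\<not> (p = 2 \<and> [d = 5] (mod 8))"
  shows "(\<exists>!P. prime_above F p P) \<longleftrightarrow> int p dvd d \<or> (int p dvd a \<and> \<not> QuadRes (int p) d) \<or>
    (\<not> int p dvd a * b * c * d \<and> \<not> QuadRes (int p) d)"
proof -
  have p': "prime (int p)" using p by simp
  consider "int p dvd d" | "\<not> int p dvd d" "\<not> QuadRes (int p) d" "int p dvd a" | "\<not> int p dvd d" "\<not> QuadRes (int p) d" "\<not> int p dvd a"
    | "\<not> int p dvd d" "QuadRes (int p) d" by blast
  then show ?thesis
  proof cases
    case 1
    then show ?thesis using denominator_exists[OF p] prime_above_ramified[OF p] by metis
  next
    case 2
    then show ?thesis using denominator_4[OF p nonresidue_odd[OF p]] prime_above_semiramified[OF p] by metis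
  next
    case 3
    have "\<not> int p dvd b"
    proof
      assume "int p dvd b"
      then have "[c\<^sup>2 = d] (mod int p)" unfolding d_eq cong_iff_dvd_diff by (simp add: power2_eq_square)
      then show False using 3 unfolding QuadRes_def by blast
    qed
    moreover have "\<not> int p dvd c"
    proof
      assume "int p dvd c"
      then have "[b\<^sup>2 = d] (mod int p)" unfolding d_eq cong_iff_dvd_diff by (simp add: power2_eq_square)
      then show False using 3 unfolding QuadRes_def by blast
    qed
    ultimately have "\<not> int p dvd a * b * c * d" using 3 p' by (simp add: prime_dvd_mult_iff)
    moreover have "\<exists>!P. prime_above F p P" using denominator_4[OF p nonresidue_odd[OF p 3(2)]] prime_above_inert[OF p 3(3,2)] by metis
    ultimately show ?thesis using 3 by blast
  next
    case 4
    have "\<not> (\<exists>!P. prime_above F p P)"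
    proof (cases "p = 2")
      case True
      then have od: "odd d" using 4 by simp
      have "d mod 4 = 1" using d_mod_4(1)[OF od] .
      moreover have "d mod 8 \<noteq> 5" using ex True unfolding cong_def by simp
      ultimately have "d mod 8 = 1" by presburger
      then show ?thesis using not_unique_two_if_split True by simp
    qed (use not_unique_if_residue p 4 in blast)
    then show ?thesis using 4 by blast
  qed
qed

end

section \<open>Well-roundedness\<close>

text \<open>For odd \<open>e\<close> and \<open>f\<close> the even vectors are those of \<open>2 D\<^sub>4\<close>, and the odd ones are glued to them. The coordinates \<open>e x, f y, z, w\<close> are those of elements of the ideal, in quarters: \<open>e\<close> and \<open>f\<close>
  are the divisors imposed on the first two of them.\<close>
definition glue_lattice :: "int \<Rightarrow> int \<Rightarrow> int \<Rightarrow> int \<Rightarrow> int \<Rightarrow> int \<Rightarrow> bool"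
  where "glue_lattice e f x y z w \<longleftrightarrow> (even x \<longleftrightarrow> even y) \<and> (even x \<longleftrightarrow> even z) \<and> (even z \<longleftrightarrow> even w) \<and> 4 dvd e * x + f * y + z + w"

definition diag_form :: "int \<Rightarrow> int \<Rightarrow> int \<Rightarrow> int \<Rightarrow> int \<Rightarrow> int \<Rightarrow> int \<Rightarrow> int"
  where "diag_form A B g x y z w = A * x\<^sup>2 + B * y\<^sup>2 + g * z\<^sup>2 + g * w\<^sup>2"

lemma glue_sign:
  fixes e f :: int
  assumes "odd e" "odd f"
  obtains \<eta> where "\<eta> = 1 \<or> \<eta> = - 1" "4 dvd e * \<eta> + f + 1 + 1"
proof -
  obtain e' f' where "e = 2 * e' + 1" "f = 2 * f' + 1" using assms by (meson oddE)
  then have "4 dvd e * 1 + f + 1 + 1 \<or> 4 dvd e * (- 1) + f + 1 + 1" by presburger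
  then show thesis using that by blast
qed

lemma scaled_square_bounds:
  fixes A x :: int
  assumes "A > 0"
  shows "A * x\<^sup>2 \<ge> 0" "x \<noteq> 0 \<Longrightarrow> A * x\<^sup>2 \<ge> A" "x \<noteq> 0 \<Longrightarrow> even x \<Longrightarrow> A * x\<^sup>2 \<ge> 4 * A"
proof -
  show "A * x\<^sup>2 \<ge> 0" using assms by simp
  assume x: "x \<noteq> 0"
  then have "1 \<le> x\<^sup>2" by (simp add: int_one_le_iff_zero_less)
  then show 1: "A * x\<^sup>2 \<ge> A" using assms mult_left_mono[of 1 "x\<^sup>2" A] by simp
  assume "even x"
  then obtain k where k: "x = 2 * k" by (rule evenE)
  then have "1 \<le> k\<^sup>2" using x by (simp add: int_one_le_iff_zero_less)
  then have "A * 4 \<le> A * x\<^sup>2" unfolding k using assms by (intro mult_left_mono) (simp_all add: power_mult_distrib)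
  then show "A * x\<^sup>2 \<ge> 4 * A" by simp
qed

text \<open>An odd vector has no zero coordinate. An even vector is \<open>2 v\<close> where \<open>v\<close> has an even number of odd
  coordinates: two coordinates of \<open>v\<close> are nonzero, or the only nonzero one is even.\<close>
lemma diag_form_bounds:
  assumes odd: "odd e" "odd f" and pos: "A > 0" "B > 0" "g > 0" and L: "glue_lattice e f x y z w"
  defines "M \<equiv> diag_form A B g x y z w" and "s \<equiv> A + B + 2 * g"
  shows "x \<noteq> 0 \<Longrightarrow> M \<ge> s \<or> M \<ge> 16 * A \<or> M \<ge> 4 * A + 4 * B \<or> M \<ge> 4 * A + 4 * g" (is "_ \<Longrightarrow> _ \<or> ?X")
    and "y \<noteq> 0 \<Longrightarrow> M \<ge> s \<or> M \<ge> 16 * B \<or> M \<ge> 4 * A + 4 * B \<or> M \<ge> 4 * B + 4 * g" (is "_ \<Longrightarrow> _ \<or> ?Y")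
    and "z \<noteq> 0 \<or> w \<noteq> 0 \<Longrightarrow> M \<ge> s \<or> M \<ge> 16 * g \<or> M \<ge> 4 * A + 4 * g \<or> M \<ge> 4 * B + 4 * g \<or> M \<ge> 8 * g"
      (is "_ \<Longrightarrow> _ \<or> ?Z")
proof -
  note b = scaled_square_bounds
  have par: "even x \<longleftrightarrow> even y" "even x \<longleftrightarrow> even z" "even z \<longleftrightarrow> even w" and s4: "4 dvd e * x + f * y + z + w"
    using L unfolding glue_lattice_def by auto
  have "M \<ge> s \<or> ((x \<noteq> 0 \<longrightarrow> ?X) \<and> (y \<noteq> 0 \<longrightarrow> ?Y) \<and> (z \<noteq> 0 \<or> w \<noteq> 0 \<longrightarrow> ?Z))"
  proof (cases "even x")
    case False
    then have "x \<noteq> 0" "y \<noteq> 0" "z \<noteq> 0" "w \<noteq> 0" using par by auto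
    then have "A * x\<^sup>2 \<ge> A" "B * y\<^sup>2 \<ge> B" "g * z\<^sup>2 \<ge> g" "g * w\<^sup>2 \<ge> g" using b(2) pos by blast+
    then have "M \<ge> s" unfolding M_def s_def diag_form_def by linarith
    then show ?thesis by blast
  next
    case True
    then have "even y" "even z" "even w" using par by auto
    then obtain x' y' z' w' where h: "x = 2 * x'" "y = 2 * y'" "z = 2 * z'" "w = 2 * w'" using True by (meson evenE)
    have sum: "e * x + f * y + z + w = 2 * (e * x' + f * y' + z' + w')" unfolding h by (simp add: algebra_simps)
    have half: "even k" if "4 dvd 2 * k" for k :: int using that by presburger
    have "even (e * x' + f * y' + z' + w')" by (rule half[OF s4[unfolded sum]])
    then have par': "even x' \<longleftrightarrow> (even y' \<longleftrightarrow> (even z' \<longleftrightarrow> even w'))" using odd by auto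
    have M: "M = 4 * (A * x'\<^sup>2) + 4 * (B * y'\<^sup>2) + 4 * (g * z'\<^sup>2) + 4 * (g * w'\<^sup>2)"
      unfolding M_def diag_form_def h by (simp add: power_mult_distrib)
    have nn: "A * x'\<^sup>2 \<ge> 0" "B * y'\<^sup>2 \<ge> 0" "g * z'\<^sup>2 \<ge> 0" "g * w'\<^sup>2 \<ge> 0" using b(1) pos by blast+
    note 1 = b(2)[OF pos(1), of x'] b(2)[OF pos(2), of y'] b(2)[OF pos(3), of z'] b(2)[OF pos(3), of w']
    note 4 = b(3)[OF pos(1), of x'] b(3)[OF pos(2), of y'] b(3)[OF pos(3), of z'] b(3)[OF pos(3), of w']
    have two_xy: "M \<ge> 4 * A + 4 * B" if "x' \<noteq> 0" "y' \<noteq> 0"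
      using 1(1)[OF that(1)] 1(2)[OF that(2)] nn unfolding M by linarith
    have two_xz: "M \<ge> 4 * A + 4 * g" if "x' \<noteq> 0" "z' \<noteq> 0"
      using 1(1)[OF that(1)] 1(3)[OF that(2)] nn unfolding M by linarith
    have two_xw: "M \<ge> 4 * A + 4 * g" if "x' \<noteq> 0" "w' \<noteq> 0"
      using 1(1)[OF that(1)] 1(4)[OF that(2)] nn unfolding M by linarith
    have two_yz: "M \<ge> 4 * B + 4 * g" if "y' \<noteq> 0" "z' \<noteq> 0"
      using 1(2)[OF that(1)] 1(3)[OF that(2)] nn unfolding M by linarith
    have two_yw: "M \<ge> 4 * B + 4 * g" if "y' \<noteq> 0" "w' \<noteq> 0"
      using 1(2)[OF that(1)] 1(4)[OF that(2)] nn unfolding M by linarith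
    have two_zw: "M \<ge> 8 * g" if "z' \<noteq> 0" "w' \<noteq> 0"
      using 1(3)[OF that(1)] 1(4)[OF that(2)] nn unfolding M by linarith
    have one_x: "M \<ge> 16 * A" if "x' \<noteq> 0" "even x'"
      using 4(1)[OF that] nn unfolding M by linarith
    have one_y: "M \<ge> 16 * B" if "y' \<noteq> 0" "even y'"
      using 4(2)[OF that] nn unfolding M by linarith
    have one_z: "M \<ge> 16 * g" if "z' \<noteq> 0" "even z'"
      using 4(3)[OF that] nn unfolding M by linarith
    have one_w: "M \<ge> 16 * g" if "w' \<noteq> 0" "even w'"
      using 4(4)[OF that] nn unfolding M by linarith
    have o: "odd u \<Longrightarrow> u \<noteq> 0" for u :: int by auto
    have X: ?X if "x' \<noteq> 0"
      using one_x two_xy two_xz two_xw par' o[of y'] o[of z'] o[of w'] that by blast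
    have Y: ?Y if "y' \<noteq> 0"
      using one_y two_xy two_yz two_yw par' o[of x'] o[of z'] o[of w'] that by blast
    have Z: ?Z if "z' \<noteq> 0"
      using one_z two_xz two_yz two_zw par' o[of x'] o[of y'] o[of w'] that by blast
    have W: ?Z if "w' \<noteq> 0"
      using one_w two_xw two_yw two_zw par' o[of x'] o[of y'] o[of z'] that by blast
    have "x \<noteq> 0 \<longleftrightarrow> x' \<noteq> 0" "y \<noteq> 0 \<longleftrightarrow> y' \<noteq> 0" "z \<noteq> 0 \<longleftrightarrow> z' \<noteq> 0" "w \<noteq> 0 \<longleftrightarrow> w' \<noteq> 0"
      unfolding h by simp_all
    then show ?thesis using X Y Z W by blast
  qed
  then show "x \<noteq> 0 \<Longrightarrow> M \<ge> s \<or> ?X" "y \<noteq> 0 \<Longrightarrow> M \<ge> s \<or> ?Y" "z \<noteq> 0 \<or> w \<noteq> 0 \<Longrightarrow> M \<ge> s \<or> ?Z"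
    by blast+
qed

context cyclic_quartic begin

definition quarter_glued :: "int \<Rightarrow> int \<Rightarrow> complex set \<Rightarrow> bool"
  where "quarter_glued e f I \<longleftrightarrow> (\<forall>x y z w. E x y z w \<in> I \<longleftrightarrow>
    (\<exists>x' y' z' w'. x = of_int (e * x') / 4 \<and> y = of_int (f * y') / 4 \<and> z = of_int z' / 4 \<and> w = of_int w' / 4 \<and>
      glue_lattice e f x' y' z' w'))"

definition "quarter_basis \<longleftrightarrow> odd d \<and> even b \<and> (a + b) mod 4 = 1"

lemma abs_ad_pos: "\<bar>a\<bar> * d > 0" using a_nz d_ge_2 by simp

lemma minimal_le:
  "minimal I x y z w \<Longrightarrow> E x' y' z' w' \<in> I \<Longrightarrow> x' \<noteq> 0 \<or> y' \<noteq> 0 \<or> z' \<noteq> 0 \<or> w' \<noteq> 0 \<Longrightarrow> qf x y z w \<le> qf x' y' z' w'"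
  unfolding minimal_def E_0_iff by blast

lemma minimal_unique:
  "minimal I x y z w \<Longrightarrow> minimal I x' y' z' w' \<Longrightarrow> qf x y z w = qf x' y' z' w'"
  unfolding minimal_def by (meson order_antisym)

lemma qf_quarter:
  "qf (of_int (e * x) / 4) (of_int (f * y) / 4) (of_int z / 4) (of_int w / 4)
    = of_int (diag_form (e\<^sup>2) (d * f\<^sup>2) (\<bar>a\<bar> * d) x y z w) / 16"
  unfolding qf_def diag_form_def by (simp add: field_simps power2_eq_square)

text \<open>Here \<open>M\<close> is 16 times the minimal value of the form. The upper bounds come from one odd vector and the
  short even ones, the lower bounds from minimal vectors with a nonzero first, second and third
  coordinate.\<close>
lemma glue_necessary:
  assumes I: "I \<subseteq> F" and wr: "well_rounded_ideal F I" and odd: "odd e" "odd f" and ef: "e \<noteq> 0" "f \<noteq> 0"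
    and glued: "quarter_glued e f I"
  defines "A \<equiv> e\<^sup>2" and "B \<equiv> d * f\<^sup>2" and "g \<equiv> \<bar>a\<bar> * d"
  obtains M where "M \<le> A + B + 2 * g" "M \<le> 16 * A" "M \<le> 16 * B" "M \<le> 4 * A + 4 * B" "M \<le> 4 * A + 4 * g" "M \<le> 4 * B + 4 * g" "M \<le> 8 * g"
    and "M \<ge> A + B + 2 * g \<or> M \<ge> 16 * A \<or> M \<ge> 4 * A + 4 * B \<or> M \<ge> 4 * A + 4 * g"
    and "M \<ge> A + B + 2 * g \<or> M \<ge> 16 * B \<or> M \<ge> 4 * A + 4 * B \<or> M \<ge> 4 * B + 4 * g"
    and "M \<ge> A + B + 2 * g \<or> M \<ge> 16 * g \<or> M \<ge> 4 * A + 4 * g \<or> M \<ge> 4 * B + 4 * g \<or> M \<ge> 8 * g"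
proof -
  note mem = glued[unfolded quarter_glued_def, rule_format]
  have pos: "A > 0" "B > 0" "g > 0" unfolding A_def B_def g_def using ef abs_ad_pos d_ge_2 by simp_all
  note bounds = diag_form_bounds[OF odd pos]
  obtain x1 y1 z1 w1 where m1: "minimal I x1 y1 z1 w1" "x1 \<noteq> 0" using well_rounded_coordinates(1)[OF I wr] by blast
  obtain x2 y2 z2 w2 where m2: "minimal I x2 y2 z2 w2" "y2 \<noteq> 0" using well_rounded_coordinates(2)[OF I wr] by blast
  obtain x3 y3 z3 w3 where m3: "minimal I x3 y3 z3 w3" "z3 \<noteq> 0" using well_rounded_coordinates(3)[OF I wr] by blast
  have vec: "\<exists>x' y' z' w'. glue_lattice e f x' y' z' w' \<and> 16 * qf x1 y1 z1 w1 = of_int (diag_form A B g x' y' z' w')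
      \<and> (x \<noteq> 0 \<longrightarrow> x' \<noteq> 0) \<and> (y \<noteq> 0 \<longrightarrow> y' \<noteq> 0) \<and> (z \<noteq> 0 \<longrightarrow> z' \<noteq> 0)" if "minimal I x y z w" for x y z w
  proof -
    have "E x y z w \<in> I" using that unfolding minimal_def by blast
    then obtain x' y' z' w' where c: "x = of_int (e * x') / 4" "y = of_int (f * y') / 4" "z = of_int z' / 4" "w = of_int w' / 4"
      and L: "glue_lattice e f x' y' z' w'" unfolding mem by blast
    have "16 * qf x y z w = of_int (diag_form A B g x' y' z' w')" unfolding c qf_quarter A_def B_def g_def by simp
    moreover have "qf x y z w = qf x1 y1 z1 w1" using minimal_unique[OF that m1(1)] .
    moreover have "x \<noteq> 0 \<longrightarrow> x' \<noteq> 0" "y \<noteq> 0 \<longrightarrow> y' \<noteq> 0" "z \<noteq> 0 \<longrightarrow> z' \<noteq> 0" unfolding c by auto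
    ultimately show ?thesis using L by metis
  qed
  obtain x1' y1' z1' w1' where v1: "x1' \<noteq> 0" "glue_lattice e f x1' y1' z1' w1'"
    "16 * qf x1 y1 z1 w1 = of_int (diag_form A B g x1' y1' z1' w1')" using vec[OF m1(1)] m1(2) by blast
  obtain x2' y2' z2' w2' where v2: "y2' \<noteq> 0" "glue_lattice e f x2' y2' z2' w2'"
    "16 * qf x1 y1 z1 w1 = of_int (diag_form A B g x2' y2' z2' w2')" using vec[OF m2(1)] m2(2) by blast
  obtain x3' y3' z3' w3' where v3: "z3' \<noteq> 0" "glue_lattice e f x3' y3' z3' w3'"
    "16 * qf x1 y1 z1 w1 = of_int (diag_form A B g x3' y3' z3' w3')" using vec[OF m3(1)] m3(2) by blast
  define M where "M = diag_form A B g x1' y1' z1' w1'"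
  have M2: "diag_form A B g x2' y2' z2' w2' = M" and M3: "diag_form A B g x3' y3' z3' w3' = M"
    using v2(3) v3(3) unfolding v1(3) M_def by (simp_all only: of_int_eq_iff)
  have le: "M \<le> diag_form A B g x y z w" if "glue_lattice e f x y z w" "x \<noteq> 0 \<or> y \<noteq> 0 \<or> z \<noteq> 0 \<or> w \<noteq> 0" for x y z w
  proof -
    have "E (of_int (e * x) / 4) (of_int (f * y) / 4) (of_int z / 4) (of_int w / 4) \<in> I" unfolding mem using that(1) by blast
    then have "qf x1 y1 z1 w1 \<le> qf (of_int (e * x) / 4) (of_int (f * y) / 4) (of_int z / 4) (of_int w / 4)"
      using minimal_le[OF m1(1)] that(2) ef by simp
    then have "16 * qf x1 y1 z1 w1 \<le> of_int (diag_form A B g x y z w)" unfolding qf_quarter A_def B_def g_def by simp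
    then have "(of_int M :: rat) \<le> of_int (diag_form A B g x y z w)" unfolding v1(3) M_def .
    then show ?thesis by (simp only: of_int_le_iff)
  qed
  have ev: "4 dvd 2 * k" if "even k" for k :: int using that by presburger
  obtain \<eta> where eta: "\<eta> = 1 \<or> \<eta> = - 1" "4 dvd e * \<eta> + f + 1 + 1" using glue_sign[OF odd] .
  have "glue_lattice e f \<eta> 1 1 1" unfolding glue_lattice_def using eta by auto
  then have t0: "M \<le> A + B + 2 * g" using le[of \<eta> 1 1 1] eta(1) by (auto simp: diag_form_def)
  have "glue_lattice e f 4 0 0 0" "glue_lattice e f 0 4 0 0" "glue_lattice e f 2 2 0 0" "glue_lattice e f 2 0 2 0"
    "glue_lattice e f 0 2 2 0" "glue_lattice e f 0 0 2 2"
    unfolding glue_lattice_def using ev[of "e + f"] ev[of "e + 1"] ev[of "f + 1"] odd by (simp_all add: algebra_simps)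
  then have "M \<le> 16 * A" "M \<le> 16 * B" "M \<le> 4 * A + 4 * B" "M \<le> 4 * A + 4 * g" "M \<le> 4 * B + 4 * g" "M \<le> 8 * g"
    using le[of 4 0 0 0] le[of 0 4 0 0] le[of 2 2 0 0] le[of 2 0 2 0] le[of 0 2 2 0] le[of 0 0 2 2]
    by (simp_all add: diag_form_def)
  moreover note v1(1) v2(1) v3(1)
  moreover note bounds(1)[OF v1(2), folded M_def] bounds(2)[OF v2(2), unfolded M2] bounds(3)[OF v3(2), unfolded M3]
  ultimately show thesis using that[of M] t0 by blast
qed

text \<open>If the odd vectors with coordinates \<open>\<plusminus>1\<close> are minimal, then changing two signs at a time yields four
  of them with the sign patterns of a Hadamard matrix.\<close>
lemma glue_sufficient:
  assumes I: "I \<subseteq> F" and odd: "odd e" "odd f" and ef: "e \<noteq> 0" "f \<noteq> 0"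
    and glued: "quarter_glued e f I"
  defines "A \<equiv> e\<^sup>2" and "B \<equiv> d * f\<^sup>2" and "g \<equiv> \<bar>a\<bar> * d"
  defines "s \<equiv> A + B + 2 * g"
  assumes ineq: "s \<le> 16 * A" "s \<le> 16 * B" "s \<le> 16 * g" "s \<le> 4 * A + 4 * B" "s \<le> 4 * A + 4 * g" "s \<le> 4 * B + 4 * g" "s \<le> 8 * g"
  shows "well_rounded_ideal F I"
proof -
  note mem = glued[unfolded quarter_glued_def, rule_format]
  have pos: "A > 0" "B > 0" "g > 0" unfolding A_def B_def g_def using ef abs_ad_pos d_ge_2 by simp_all
  note bounds = diag_form_bounds[OF odd pos]
  obtain \<eta> where eta: "\<eta> = 1 \<or> \<eta> = - 1" "4 dvd e * \<eta> + f + 1 + 1" using glue_sign[OF odd] .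
  have min: "minimal I (of_int (e * \<eta>) / 4) (of_int (f * y) / 4) (of_int z / 4) (of_int w / 4)"
    if yzw: "y = 1 \<or> y = - 1" "z = 1 \<or> z = - 1" "w = 1 \<or> w = - 1" and L: "4 dvd e * \<eta> + f * y + z + w" for y z w
    unfolding minimal_def
  proof (intro conjI allI impI)
    have "glue_lattice e f \<eta> y z w" unfolding glue_lattice_def using eta(1) yzw L by auto
    then show "E (of_int (e * \<eta>) / 4) (of_int (f * y) / 4) (of_int z / 4) (of_int w / 4) \<in> I"
      unfolding mem by (intro exI[of _ \<eta>] exI[of _ y] exI[of _ z] exI[of _ w] conjI refl)
    show "E (of_int (e * \<eta>) / 4) (of_int (f * y) / 4) (of_int z / 4) (of_int w / 4) \<noteq> 0"
      unfolding E_0_iff using yzw(2) by auto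
    fix x' y' z' w' assume v: "E x' y' z' w' \<in> I" "E x' y' z' w' \<noteq> 0"
    then obtain x2 y2 z2 w2 where c: "x' = of_int (e * x2) / 4" "y' = of_int (f * y2) / 4" "z' = of_int z2 / 4" "w' = of_int w2 / 4"
      "glue_lattice e f x2 y2 z2 w2" unfolding mem by blast
    have "x2 \<noteq> 0 \<or> y2 \<noteq> 0 \<or> z2 \<noteq> 0 \<or> w2 \<noteq> 0" using v(2) unfolding c E_0_iff by auto
    then consider "x2 \<noteq> 0" | "y2 \<noteq> 0" | "z2 \<noteq> 0 \<or> w2 \<noteq> 0" by blast
    then have "s \<le> diag_form A B g x2 y2 z2 w2"
    proof cases
      assume "x2 \<noteq> 0"
      from bounds(1)[OF c(5) this] show ?thesis unfolding s_def by (elim disjE) (use ineq[unfolded s_def] in linarith)+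
    next
      assume "y2 \<noteq> 0"
      from bounds(2)[OF c(5) this] show ?thesis unfolding s_def by (elim disjE) (use ineq[unfolded s_def] in linarith)+
    next
      assume "z2 \<noteq> 0 \<or> w2 \<noteq> 0"
      from bounds(3)[OF c(5) this] show ?thesis unfolding s_def by (elim disjE) (use ineq[unfolded s_def] in linarith)+
    qed
    moreover have "diag_form A B g \<eta> y z w = s"
      using eta(1) yzw unfolding diag_form_def s_def by auto
    ultimately have "diag_form A B g \<eta> y z w \<le> diag_form A B g x2 y2 z2 w2" by simp
    then show "qf (of_int (e * \<eta>) / 4) (of_int (f * y) / 4) (of_int z / 4) (of_int w / 4) \<le> qf x' y' z' w'"
      unfolding c qf_quarter A_def B_def g_def by (simp add: divide_right_mono)
  qed
  have signs: "4 dvd t + f * 1 + 1 + 1 \<and> 4 dvd t + f * 1 + - 1 + - 1 \<and> 4 dvd t + f * (- 1) + 1 + - 1 \<and> 4 dvd t + f * (- 1) + - 1 + 1"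
    if "4 dvd t + f + 1 + 1" for t using that odd(2) by presburger
  note L = signs[OF eta(2)]
  have ne: "of_int (e * \<eta>) / 4 \<noteq> (0::rat)" "of_int (f * 1) / 4 \<noteq> (0::rat)" "of_int 1 / 4 \<noteq> (0::rat)"
    using eta(1) ef by auto
  have neg: "of_int (f * - 1) / 4 = - (of_int (f * 1) / 4 :: rat)" "of_int (- 1) / 4 = - (of_int 1 / 4 :: rat)" by simp_all
  show ?thesis
  proof (rule well_rounded_if_sign_changes[OF I ne(1,2,3,3)])
    show "minimal I (of_int (e * \<eta>) / 4) (of_int (f * 1) / 4) (of_int 1 / 4) (of_int 1 / 4)"
      using min[of 1 1 1] L by blast
    show "minimal I (of_int (e * \<eta>) / 4) (of_int (f * 1) / 4) (- (of_int 1 / 4)) (- (of_int 1 / 4))"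
      using min[of 1 "- 1" "- 1"] L unfolding neg by blast
    show "minimal I (of_int (e * \<eta>) / 4) (- (of_int (f * 1) / 4)) (of_int 1 / 4) (- (of_int 1 / 4))"
      using min[of "- 1" 1 "- 1"] L unfolding neg by blast
    show "minimal I (of_int (e * \<eta>) / 4) (- (of_int (f * 1) / 4)) (- (of_int 1 / 4)) (of_int 1 / 4)"
      using min[of "- 1" "- 1" 1] L unfolding neg by blast
  qed
qed

lemma quarter_members:
  assumes G: quarter_basis and t: "Em 4 i j k l = E x y z w"
  shows "algebraic_int (E x y z w) \<longleftrightarrow> (even i \<longleftrightarrow> even j) \<and> (even i \<longleftrightarrow> even k) \<and> (even k \<longleftrightarrow> even l) \<and> 4 dvd i + j + k + l"
proof
  have g: "even b" "odd d" "(a + b) mod 4 = 1" using G unfolding quarter_basis_def by auto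
  have t': "E x y z w = E (of_int i / 4) (of_int j / 4) (of_int k / 4) (of_int l / 4)" using t unfolding Em_def by simp
  show "(even i \<longleftrightarrow> even j) \<and> (even i \<longleftrightarrow> even k) \<and> (even k \<longleftrightarrow> even l) \<and> 4 dvd i + j + k + l \<Longrightarrow> algebraic_int (E x y z w)"
    unfolding t' using integers_quarter[OF g] by blast
  assume al: "algebraic_int (E x y z w)"
  have co: "x = of_int i / 4" "y = of_int j / 4" "z = of_int k / 4" "w = of_int l / 4" using E_inject[OF t'] by auto
  obtain i' j' k' l' where p: "x = of_int i' / 4" "y = of_int j' / 4" "z = of_int k' / 4" "w = of_int l' / 4"
    "even i' \<longleftrightarrow> even j'" "even i' \<longleftrightarrow> even k'" "even k' \<longleftrightarrow> even l'" "4 dvd i' + j' + k' + l'"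
    using integers_b_even[OF g(1,2) al] by metis
  have "i' = i" "j' = j" "k' = k" "l' = l" using p(1-4) unfolding co by simp_all
  then show "(even i \<longleftrightarrow> even j) \<and> (even i \<longleftrightarrow> even k) \<and> (even k \<longleftrightarrow> even l) \<and> 4 dvd i + j + k + l" using p by blast
qed

lemma norm_ideal_quarter_glued:
  assumes G: quarter_basis and ef: "odd e" "odd f"
    and norm: "\<And>i j k l. int p dvd norm4 i j k l \<longleftrightarrow> e dvd i \<and> f dvd j"
  shows "quarter_glued e f (norm_ideal 4 p)"
  unfolding quarter_glued_def
proof (intro allI iffI)
  fix x y z w
  assume "E x y z w \<in> norm_ideal 4 p"
  then obtain i j k l where t: "E x y z w \<in> \<O>" "E x y z w = Em 4 i j k l" "e dvd i" "f dvd j"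
    unfolding norm_ideal_def norm by blast
  obtain i' j' where h: "i = e * i'" "j = f * j'" using t(3,4) by (auto elim!: dvdE)
  have co: "x = of_int i / 4" "y = of_int j / 4" "z = of_int k / 4" "w = of_int l / 4"
    using E_inject[OF t(2)[unfolded Em_def]] by auto
  have "(even i \<longleftrightarrow> even j) \<and> (even i \<longleftrightarrow> even k) \<and> (even k \<longleftrightarrow> even l) \<and> 4 dvd i + j + k + l"
    using t(1) quarter_members[OF G t(2)[symmetric]] by blast
  then have "glue_lattice e f i' j' k l" unfolding glue_lattice_def h using ef by auto
  then show "\<exists>x' y' z' w'. x = of_int (e * x') / 4 \<and> y = of_int (f * y') / 4 \<and>
      z = of_int z' / 4 \<and> w = of_int w' / 4 \<and> glue_lattice e f x' y' z' w'" using co unfolding h by blast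
next
  fix x y z w :: rat
  assume "\<exists>x' y' z' w'. x = of_int (e * x') / 4 \<and> y = of_int (f * y') / 4 \<and>
      z = of_int z' / 4 \<and> w = of_int w' / 4 \<and> glue_lattice e f x' y' z' w'"
  then obtain x' y' z' w' where c: "x = of_int (e * x') / 4" "y = of_int (f * y') / 4"
      "z = of_int z' / 4" "w = of_int w' / 4" and L: "glue_lattice e f x' y' z' w'" by blast
  have t: "Em 4 (e * x') (f * y') z' w' = E x y z w" unfolding Em_def c by simp
  have "algebraic_int (E x y z w)" unfolding quarter_members[OF G t] using L ef unfolding glue_lattice_def by auto
  moreover have "int p dvd norm4 (e * x') (f * y') z' w'" unfolding norm by simp
  moreover have "E x y z w \<in> F" by (rule E_in_F)
  ultimately show "E x y z w \<in> norm_ideal 4 p" unfolding norm_ideal_def using t[symmetric] by blast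
qed

lemma norm_ideal_subset: "norm_ideal m p \<subseteq> F" unfolding norm_ideal_def by blast

lemma odd_d_ge_5: "odd d \<Longrightarrow> d \<ge> 5"
  using d_mod_4(1) d_ge_2 by presburger

text \<open>If the odd vectors were not minimal, \<open>M\<close> would be below their length, which the lower bounds along the
  first and third axis exclude. So \<open>M\<close> is the length of the odd vectors; being at most \<open>16 d\<close> and \<open>4 (p\<^sup>2 + d)\<close> it bounds \<open>\<bar>a\<bar>\<close> by 6.\<close>
theorem well_rounded_ramified_quarter:
  assumes G: quarter_basis and p: "prime p" "int p dvd d" and P: "prime_above F p P"
  shows "well_rounded_ideal F P \<longleftrightarrow>
    \<bar>a\<bar> = 1 \<and> d \<le> 5 * (int p)\<^sup>2 \<and> (int p)\<^sup>2 \<le> 5 * d \<or> \<bar>a\<bar> = 3 \<and> d \<le> (int p)\<^sup>2 \<and> (int p)\<^sup>2 \<le> 9 * d \<or>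
    \<bar>a\<bar> = 5 \<and> 7 * d \<le> 3 * (int p)\<^sup>2 \<and> (int p)\<^sup>2 \<le> 5 * d" (is "_ \<longleftrightarrow> ?R")
proof -
  have od: "odd d" using G unfolding quarter_basis_def by blast
  have p2: "p \<noteq> 2" using p(2) od by auto
  have op: "odd (int p)" using prime_odd_nat[OF p(1)] p2 prime_ge_2_nat[OF p(1)] by simp
  have Pn: "P = norm_ideal 4 p" using prime_above_ramified[OF p denominator_4[OF p(1) p2]] P by blast
  have PF: "P \<subseteq> F" unfolding Pn by (rule norm_ideal_subset)
  have p0: "int p \<noteq> 0" using p(1) by auto
  have one: "odd (1::int)" "(1::int) \<noteq> 0" by simp_all
  have glued: "quarter_glued (int p) 1 P"
    unfolding Pn by (rule norm_ideal_quarter_glued[OF G op one(1)]) (simp add: norm4_dvd_ramified[OF p])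
  define Q where "Q = (int p)\<^sup>2"
  define g where "g = \<bar>a\<bar> * d"
  have d0: "d > 0" using d_ge_2 by simp
  have a1: "\<bar>a\<bar> \<ge> 1" using a_nz by simp
  then have gd: "g \<ge> d" unfolding g_def using d0 mult_right_mono[of 1 "\<bar>a\<bar>" d] by simp
  have Q0: "Q > 0" unfolding Q_def using p0 by simp
  show ?thesis
  proof
    assume wr: "well_rounded_ideal F P"
    obtain M where M: "M \<le> Q + d + 2 * g" "M \<le> 16 * Q" "M \<le> 16 * d" "M \<le> 4 * Q + 4 * d" "M \<le> 4 * Q + 4 * g" "M \<le> 4 * d + 4 * g" "M \<le> 8 * g"
      and x: "M \<ge> Q + d + 2 * g \<or> M \<ge> 16 * Q \<or> M \<ge> 4 * Q + 4 * d \<or> M \<ge> 4 * Q + 4 * g"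
      and y: "M \<ge> Q + d + 2 * g \<or> M \<ge> 16 * d \<or> M \<ge> 4 * Q + 4 * d \<or> M \<ge> 4 * d + 4 * g"
      and z: "M \<ge> Q + d + 2 * g \<or> M \<ge> 16 * g \<or> M \<ge> 4 * Q + 4 * g \<or> M \<ge> 4 * d + 4 * g \<or> M \<ge> 8 * g"
      using glue_necessary[OF PF wr op one(1) p0 one(2) glued, folded Q_def g_def] by (simp only: power_one mult_1_right) blast
    have s: "M = Q + d + 2 * g"
    proof (rule ccontr)
      assume "M \<noteq> Q + d + 2 * g"
      then have lt: "M < Q + d + 2 * g" using M(1) by simp
      have x': "M \<ge> 16 * Q \<or> M \<ge> 4 * Q + 4 * d"
        using x
      proof (elim disjE)
        assume "M \<ge> 4 * Q + 4 * g"
        then have "M \<ge> 4 * Q + 4 * d" using gd by linarith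
        then show ?thesis ..
      qed (use lt in simp_all)
      from z show False
      proof (elim disjE)
        assume "M \<ge> Q + d + 2 * g" then show False using lt by linarith
      next
        assume "M \<ge> 16 * g" then show False using M(7) gd d0 by linarith
      next
        assume "M \<ge> 4 * Q + 4 * g" then show False using lt gd Q0 d0 by linarith
      next
        assume "M \<ge> 4 * d + 4 * g"
        from x' show False by (rule disjE) (use \<open>M \<ge> 4 * d + 4 * g\<close> lt gd Q0 d0 in linarith)+
      next
        assume "M \<ge> 8 * g"
        from x' show False by (rule disjE) (use \<open>M \<ge> 8 * g\<close> lt gd Q0 d0 in linarith)+
      qed
    qed
    have "\<bar>a\<bar> < 7"
    proof (rule ccontr)
      assume "\<not> \<bar>a\<bar> < 7"
      then have "g \<ge> 7 * d" unfolding g_def using d0 mult_right_mono[of 7 "\<bar>a\<bar>" d] by simp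
      then show False using M s d0 by linarith
    qed
    moreover have "odd \<bar>a\<bar>" using odd_a by simp
    ultimately have "\<bar>a\<bar> = 1 \<or> \<bar>a\<bar> = 3 \<or> \<bar>a\<bar> = 5" using a1 by presburger
    then show ?R
    proof (elim disjE)
      assume a: "\<bar>a\<bar> = 1"
      then have "g = d" unfolding g_def by simp
      then show ?R unfolding Q_def[symmetric] using a M s by simp
    next
      assume a: "\<bar>a\<bar> = 3"
      then have "g = 3 * d" unfolding g_def by simp
      then show ?R unfolding Q_def[symmetric] using a M s by simp
    next
      assume a: "\<bar>a\<bar> = 5"
      then have "g = 5 * d" unfolding g_def by simp
      then show ?R unfolding Q_def[symmetric] using a M s by simp
    qed
  next
    assume R: ?R
    have "g = d \<and> d \<le> 5 * Q \<and> Q \<le> 5 * d \<or> g = 3 * d \<and> d \<le> Q \<and> Q \<le> 9 * d \<or> g = 5 * d \<and> 7 * d \<le> 3 * Q \<and> Q \<le> 5 * d"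
      using R unfolding Q_def g_def by auto
    then have "Q + d + 2 * g \<le> 16 * Q \<and> Q + d + 2 * g \<le> 16 * d \<and> Q + d + 2 * g \<le> 16 * g \<and> Q + d + 2 * g \<le> 4 * Q + 4 * d \<and>
      Q + d + 2 * g \<le> 4 * Q + 4 * g \<and> Q + d + 2 * g \<le> 4 * d + 4 * g \<and> Q + d + 2 * g \<le> 8 * g"
      using d0 Q0 by (elim disjE conjE) (intro conjI; linarith)+
    then show "well_rounded_ideal F P"
      using glue_sufficient[OF PF op one(1) p0 one(2) glued, folded Q_def g_def] by simp
  qed
qed

text \<open>The second axis has weight \<open>d p\<^sup>2\<close> with \<open>d \<ge> 5\<close>, so an even vector with a nonzero second coordinate is
  longer than \<open>p\<close>, and a minimal one is odd. Its length, compared with the even vectors, gives \<open>d < 13\<close>.\<close>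
theorem well_rounded_semiramified_quarter:
  assumes G: quarter_basis and p: "prime p" "int p dvd a" "\<not> QuadRes (int p) d" and P: "prime_above F p P"
  shows "well_rounded_ideal F P \<longleftrightarrow> d = 5 \<and> \<bar>a\<bar> \<le> (int p)\<^sup>2 \<and> (int p)\<^sup>2 \<le> 5 * \<bar>a\<bar>"
proof -
  have od: "odd d" using G unfolding quarter_basis_def by blast
  have p2: "p \<noteq> 2" using nonresidue_odd[OF p(1,3)] .
  have op: "odd (int p)" using prime_odd_nat[OF p(1)] p2 prime_ge_2_nat[OF p(1)] by simp
  have Pn: "P = norm_ideal 4 p" using prime_above_semiramified[OF p denominator_4[OF p(1) p2]] P by blast
  have PF: "P \<subseteq> F" unfolding Pn by (rule norm_ideal_subset)
  have p0: "int p \<noteq> 0" using p(1) by auto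
  have glued: "quarter_glued (int p) (int p) P"
    unfolding Pn by (rule norm_ideal_quarter_glued[OF G op op norm4_dvd_semiramified[OF p]])
  define Q where "Q = (int p)\<^sup>2"
  define g where "g = \<bar>a\<bar> * d"
  define B where "B = d * Q"
  have d5: "d \<ge> 5" using odd_d_ge_5[OF od] .
  have a1: "\<bar>a\<bar> \<ge> 1" using a_nz by simp
  have Q0: "Q > 0" unfolding Q_def using p0 by simp
  have B5: "B \<ge> 5 * Q" unfolding B_def using d5 Q0 mult_right_mono[of 5 d Q] by simp
  have g0: "g > 0" unfolding g_def using abs_ad_pos .
  show ?thesis
  proof
    assume wr: "well_rounded_ideal F P"
    obtain M where M: "M \<le> Q + B + 2 * g" "M \<le> 16 * Q" "M \<le> 16 * B" "M \<le> 4 * Q + 4 * B" "M \<le> 4 * Q + 4 * g" "M \<le> 4 * B + 4 * g" "M \<le> 8 * g"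
      and y: "M \<ge> Q + B + 2 * g \<or> M \<ge> 16 * B \<or> M \<ge> 4 * Q + 4 * B \<or> M \<ge> 4 * B + 4 * g"
      using glue_necessary[OF PF wr op op p0 p0 glued, folded Q_def g_def, folded B_def] by blast
    from y have s: "M = Q + B + 2 * g"
      by (elim disjE) (use M B5 Q0 g0 in linarith)+
    have "d < 13"
    proof (rule ccontr)
      assume "\<not> d < 13"
      then have "B \<ge> 13 * Q" unfolding B_def using Q0 mult_right_mono[of 13 d Q] by simp
      then show False using M s Q0 by linarith
    qed
    moreover have "d \<noteq> 9"
    proof
      assume "d = 9"
      then have "(3::int)\<^sup>2 dvd d" by simp
      then have "(3::int) dvd 1" using squarefree_d unfolding squarefree_def by blast
      then show False by simp
    qed
    ultimately have d: "d = 5" using d5 d_mod_4(1)[OF od] by presburger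
    then have "B = 5 * Q" "g = 5 * \<bar>a\<bar>" unfolding B_def g_def by simp_all
    then show "d = 5 \<and> \<bar>a\<bar> \<le> (int p)\<^sup>2 \<and> (int p)\<^sup>2 \<le> 5 * \<bar>a\<bar>" unfolding Q_def[symmetric] using d M s by linarith
  next
    assume R: "d = 5 \<and> \<bar>a\<bar> \<le> (int p)\<^sup>2 \<and> (int p)\<^sup>2 \<le> 5 * \<bar>a\<bar>"
    then have e: "B = 5 * Q" "g = 5 * \<bar>a\<bar>" "\<bar>a\<bar> \<le> Q" "Q \<le> 5 * \<bar>a\<bar>" unfolding B_def g_def Q_def by simp_all
    have "Q + B + 2 * g \<le> 16 * Q" "Q + B + 2 * g \<le> 16 * B" "Q + B + 2 * g \<le> 16 * g" "Q + B + 2 * g \<le> 4 * Q + 4 * B"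
      "Q + B + 2 * g \<le> 4 * Q + 4 * g" "Q + B + 2 * g \<le> 4 * B + 4 * g" "Q + B + 2 * g \<le> 8 * g"
      using e a1 Q0 by linarith+
    then show "well_rounded_ideal F P"
      using glue_sufficient[OF PF op op p0 p0 glued, folded Q_def g_def, folded B_def] by blast
  qed
qed

text \<open>Outside the quarter case the \<open>K\<close>-part of an integer is itself an integer.\<close>
lemma not_quarter_coordinates:
  assumes nG: "\<not> quarter_basis" and al: "algebraic_int (E x y z w)"
  obtains m n where "x = of_int m / 2" "y = of_int n / 2" "even m \<longleftrightarrow> even n" "even d \<Longrightarrow> even n"
proof (cases "even d")
  case True
  then obtain m n i j where "x = of_int m" "y = of_int n" "z = of_int i" "w = of_int j" by (rule integers_d_even[OF _ al])
  then have "x = of_int (2 * m) / 2" "y = of_int (2 * n) / 2" by simp_all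
  then show thesis using that[of "2 * m" "2 * n"] by simp
next
  case od: False
  show thesis
  proof (cases "even b")
    case False
    then show thesis using integers_b_odd[OF od _ al] that od by metis
  next
    case True
    then have "(a + b) mod 4 = 3" using nG odd_a od unfolding quarter_basis_def by presburger
    then obtain m n where "x = of_int m / 4" "y = of_int n / 4" "even m" "4 dvd m + n"
      using integers_b_even[OF True od al] by metis
    moreover from this obtain m' where "m = 2 * m'" by (auto elim: evenE)
    moreover have "even n" using \<open>4 dvd m + n\<close> \<open>even m\<close> by presburger
    then obtain n' where "n = 2 * n'" by (auto elim: evenE)
    ultimately have "x = of_int m' / 2" "y = of_int n' / 2" "4 dvd 2 * m' + 2 * n'" by simp_all
    moreover from this have "even m' \<longleftrightarrow> even n'" by presburger
    ultimately show thesis using that[of m' n'] od by blast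
  qed
qed

lemma qf_lower: "qf x y z w \<ge> x\<^sup>2 + of_int d * y\<^sup>2" "qf x y z w \<ge> of_int (\<bar>a\<bar> * d) * (z\<^sup>2 + w\<^sup>2)"
proof -
  have "of_int (\<bar>a\<bar> * d) \<ge> (0::rat)" "of_int d \<ge> (0::rat)" using abs_ad_pos d_ge_2 by linarith+
  then have "of_int (\<bar>a\<bar> * d) * (z\<^sup>2 + w\<^sup>2) \<ge> 0" "x\<^sup>2 \<ge> 0" "of_int d * y\<^sup>2 \<ge> 0" by (simp_all del: of_int_mult)
  then show "qf x y z w \<ge> x\<^sup>2 + of_int d * y\<^sup>2" "qf x y z w \<ge> of_int (\<bar>a\<bar> * d) * (z\<^sup>2 + w\<^sup>2)" unfolding qf_def by linarith+
qed

text \<open>\<open>p\<close> lies in the ideal and is shorter than every element whose second coordinate is nonzero.\<close>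
theorem not_well_rounded_semiramified:
  assumes nG: "\<not> quarter_basis" and p: "prime p" "int p dvd a" "\<not> QuadRes (int p) d" and P: "prime_above F p P"
  shows "\<not> well_rounded_ideal F P"
proof
  assume wr: "well_rounded_ideal F P"
  note PD = prime_aboveD[OF P]
  have PF: "P \<subseteq> F" using PD(1) by blast
  have p2: "p \<noteq> 2" using nonresidue_odd[OF p(1,3)] .
  have Pn: "P = norm_ideal 4 p" using prime_above_semiramified[OF p denominator_4[OF p(1) p2]] P by blast
  have p': "prime (int p)" using p(1) by simp
  have op: "odd (int p)" using prime_odd_nat[OF p(1)] p2 prime_ge_2_nat[OF p(1)] by simp
  obtain x y z w where m: "minimal P x y z w" "y \<noteq> 0" using well_rounded_coordinates(2)[OF PF wr] by blast
  have t: "E x y z w \<in> P" using m unfolding minimal_def by blast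
  then obtain i j k l where e: "E x y z w = Em 4 i j k l" "int p dvd i" "int p dvd j"
    unfolding Pn norm_ideal_def norm4_dvd_semiramified[OF p] by blast
  have co: "x = of_int i / 4" "y = of_int j / 4" using E_inject[OF e(1)[unfolded Em_def]] by auto
  have al: "algebraic_int (E x y z w)" using t PD(1) by blast
  obtain m n where mn: "x = of_int m / 2" "y = of_int n / 2" "even m \<longleftrightarrow> even n" "even d \<Longrightarrow> even n"
    by (rule not_quarter_coordinates[OF nG al]) blast
  have "(of_int i :: rat) = of_int (2 * m)" "(of_int j :: rat) = of_int (2 * n)" using mn(1,2) unfolding co by simp_all
  then have "i = 2 * m" "j = 2 * n" by (simp_all only: of_int_eq_iff)
  moreover have "\<not> int p dvd 2" using p(1) p2 by (metis int_dvd_int_iff of_nat_numeral primes_dvd_imp_eq two_is_prime_nat)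
  ultimately have "int p dvd m" "int p dvd n" using e(2,3) p' by (auto simp: prime_dvd_mult_iff)
  then obtain m' n' where h: "m = int p * m'" "n = int p * n'" by (auto elim!: dvdE)
  have par: "even m' \<longleftrightarrow> even n'" "even d \<Longrightarrow> even n'" using mn(3,4) op unfolding h by simp_all
  have n0: "n' \<noteq> 0" using m(2) unfolding mn(2) h by auto
  define Q where "Q = (int p)\<^sup>2"
  have Q0: "Q > 0" unfolding Q_def using p(1) by (simp add: prime_gt_0_nat)
  have "qf x y z w \<le> qf (of_int (int p)) 0 0 0"
  proof (rule minimal_le[OF m(1)])
    have "E (of_int (int p)) 0 0 0 = of_nat p" by (simp add: ev_def)
    then show "E (of_int (int p)) 0 0 0 \<in> P" using PD(6) by simp
    show "of_int (int p) \<noteq> (0::rat) \<or> (0::rat) \<noteq> 0 \<or> (0::rat) \<noteq> 0 \<or> (0::rat) \<noteq> 0" using p(1) by auto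
  qed
  also have "\<dots> = of_int Q" unfolding qf_def Q_def by simp
  finally have "x\<^sup>2 + of_int d * y\<^sup>2 \<le> of_int Q" using qf_lower(1) order_trans by blast
  then have "of_int (Q * m'\<^sup>2 + d * Q * n'\<^sup>2) \<le> (of_int (4 * Q) :: rat)"
    unfolding mn(1,2) h Q_def by (simp add: field_simps power2_eq_square)
  then have le: "Q * m'\<^sup>2 + (d * Q) * n'\<^sup>2 \<le> 4 * Q" by (simp only: of_int_le_iff)
  have dQ: "d * Q \<ge> 2 * Q" using d_ge_2 Q0 mult_right_mono[of 2 d Q] by simp
  have dQ0: "d * Q > 0" using dQ Q0 by linarith
  show False
  proof (cases "even n'")
    case True
    then have "(d * Q) * n'\<^sup>2 \<ge> 4 * (d * Q)" using scaled_square_bounds(3)[OF dQ0 n0] by blast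
    moreover have "Q * m'\<^sup>2 \<ge> 0" using scaled_square_bounds(1)[OF Q0] .
    ultimately show False using le dQ Q0 by linarith
  next
    case False
    then have "odd m'" "odd d" using par by auto
    then have "m' \<noteq> 0" by auto
    have "d * Q \<ge> 5 * Q" using odd_d_ge_5[OF \<open>odd d\<close>] Q0 mult_right_mono[of 5 d Q] by simp
    moreover have "(d * Q) * n'\<^sup>2 \<ge> d * Q" using scaled_square_bounds(2)[OF dQ0 n0] .
    moreover have "Q * m'\<^sup>2 \<ge> Q" using scaled_square_bounds(2)[OF Q0 \<open>m' \<noteq> 0\<close>] .
    ultimately show False using le Q0 by linarith
  qed
qed

text \<open>The elements \<open>p\<close>, \<open>s\<close> and possibly \<open>(\<beta> + \<gamma>) / 2\<close> of the ideal bound the minimal length from above, minimal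
  vectors with a nonzero first, second or third coordinate from below. The bounds meet, and the
  resulting equations contradict that \<open>p\<close> divides \<open>d\<close> exactly once or that \<open>d\<close> is 1 modulo 4 if odd.\<close>
theorem not_well_rounded_ramified:
  assumes nG: "\<not> quarter_basis" and p: "prime p" "int p dvd d" and P: "prime_above F p P"
  shows "\<not> well_rounded_ideal F P"
proof
  assume wr: "well_rounded_ideal F P"
  note PD = prime_aboveD[OF P]
  have PF: "P \<subseteq> F" using PD(1) by blast
  have p': "prime (int p)" using p(1) by simp
  have alg: "algebraic_int (E x y z w)" if "minimal P x y z w" for x y z w
    using that PD(1) unfolding minimal_def by blast
  define Q where "Q = (int p)\<^sup>2"
  have Q0: "Q > 0" unfolding Q_def using p(1) by (simp add: prime_gt_0_nat)
  have d0: "d > 0" using d_ge_2 by simp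
  \<comment> \<open>\<open>e\<close> is prime to \<open>p\<close>; the equations below reduce to divisibility relations between \<open>p\<close> and \<open>e\<close>\<close>
  obtain e where e: "d = int p * e" using p(2) by (auto elim: dvdE)
  have pe: "\<not> int p dvd e"
  proof
    assume "int p dvd e"
    then have "(int p)\<^sup>2 dvd d" unfolding e power2_eq_square by (intro mult_dvd_mono) auto
    then have "int p dvd 1" using squarefree_d unfolding squarefree_def by blast
    then show False using p(1) by (simp add: prime_nat_iff)
  qed
  have e0: "e > 0" using d0 p(1) unfolding e by (simp add: zero_less_mult_iff)
  have sqfree_e: "squarefree e" using squarefree_d unfolding e by (metis dvd_triv_right squarefree_mono)
  have pp: "int p > 0" using p(1) by (simp add: prime_gt_0_nat)
  have le_d: "qf x y z w \<le> of_int d" if "minimal P x y z w" for x y z w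
  proof -
    have "qf x y z w \<le> qf 0 1 0 0"
      using minimal_le[OF that, of 0 1 0 0] basis_in_prime_ramified(1)[OF p P] E_basis(2) by simp
    then show ?thesis by (simp add: qf_def)
  qed
  have le_Q: "qf x y z w \<le> of_int Q" if "minimal P x y z w" for x y z w
  proof -
    have "E (of_int (int p)) 0 0 0 = of_nat p" by (simp add: ev_def)
    then have "qf x y z w \<le> qf (of_int (int p)) 0 0 0"
      using minimal_le[OF that, of "of_int (int p)" 0 0 0] PD(6) p(1) by simp
    then show ?thesis by (simp add: qf_def Q_def)
  qed
  obtain x1 y1 z1 w1 where m1: "minimal P x1 y1 z1 w1" "x1 \<noteq> 0" using well_rounded_coordinates(1)[OF PF wr] by blast
  obtain x2 y2 z2 w2 where m2: "minimal P x2 y2 z2 w2" "y2 \<noteq> 0" using well_rounded_coordinates(2)[OF PF wr] by blast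
  obtain x3 y3 z3 w3 where m3: "minimal P x3 y3 z3 w3" "z3 \<noteq> 0" using well_rounded_coordinates(3)[OF PF wr] by blast
  have t1: "E x1 y1 z1 w1 \<in> P" using m1 unfolding minimal_def by blast
  show False
  proof (cases "even d")
    case True
    \<comment> \<open>an orthogonal lattice: \<open>p\<close> and \<open>s\<close> would have to be equally long\<close>
    have Pn: "P = norm_ideal 1 p" using prime_above_ramified[OF p denominator_1[OF True]] P by blast
    obtain i j k l where t: "E x1 y1 z1 w1 = Em 1 i j k l" "int p dvd i"
      using t1 unfolding Pn norm_ideal_def norm4_dvd_ramified[OF p] by blast
    have xi: "x1 = of_int i" using E_inject[OF t(1)[unfolded Em_def]] by simp
    obtain i' where i': "i = int p * i'" using t(2) by (auto elim: dvdE)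
    have "i' \<noteq> 0" using m1(2) unfolding xi i' by auto
    then have "Q \<le> Q * i'\<^sup>2" using scaled_square_bounds(2)[OF Q0] by blast
    also have "\<dots> = i\<^sup>2" unfolding i' Q_def by (simp add: power_mult_distrib)
    finally have "(of_int Q :: rat) \<le> of_int (i\<^sup>2)" by (simp only: of_int_le_iff)
    also have "\<dots> \<le> x1\<^sup>2 + of_int d * y1\<^sup>2" unfolding xi using d0 by simp
    also have "\<dots> \<le> of_int d" using qf_lower(1) le_d[OF m1(1)] order_trans by blast
    finally have Qd: "Q \<le> d" by (simp only: of_int_le_iff)
    obtain m n i j where c2: "x2 = of_int m" "y2 = of_int n" by (rule integers_d_even[OF True alg[OF m2(1)]]) blast
    have "n \<noteq> 0" using m2(2) unfolding c2 by auto
    then have "d \<le> d * n\<^sup>2" using scaled_square_bounds(2)[OF d0] by blast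
    then have "(of_int d :: rat) \<le> of_int (d * n\<^sup>2)" by (simp only: of_int_le_iff)
    also have "\<dots> \<le> x2\<^sup>2 + of_int d * y2\<^sup>2" unfolding c2 by simp
    also have "\<dots> \<le> of_int Q" using qf_lower(1) le_Q[OF m2(1)] order_trans by blast
    finally have "d \<le> Q" by (simp only: of_int_le_iff)
    then have "d = Q" using Qd by simp
    then have "int p * e = int p * int p" unfolding Q_def power2_eq_square e .
    then have "e = int p" using pp by simp
    then show False using pe by simp
  next
    case od: False
    have p2: "p \<noteq> 2" using p(2) od by auto
    have Pn: "P = norm_ideal 4 p" using prime_above_ramified[OF p denominator_4[OF p(1) p2]] P by blast
    have p_2: "\<not> int p dvd 2" using p(1) p2 by (metis int_dvd_int_iff of_nat_numeral primes_dvd_imp_eq two_is_prime_nat)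
    have p_4: "\<not> int p dvd 4" using prime_dvd_mult_iff[OF p', of 2 2] p_2 by simp
    obtain i j k l where t: "E x1 y1 z1 w1 = Em 4 i j k l" "int p dvd i"
      using t1 unfolding Pn norm_ideal_def norm4_dvd_ramified[OF p] by blast
    have xi: "x1 = of_int i / 4" using E_inject[OF t(1)[unfolded Em_def]] by simp
    obtain m n where mn: "x1 = of_int m / 2" "y1 = of_int n / 2" by (rule not_quarter_coordinates[OF nG alg[OF m1(1)]]) blast
    have "(of_int i :: rat) = of_int (2 * m)" using mn(1) unfolding xi by simp
    then have "i = 2 * m" by (simp only: of_int_eq_iff)
    then have "int p dvd m" using t(2) p' p_2 by (auto simp: prime_dvd_mult_iff)
    then obtain m' where h: "m = int p * m'" by (auto elim: dvdE)
    have m0: "m' \<noteq> 0" using m1(2) unfolding mn(1) h by auto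
    have sq0: "int p * m'\<^sup>2 > 0" using pp m0 by simp
    have n_cases: "n = 0 \<or> n\<^sup>2 = 1 \<or> n\<^sup>2 \<ge> 4"
    proof -
      have "n = 0 \<or> n = 1 \<or> n = - 1 \<or> \<bar>n\<bar> \<ge> 2" by linarith
      moreover have "\<bar>n\<bar> \<ge> 2 \<Longrightarrow> n\<^sup>2 \<ge> 4" using power_mono[of 2 "\<bar>n\<bar>" 2] by simp
      ultimately show ?thesis by auto
    qed
    show False
    proof (cases "even b")
      case False
      \<comment> \<open>\<open>\<beta>\<close> and \<open>\<gamma>\<close> span the second summand: the minimal value is \<open>d\<close>, and \<open>4 d = p\<^sup>2 m'\<^sup>2 + d n\<^sup>2\<close> remains\<close>
      obtain i3 where i3: "z3 = of_int i3" by (rule integers_b_odd[OF od False alg[OF m3(1)]]) blast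
      have "i3 \<noteq> 0" using m3(2) i3 by auto
      obtain k1 l1 where c1: "z1 = of_int k1" "w1 = of_int l1" by (rule integers_b_odd[OF od False alg[OF m1(1)]]) blast
      have gd: "\<bar>a\<bar> * d \<ge> d" using a_nz d0 mult_right_mono[of 1 "\<bar>a\<bar>" d] by simp
      have "d \<le> (\<bar>a\<bar> * d) * i3\<^sup>2" using gd scaled_square_bounds(2)[OF abs_ad_pos \<open>i3 \<noteq> 0\<close>] by linarith
      then have "(of_int d :: rat) \<le> of_int ((\<bar>a\<bar> * d) * i3\<^sup>2)" by (simp only: of_int_le_iff)
      also have "\<dots> \<le> of_int (\<bar>a\<bar> * d) * (z3\<^sup>2 + w3\<^sup>2)"
        unfolding of_int_mult[of "\<bar>a\<bar> * d"] i3 using abs_ad_pos by (intro mult_left_mono) (simp_all del: of_int_mult)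
      also have "\<dots> \<le> qf x3 y3 z3 w3" by (rule qf_lower(2))
      also have "\<dots> = qf x1 y1 z1 w1" by (rule minimal_unique[OF m3(1) m1(1)])
      finally have "qf x1 y1 z1 w1 = of_int d" using le_d[OF m1(1)] by simp
      then have "of_int ((int p)\<^sup>2 * m'\<^sup>2 + d * n\<^sup>2 + 4 * (\<bar>a\<bar> * d * (k1\<^sup>2 + l1\<^sup>2))) = (of_int (4 * d) :: rat)"
        unfolding qf_def mn h c1 by (simp add: field_simps power2_eq_square)
      then have eq: "(int p)\<^sup>2 * m'\<^sup>2 + d * n\<^sup>2 + 4 * (\<bar>a\<bar> * d * (k1\<^sup>2 + l1\<^sup>2)) = 4 * d" by (simp only: of_int_eq_iff)
      have "k1\<^sup>2 + l1\<^sup>2 = 0"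
      proof (rule ccontr)
        assume "k1\<^sup>2 + l1\<^sup>2 \<noteq> 0"
        then have "k1\<^sup>2 + l1\<^sup>2 \<ge> 1" using sum_power2_ge_zero[of k1 l1] by linarith
        then have "\<bar>a\<bar> * d * (k1\<^sup>2 + l1\<^sup>2) \<ge> \<bar>a\<bar> * d" using abs_ad_pos mult_left_mono[of 1 "k1\<^sup>2 + l1\<^sup>2" "\<bar>a\<bar> * d"] by simp
        moreover have "(int p)\<^sup>2 * m'\<^sup>2 > 0" using pp m0 by simp
        moreover have "d * n\<^sup>2 \<ge> 0" using d0 by simp
        ultimately show False using eq gd by linarith
      qed
      then have "int p * (int p * m'\<^sup>2 + e * n\<^sup>2) = int p * (4 * e)" using eq unfolding e by (simp add: power2_eq_square algebra_simps)
      then have eq': "int p * m'\<^sup>2 + e * n\<^sup>2 = 4 * e" using pp by simp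
      from n_cases show False
      proof (elim disjE)
        assume "n = 0"
        then have "int p dvd 4 * e" using eq' by (metis add_0_right dvd_triv_left mult_zero_right power_zero_numeral)
        then show False using p' p_4 pe prime_dvd_mult_iff by blast
      next
        assume "n\<^sup>2 = 1"
        then have eq3: "int p * m'\<^sup>2 = 3 * e" using eq' by simp
        then have "int p dvd 3 * e" by (metis dvd_triv_left)
        then have "int p dvd int 3" using p' pe prime_dvd_mult_iff[OF p', of 3 e] by simp
        then have "p dvd 3" unfolding int_dvd_int_iff .
        then have "p \<le> 3" by (rule dvd_imp_le) simp
        then have p3: "p = 3" using p2 prime_ge_2_nat[OF p(1)] by linarith
        then have "m'\<^sup>2 = e" using eq3 by simp
        then have "m'\<^sup>2 dvd e" by simp
        then have "m' dvd 1" using sqfree_e unfolding squarefree_def by blast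
        then have "\<bar>m'\<bar> = 1" by simp
        then have "m'\<^sup>2 = 1" by (metis one_power2 power2_abs)
        then have "e = 1" using \<open>m'\<^sup>2 = e\<close> by simp
        then have "d = 3" using e p3 by simp
        then show False using d_mod_4(1)[OF od] by simp
      next
        assume "n\<^sup>2 \<ge> 4"
        then have "e * n\<^sup>2 \<ge> e * 4" using e0 by (intro mult_left_mono) auto
        then show False using eq' sq0 by linarith
      qed
    next
      case True
      \<comment> \<open>the second summand contains \<open>(\<beta> + \<gamma>) / 2\<close>: \<open>\<bar>a\<bar> = 1\<close>, the minimal value is \<open>d / 2\<close>, and \<open>2 d = p\<^sup>2 m'\<^sup>2 + d n\<^sup>2\<close> remains\<close>
      have ab: "(a + b) mod 4 = 3" using nG odd_a od True unfolding quarter_basis_def by presburger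
      have half: "\<exists>i j. z = of_int i / 2 \<and> w = of_int j / 2 \<and> (even i \<longleftrightarrow> even j)" if al: "algebraic_int (E x y z w)" for x y z w
      proof -
        obtain m n i j :: int where c: "z = of_int i / 4" "w = of_int j / 4" "even m \<longleftrightarrow> even i" "even i \<longleftrightarrow> even j"
          and imp: "(a + b) mod 4 = 3 \<Longrightarrow> even m \<and> 4 dvd m + n \<and> 4 dvd i + j"
          by (rule integers_b_even[OF True od al]) blast
        have "even i" "even j" "4 dvd i + j" using c(3,4) imp[OF ab] by blast+
        then obtain i' j' where "i = 2 * i'" "j = 2 * j'" by (meson evenE)
        moreover from this have "even i' \<longleftrightarrow> even j'" using \<open>4 dvd i + j\<close> by presburger
        ultimately show ?thesis using c(1,2) by (intro exI[of _ i'] exI[of _ j']) simp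
      qed
      obtain i3 j3 where c3: "z3 = of_int i3 / 2" "w3 = of_int j3 / 2" "even i3 \<longleftrightarrow> even j3" using half[OF alg[OF m3(1)]] by blast
      obtain k1 l1 where c1: "z1 = of_int k1 / 2" "w1 = of_int l1 / 2" "even k1 \<longleftrightarrow> even l1" using half[OF alg[OF m1(1)]] by blast
      have "i3 \<noteq> 0" using m3(2) c3 by auto
      have two: "i\<^sup>2 + j\<^sup>2 \<ge> 2" if "i \<noteq> 0 \<or> j \<noteq> 0" "even i \<longleftrightarrow> even j" for i j :: int
      proof -
        have 1: "u = 0 \<or> u\<^sup>2 \<ge> 1" "u = 0 \<or> odd u \<or> u\<^sup>2 \<ge> 4" "u\<^sup>2 \<ge> 0" for u :: int
          using scaled_square_bounds[of 1 u] by auto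
        show ?thesis using that 1[of i] 1[of j] by fastforce
      qed
      define g where "g = \<bar>a\<bar> * d"
      have g0: "g > 0" unfolding g_def using abs_ad_pos .
      have "E 0 0 (1/2) (1/2) = Em 4 0 0 2 2" by (simp add: Em_def)
      moreover have "E 0 0 (1/2) (1/2) \<in> \<O>" using half_beta_gamma_int[OF True od] E_in_F by simp
      moreover have "int p dvd 0" by simp
      ultimately have "E 0 0 (1/2) (1/2) \<in> P" unfolding Pn norm_ideal_def norm4_dvd_ramified[OF p] by blast
      then have "qf x1 y1 z1 w1 \<le> qf 0 0 (1/2) (1/2)" using minimal_le[OF m1(1)] by simp
      also have "\<dots> = of_int g / 2" unfolding qf_def g_def by (simp add: field_simps power2_eq_square)
      finally have up: "qf x1 y1 z1 w1 \<le> of_int g / 2" .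
      have "2 * g \<le> g * (i3\<^sup>2 + j3\<^sup>2)" using g0 two[of i3 j3] \<open>i3 \<noteq> 0\<close> c3(3) mult_left_mono[of 2 "i3\<^sup>2 + j3\<^sup>2" g] by simp
      then have "(of_int (2 * g) :: rat) \<le> of_int (g * (i3\<^sup>2 + j3\<^sup>2))" by (simp only: of_int_le_iff)
      then have "of_int g / 2 \<le> of_int g * (z3\<^sup>2 + w3\<^sup>2)" unfolding c3 by (simp add: field_simps power2_eq_square)
      also have "\<dots> \<le> qf x3 y3 z3 w3" unfolding g_def by (rule qf_lower(2))
      also have "\<dots> = qf x1 y1 z1 w1" by (rule minimal_unique[OF m3(1) m1(1)])
      finally have val: "qf x1 y1 z1 w1 = of_int g / 2" using up by simp
      then have "of_int g / 2 \<le> (of_int d :: rat)" using le_d[OF m1(1)] by simp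
      then have "(of_int g :: rat) \<le> of_int (2 * d)" by simp
      then have "g \<le> 2 * d" by (simp only: of_int_le_iff)
      then have "\<bar>a\<bar> \<le> 2" unfolding g_def using d0 by simp
      moreover have "odd \<bar>a\<bar>" using odd_a by simp
      ultimately have "\<bar>a\<bar> = 1" by presburger
      then have gd: "g = d" unfolding g_def by simp
      have "qf x1 y1 z1 w1 = of_int (int p * int p * m'\<^sup>2 + d * n\<^sup>2 + g * (k1\<^sup>2 + l1\<^sup>2)) / 4"
        unfolding qf_def mn h c1 g_def by (simp add: field_simps power2_eq_square)
      then have "of_int (int p * int p * m'\<^sup>2 + d * n\<^sup>2 + g * (k1\<^sup>2 + l1\<^sup>2)) = (of_int (2 * d) :: rat)"
        using val gd by simp
      then have eq: "int p * int p * m'\<^sup>2 + d * n\<^sup>2 + d * (k1\<^sup>2 + l1\<^sup>2) = 2 * d" unfolding gd by (simp only: of_int_eq_iff)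
      then have "int p * (int p * m'\<^sup>2 + e * n\<^sup>2 + e * (k1\<^sup>2 + l1\<^sup>2)) = int p * (2 * e)" unfolding e by (simp add: algebra_simps)
      then have eq': "int p * m'\<^sup>2 + e * n\<^sup>2 + e * (k1\<^sup>2 + l1\<^sup>2) = 2 * e" using pp by simp
      have en: "e * n\<^sup>2 \<ge> 0" using e0 by simp
      have "k1 = 0 \<and> l1 = 0"
      proof (rule ccontr)
        assume "\<not> (k1 = 0 \<and> l1 = 0)"
        then have "e * (k1\<^sup>2 + l1\<^sup>2) \<ge> e * 2" using two[of k1 l1] c1(3) e0 by (intro mult_left_mono) auto
        then show False using eq' sq0 en by linarith
      qed
      then have eq2: "int p * m'\<^sup>2 + e * n\<^sup>2 = 2 * e" using eq' by simp
      from n_cases show False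
      proof (elim disjE)
        assume "n = 0"
        then have "int p * m'\<^sup>2 = 2 * e" using eq2 by simp
        then have "int p dvd 2 * e" by (metis dvd_triv_left)
        then show False using p' p_2 pe prime_dvd_mult_iff by blast
      next
        assume "n\<^sup>2 = 1"
        then have "int p * m'\<^sup>2 = e" using eq2 by simp
        then have "int p dvd e" by (metis dvd_triv_left)
        then show False using pe by blast
      next
        assume "n\<^sup>2 \<ge> 4"
        then have "e * n\<^sup>2 \<ge> e * 4" using e0 by (intro mult_left_mono) auto
        then show False using eq2 sq0 e0 by linarith
      qed
    qed
  qed
qed

theorem well_rounded_ramified_iff:
  assumes p: "prime p" "int p dvd d" and P: "prime_above F p P"
  shows "well_rounded_ideal F P \<longleftrightarrow> quarter_basis \<and>
    (\<bar>a\<bar> = 1 \<and> d \<le> 5 * (int p)\<^sup>2 \<and> (int p)\<^sup>2 \<le> 5 * d \<or> \<bar>a\<bar> = 3 \<and> d \<le> (int p)\<^sup>2 \<and> (int p)\<^sup>2 \<le> 9 * d \<or>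
    \<bar>a\<bar> = 5 \<and> 7 * d \<le> 3 * (int p)\<^sup>2 \<and> (int p)\<^sup>2 \<le> 5 * d)"
  using well_rounded_ramified_quarter[OF _ p P] not_well_rounded_ramified[OF _ p P] by blast

theorem well_rounded_semiramified_iff:
  assumes p: "prime p" "int p dvd a" "\<not> QuadRes (int p) d" and P: "prime_above F p P"
  shows "well_rounded_ideal F P \<longleftrightarrow> quarter_basis \<and> d = 5 \<and> \<bar>a\<bar> \<le> (int p)\<^sup>2 \<and> (int p)\<^sup>2 \<le> 5 * \<bar>a\<bar>"
  using well_rounded_semiramified_quarter[OF _ p P] not_well_rounded_semiramified[OF _ p P] by blast

end

section \<open>Unique primes and their well-roundedness\<close>

theorem theorem1p6:
  fixes a b c d :: int and p :: nat
  assumes "squarefree a" and "odd a"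
    and "d = b\<^sup>2 + c\<^sup>2" and "squarefree d"
    and "b > 0" and "c > 0"
    and "coprime a d"
    and "prime p"
  shows "(\<not> (p = 2 \<and> [d = 5] (mod 8)) \<longrightarrow>
           ((\<exists>!P. prime_above (quartic_field a b d) p P) \<longleftrightarrow>
              int p dvd d \<or>
              (int p dvd a \<and> \<not> QuadRes (int p) d) \<or>
              (\<not> int p dvd a * b * c * d \<and> \<not> QuadRes (int p) d)))
       \<and> (\<forall>P. prime_above (quartic_field a b d) p P \<longrightarrow>
            (int p dvd d \<longrightarrow>
               primitive_ideal (quartic_field a b d) P \<and>
               (well_rounded_ideal (quartic_field a b d) P \<longleftrightarrow>
                  [d = 1] (mod 4) \<and> [b = 0] (mod 2) \<and> [a + b = 1] (mod 4) \<and>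
                  ((\<bar>a\<bar> = 1 \<and> 1 / 5 * real_of_int d \<le> (real p)\<^sup>2 \<and> (real p)\<^sup>2 \<le> 5 * real_of_int d) \<or>
                   (\<bar>a\<bar> = 3 \<and> real_of_int d \<le> (real p)\<^sup>2 \<and> (real p)\<^sup>2 \<le> 9 * real_of_int d) \<or>
                   (\<bar>a\<bar> = 5 \<and> 7 / 3 * real_of_int d \<le> (real p)\<^sup>2 \<and> (real p)\<^sup>2 \<le> 5 * real_of_int d))))
            \<and> (int p dvd a \<and> \<not> QuadRes (int p) d \<longrightarrow>
               primitive_ideal (quartic_field a b d) P \<and>
               (well_rounded_ideal (quartic_field a b d) P \<longleftrightarrow>
                  d = 5 \<and> b = 2 \<and> c = 1 \<and> [a + b = 1] (mod 4) \<and>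
                  \<bar>real_of_int a\<bar> \<le> (real p)\<^sup>2 \<and> (real p)\<^sup>2 \<le> 5 * \<bar>real_of_int a\<bar>))
            \<and> (\<not> int p dvd a * b * c * d \<and> \<not> QuadRes (int p) d \<longrightarrow>
               \<not> primitive_ideal (quartic_field a b d) P))"
proof -
  \<comment> \<open>the sign of \<open>c\<close> that makes \<open>a c \<equiv> 1 (mod 4)\<close> if \<open>c\<close> is odd\<close>
  define c' where "c' = (if odd c \<and> a * c mod 4 \<noteq> 1 then - c else c)"
  have ac: "a * c' mod 4 = 1" if "odd c'"
  proof (cases "a * c mod 4 = 1")
    case False
    have "odd c" using that unfolding c'_def by (auto split: if_splits)
    then have "odd (a * c)" using assms(2) by simp
    then have "a * c mod 4 = 3" using False mod_4_cases_odd by blast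
    then have "- (a * c) mod 4 = 1" by presburger
    then show ?thesis using False \<open>odd c\<close> unfolding c'_def by simp
  next
    case True
    then show ?thesis unfolding c'_def by simp
  qed
  have c'_sq: "c'\<^sup>2 = c\<^sup>2" and c'_nz: "c' \<noteq> 0" and c'_dvd: "int p dvd a * b * c' * d \<longleftrightarrow> int p dvd a * b * c * d"
    using assms(6) unfolding c'_def by simp_all
  interpret cyclic_quartic a b c' d
    using assms ac c'_sq c'_nz by unfold_locales simp_all
  have Q: "(real p)\<^sup>2 = real_of_int ((int p)\<^sup>2)" by simp
  have G: "quarter_basis \<longleftrightarrow> [d = 1] (mod 4) \<and> [b = 0] (mod 2) \<and> [a + b = 1] (mod 4)"
  proof -
    have "[d = 1] (mod 4) \<longleftrightarrow> odd d" using d_mod_4(1) unfolding cong_def by auto presburger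
    then show ?thesis unfolding quarter_basis_def by (auto simp: cong_def even_iff_mod_2_eq_zero)
  qed
  have ineq1: "1 / 5 * real_of_int d \<le> (real p)\<^sup>2 \<longleftrightarrow> d \<le> 5 * (int p)\<^sup>2"
  proof -
    have "1 / 5 * real_of_int d \<le> (real p)\<^sup>2 \<longleftrightarrow> real_of_int d \<le> real_of_int (5 * (int p)\<^sup>2)" unfolding Q by (simp add: mult.commute)
    then show ?thesis by (simp only: of_int_le_iff)
  qed
  have ineq7: "7 / 3 * real_of_int d \<le> (real p)\<^sup>2 \<longleftrightarrow> 7 * d \<le> 3 * (int p)\<^sup>2"
  proof -
    have "7 / 3 * real_of_int d \<le> (real p)\<^sup>2 \<longleftrightarrow> real_of_int (7 * d) \<le> real_of_int (3 * (int p)\<^sup>2)" unfolding Q by (auto simp: field_simps)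
    then show ?thesis by (simp only: of_int_le_iff)
  qed
  have ineqd: "real_of_int u \<le> (real p)\<^sup>2 \<longleftrightarrow> u \<le> (int p)\<^sup>2" for u unfolding Q by (simp only: of_int_le_iff)
  have inequ: "(real p)\<^sup>2 \<le> k * real_of_int u \<longleftrightarrow> (int p)\<^sup>2 \<le> l * u" if "k = real_of_int l" for k l u
  proof -
    have "(real p)\<^sup>2 \<le> k * real_of_int u \<longleftrightarrow> real_of_int ((int p)\<^sup>2) \<le> real_of_int (l * u)" unfolding Q that by simp
    then show ?thesis by (simp only: of_int_le_iff)
  qed
  have abs_a: "\<bar>real_of_int a\<bar> = real_of_int \<bar>a\<bar>" by simp
  have b2: "quarter_basis \<and> d = 5 \<longleftrightarrow> d = 5 \<and> b = 2 \<and> c = 1 \<and> [a + b = 1] (mod 4)"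
  proof
    assume L: "quarter_basis \<and> d = 5"
    then obtain k where k: "b = 2 * k" unfolding quarter_basis_def by (auto elim: evenE)
    have "b\<^sup>2 + c\<^sup>2 = 5" using assms(3) L by simp
    moreover have "c\<^sup>2 \<ge> 1" using assms(6) by (simp add: int_one_le_iff_zero_less)
    ultimately have "b\<^sup>2 < 3\<^sup>2" by simp
    then have "b < 3" by (rule power_less_imp_less_base) simp
    then have "b = 2" using assms(5) k by presburger
    then have "c\<^sup>2 = 1" using \<open>b\<^sup>2 + c\<^sup>2 = 5\<close> by simp
    then have "c = 1" using assms(6) by (auto simp: power2_eq_1_iff)
    then show "d = 5 \<and> b = 2 \<and> c = 1 \<and> [a + b = 1] (mod 4)" using L \<open>b = 2\<close> G by blast
  next
    assume R: "d = 5 \<and> b = 2 \<and> c = 1 \<and> [a + b = 1] (mod 4)"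
    then show "quarter_basis \<and> d = 5" unfolding G by (auto simp: cong_def)
  qed
  have n5: "(5::real) = real_of_int 5" "(9::real) = real_of_int 9" by simp_all
  have part1: "\<not> (p = 2 \<and> [d = 5] (mod 8)) \<longrightarrow>
           ((\<exists>!P. prime_above (quartic_field a b d) p P) \<longleftrightarrow> int p dvd d \<or> (int p dvd a \<and> \<not> QuadRes (int p) d) \<or>
              (\<not> int p dvd a * b * c * d \<and> \<not> QuadRes (int p) d))"
    using unique_prime_iff[OF assms(8)] unfolding c'_dvd by blast
  have part2: "primitive_ideal (quartic_field a b d) P \<and>
               (well_rounded_ideal (quartic_field a b d) P \<longleftrightarrow>
                  [d = 1] (mod 4) \<and> [b = 0] (mod 2) \<and> [a + b = 1] (mod 4) \<and>
                  ((\<bar>a\<bar> = 1 \<and> 1 / 5 * real_of_int d \<le> (real p)\<^sup>2 \<and> (real p)\<^sup>2 \<le> 5 * real_of_int d) \<or>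
                   (\<bar>a\<bar> = 3 \<and> real_of_int d \<le> (real p)\<^sup>2 \<and> (real p)\<^sup>2 \<le> 9 * real_of_int d) \<or>
                   (\<bar>a\<bar> = 5 \<and> 7 / 3 * real_of_int d \<le> (real p)\<^sup>2 \<and> (real p)\<^sup>2 \<le> 5 * real_of_int d)))"
    if "prime_above (quartic_field a b d) p P" "int p dvd d" for P
    using primitive_ramified[OF assms(8) that(2,1)] well_rounded_ramified_iff[OF assms(8) that(2,1)]
    unfolding ineq1 ineq7 ineqd inequ[OF n5(1)] inequ[OF n5(2)] G by blast
  have part3: "primitive_ideal (quartic_field a b d) P \<and>
               (well_rounded_ideal (quartic_field a b d) P \<longleftrightarrow>
                  d = 5 \<and> b = 2 \<and> c = 1 \<and> [a + b = 1] (mod 4) \<and>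
                  \<bar>real_of_int a\<bar> \<le> (real p)\<^sup>2 \<and> (real p)\<^sup>2 \<le> 5 * \<bar>real_of_int a\<bar>)"
    if "prime_above (quartic_field a b d) p P" "int p dvd a" "\<not> QuadRes (int p) d" for P
    using primitive_semiramified[OF assms(8) that(2,3,1)] well_rounded_semiramified_iff[OF assms(8) that(2,3,1)] b2
    unfolding abs_a ineqd inequ[OF n5(1)] by blast
  have part4: "\<not> primitive_ideal (quartic_field a b d) P"
    if "prime_above (quartic_field a b d) p P" "\<not> int p dvd a * b * c * d" "\<not> QuadRes (int p) d" for P
  proof -
    have "\<not> int p dvd a" using that(2) by auto
    then show ?thesis using not_primitive_inert[OF assms(8) _ that(3,1)] by blast
  qed
  show ?thesis using part1 part2 part3 part4 by blast
qed

end
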